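(* Let $A:(\Omega\cup\Omega_\delta)^2\times\Gamma\to\mathbb R$ be symmetric in its first two arguments and satisfy $0<r\le A(\mathbf x,\mathbf y,\boldsymbol\xi)\le R<\infty$ for all $\mathbf x,\mathbf y\in\Omega\cup\Omega_\delta$, $\boldsymbol\xi\in\Gamma$, and, for each $\boldsymbol\xi\in\Gamma$, $A(\cdot,\cdot,\boldsymbol\xi)\in C(\overline{(\Omega\cup\Omega_\delta)^2})$, with $a(\mathbf x,\boldsymbol\xi):=A(\mathbf x,\mathbf x,\boldsymbol\xi)$. Let $f$ be such that $\|f\|_{(S_\delta(\Omega))^\ast}$ is uniformly bounded for $\delta\in(0,\delta_0)$. For $\boldsymbol\xi\in\Gamma$ let $u^\delta(\cdot,\boldsymbol\xi)\in S_\delta(\Omega)$ be the weak solution of the nonlocal problem with coefficient $A(\cdot,\cdot,\boldsymbol\xi)$ and let $u^0(\cdot,\boldsymbol\xi)\in H_0^1(\Omega)$ be the weak solution of $-\nabla\cdot(a(\cdot,\boldsymbol\xi)\nabla u)=f$ in $\Omega$, $u=0$ on $\partial\Omega$. Then $$\lim_{\delta\to0}\|u^\delta-u^0\|_{L^2(\Omega)\otimes L^2_\rho(\Gamma)}=0 .$$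
   Context: $\Omega\subset\mathbb R^d$ ($d\ge1$) is a bounded Lipschitz domain; $\Omega_\delta=\{\mathbf x\in\mathbb R^d\setminus\Omega:\mathrm{dist}(\mathbf x,\partial\Omega)<\delta\}$; $B_\delta(\mathbf x)=\{\mathbf y:|\mathbf y-\mathbf x|<\delta\}$. Parameter space: $\Gamma=[-1,1]^N$, with a probability density $\rho:\Gamma\to\mathbb R^+$ for the random variable $\boldsymbol\xi=(\xi_{(1)},\dots,\xi_{(N)})$. $A$ is a random field (measurable in its arguments), independent of $\delta$. $\|u\|_{L^2(\Omega)\otimes L^2_\rho(\Gamma)}=\left(\int_\Gamma\|u(\cdot,\boldsymbol\xi)\|^2_{L^2(\Omega)}\rho(\boldsymbol\xi)d\boldsymbol\xi\right)^{1/2}$. Kernel: $\gamma_\delta(|\mathbf x-\mathbf y|)=\frac1{\delta^{d+2}}\gamma_1\!\left(\frac{|\mathbf x-\mathbf y|}{\delta}\right)$, equal to $\frac{D_0}{\delta^{d+2-s}|\mathbf x-\mathbf y|^s}$ for $|\mathbf x-\mathbf y|<\delta$ and $0$ otherwise ($D_0>0$), where $\gamma_1$ is nonnegative, nonincreasing, has a singularity of order $s$ at the origin, $\mathrm{supp}(\gamma_1)\subset B_1(\mathbf 0)$ and $\int_{B_1(\mathbf 0)}\gamma_1(|\mathbf z|)|\mathbf z|^2d\mathbf z=d$. $S_\delta(\Omega)=\{u\in L^2(\Omega\cup\Omega_\delta):\|u\|_{S_\delta(\Omega)}<\infty,\ u|_{\Omega_\delta}=0\}$, $\|u\|_{S_\delta(\Omega)}^2=\iint_{(\Omega\cup\Omega_\delta)^2}\gamma_\delta(|\mathbf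 y-\mathbf x|)(u(\mathbf y)-u(\mathbf x))^2d\mathbf y\,d\mathbf x$; $(S_\delta(\Omega))^\ast$ is its dual with the induced norm. The weak nonlocal problem for parameter $\boldsymbol\xi$: find $u\in S_\delta(\Omega)$ with $$\iint_{(\Omega\cup\Omega_\delta)^2}A(\mathbf x,\mathbf y,\boldsymbol\xi)\gamma_\delta(|\mathbf x-\mathbf y|)(u(\mathbf y)-u(\mathbf x))(v(\mathbf y)-v(\mathbf x))\,d\mathbf y\,d\mathbf x=\langle f,v\rangle\quad\forall v\in S_\delta(\Omega).$$ $\delta_0>0$ denotes a constant for which the (known) uniform nonlocal Poincaré inequality $\|v\|_{L^2(\Omega)}^2\le C\|v\|^2_{S_\delta(\Omega)}$, $v\in S_\delta(\Omega)$, holds with one constant $C$ for all $0<\delta<\delta_0$; horizons satisfy $\delta\in(0,\delta_0)$. $f$ is one fixed datum (independent of $\boldsymbol\xi$), viewed as a functional on every $S_\delta(\Omega)$ (consistently on $C_0^\infty(\Omega)$) and on $H_0^1(\Omega)$ (functions extended by zero). *)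

theory Defs
  imports "HOL-Analysis.Analysis"
begin

text \<open>
  Strongly Lipschitz domains: near each boundary point \<open>\<Omega>\<close> is, in some orthonormal
  coordinate system with vertical direction \<open>e\<close>, the region strictly above the graph of a
  Lipschitz function.  That function is only ever evaluated at projections to the hyperplane
  orthogonal to \<open>e\<close>; taking it Lipschitz on the whole space is no restriction.
\<close>

definition lipschitz_domain :: "'a::euclidean_space set \<Rightarrow> bool" where
  "lipschitz_domain \<Omega> \<longleftrightarrow>
     open \<Omega> \<and> connected \<Omega> \<and> \<Omega> \<noteq> {} \<and>
     (\<forall>p\<in>frontier \<Omega>. \<exists>e \<rho> L \<psi>. norm e = 1 \<and> \<rho> > 0 \<and> L-lipschitz_on UNIV \<psi> \<and>
        \<Omega> \<inter> ball p \<rho> = {x \<in> ball p \<rho>. (\<psi> (x - (x \<bullet> e) *\<^sub>R e) :: real) < x \<bullet> e})"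

definition collar :: "'a::euclidean_space set \<Rightarrow> real \<Rightarrow> 'a set" where
  "collar \<Omega> \<delta> = {x. x \<notin> \<Omega> \<and> infdist x (frontier \<Omega>) < \<delta>}"

definition extended_domain :: "'a::euclidean_space set \<Rightarrow> real \<Rightarrow> 'a set" where
  "extended_domain \<Omega> \<delta> = \<Omega> \<union> collar \<Omega> \<delta>"

definition param_space :: "(real ^ 'm) set" where
  "param_space = {\<xi>. \<forall>i. -1 \<le> \<xi> $ i \<and> \<xi> $ i \<le> 1}"

text \<open>
  Norms take values in \<open>ennreal\<close>, so that an infinite norm is not confused with a default
  value.  Elements of \<open>L\<^sup>2\<close> are represented by functions that are Borel measurable on
  the set in question; their values elsewhere are irrelevant.
\<close>

definition esqrt :: "ennreal \<Rightarrow> ennreal" where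
  "esqrt t = (if t = \<infinity> then \<infinity> else ennreal (sqrt (enn2real t)))"

definition L2_norm_on :: "'a::euclidean_space set \<Rightarrow> ('a \<Rightarrow> 'b::real_normed_vector) \<Rightarrow> ennreal" where
  "L2_norm_on S u = esqrt (\<integral>\<^sup>+x\<in>S. ennreal ((norm (u x))\<^sup>2) \<partial>lborel)"

definition L2_space :: "'a::euclidean_space set \<Rightarrow> ('a \<Rightarrow> 'b::real_normed_vector) set" where
  "L2_space S = {u. set_borel_measurable lborel S u \<and> L2_norm_on S u < \<infinity>}"

text \<open>
  Elements of \<open>L\<^sup>2(\<Omega>) \<otimes> L\<^sup>2\<^sub>\<rho>(\<Gamma>)\<close> are curried with the parameter first.
\<close>

definition L2_tensor_norm ::
  "'a::euclidean_space set \<Rightarrow> (real ^ 'm \<Rightarrow> real) \<Rightarrow> (real ^ 'm \<Rightarrow> 'a \<Rightarrow> real) \<Rightarrow> ennreal" where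
  "L2_tensor_norm \<Omega> \<rho> w =
     esqrt (\<integral>\<^sup>+\<xi>\<in>param_space. (L2_norm_on \<Omega> (w \<xi>))\<^sup>2 * ennreal (\<rho> \<xi>) \<partial>lborel)"

definition linear_functional_on :: "('a \<Rightarrow> real) set \<Rightarrow> (('a \<Rightarrow> real) \<Rightarrow> real) \<Rightarrow> bool" where
  "linear_functional_on V F \<longleftrightarrow>
     (\<forall>u\<in>V. \<forall>v\<in>V. F (\<lambda>x. u x + v x) = F u + F v) \<and>
     (\<forall>c. \<forall>u\<in>V. F (\<lambda>x. c * u x) = c * F u)"

text \<open>
  A linear functional of finite dual norm vanishes on functions of norm zero, hence is
  well defined on classes modulo equality almost everywhere.
\<close>

definition dual_norm ::
  "('a \<Rightarrow> real) set \<Rightarrow> (('a \<Rightarrow> real) \<Rightarrow> ennreal) \<Rightarrow> (('a \<Rightarrow> real) \<Rightarrow> real) \<Rightarrow> ennreal" where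
  "dual_norm V N F = (SUP v\<in>{v \<in> V. N v \<le> 1}. ennreal \<bar>F v\<bar>)"

definition scaled_kernel :: "nat \<Rightarrow> (real \<Rightarrow> real) \<Rightarrow> real \<Rightarrow> real \<Rightarrow> real" where
  "scaled_kernel d \<gamma>1 \<delta> t = \<gamma>1 (t / \<delta>) / \<delta> ^ (d + 2)"

text \<open>
  The unscaled kernel in dimension \<open>d = DIM('a)\<close>.  Its value at \<open>0\<close> is left open, as it only
  enters on the (null) diagonal.  The support condition is read as vanishing outside the open
  unit ball.  Monotonicity forces \<open>0 \<le> s\<close>, and the normalisation forces \<open>s < d + 2\<close> (the
  integral of a non-integrable function would be \<open>0\<close>).
\<close>

definition nonlocal_kernel :: "'a::euclidean_space itself \<Rightarrow> real \<Rightarrow> real \<Rightarrow> (real \<Rightarrow> real) \<Rightarrow> bool" where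
  "nonlocal_kernel _ D0 s \<gamma>1 \<longleftrightarrow>
     D0 > 0 \<and>
     (\<forall>t. 0 < t \<and> t < 1 \<longrightarrow> \<gamma>1 t = D0 / t powr s) \<and>
     (\<forall>t\<ge>1. \<gamma>1 t = 0) \<and>
     (\<forall>t>0. \<gamma>1 t \<ge> 0) \<and>
     antimono_on {0<..} \<gamma>1 \<and>
     (LINT z:ball (0::'a) 1|lborel. \<gamma>1 (norm z) * (norm z)\<^sup>2) = real DIM('a)"

definition S_norm :: "(real \<Rightarrow> real) \<Rightarrow> 'a::euclidean_space set \<Rightarrow> real \<Rightarrow> ('a \<Rightarrow> real) \<Rightarrow> ennreal" where
  "S_norm \<gamma>1 \<Omega> \<delta> u =
     esqrt (\<integral>\<^sup>+(x, y)\<in>extended_domain \<Omega> \<delta> \<times> extended_domain \<Omega> \<delta>.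
       ennreal (scaled_kernel DIM('a) \<gamma>1 \<delta> (dist y x) * (u y - u x)\<^sup>2) \<partial>lborel)"

definition S_space :: "(real \<Rightarrow> real) \<Rightarrow> 'a::euclidean_space set \<Rightarrow> real \<Rightarrow> ('a \<Rightarrow> real) set" where
  "S_space \<gamma>1 \<Omega> \<delta> = {u \<in> L2_space (extended_domain \<Omega> \<delta>).
     S_norm \<gamma>1 \<Omega> \<delta> u < \<infinity> \<and> (AE x in lborel. x \<in> collar \<Omega> \<delta> \<longrightarrow> u x = 0)}"

definition nonlocal_weak_solution ::
  "(real \<Rightarrow> real) \<Rightarrow> 'a::euclidean_space set \<Rightarrow> real \<Rightarrow> ('a \<Rightarrow> 'a \<Rightarrow> real) \<Rightarrow>
     (('a \<Rightarrow> real) \<Rightarrow> real) \<Rightarrow> ('a \<Rightarrow> real) \<Rightarrow> bool" where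
  "nonlocal_weak_solution \<gamma>1 \<Omega> \<delta> A F u \<longleftrightarrow>
     u \<in> S_space \<gamma>1 \<Omega> \<delta> \<and>
     (\<forall>v\<in>S_space \<gamma>1 \<Omega> \<delta>.
        (LINT (x, y):extended_domain \<Omega> \<delta> \<times> extended_domain \<Omega> \<delta>|lborel.
           A x y * scaled_kernel DIM('a) \<gamma>1 \<delta> (dist x y) * (u y - u x) * (v y - v x)) = F v)"

primrec C_k :: "nat \<Rightarrow> ('a::euclidean_space \<Rightarrow> real) \<Rightarrow> bool" where
  "C_k 0 \<phi> \<longleftrightarrow> continuous_on UNIV \<phi>"
| "C_k (Suc k) \<phi> \<longleftrightarrow> (\<forall>x. \<phi> differentiable (at x)) \<and>
     (\<forall>b\<in>Basis. C_k k (\<lambda>x. frechet_derivative \<phi> (at x) b))"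

text \<open>\<open>C\<^sub>0\<^sup>\<infinity>(\<Omega>)\<close>, as functions on the whole space (extended by zero).\<close>

definition test_functions :: "'a::euclidean_space set \<Rightarrow> ('a \<Rightarrow> real) set" where
  "test_functions \<Omega> = {\<phi>. (\<forall>k. C_k k \<phi>) \<and>
     compact (closure {x. \<phi> x \<noteq> 0}) \<and> closure {x. \<phi> x \<noteq> 0} \<subseteq> \<Omega>}"

definition is_weak_gradient :: "'a::euclidean_space set \<Rightarrow> ('a \<Rightarrow> real) \<Rightarrow> ('a \<Rightarrow> 'a) \<Rightarrow> bool" where
  "is_weak_gradient \<Omega> u g \<longleftrightarrow> g \<in> L2_space \<Omega> \<and>
     (\<forall>\<phi>\<in>test_functions \<Omega>. \<forall>b\<in>Basis.
        (LINT x:\<Omega>|lborel. u x * frechet_derivative \<phi> (at x) b) =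
        - (LINT x:\<Omega>|lborel. (g x \<bullet> b) * \<phi> x))"

definition H1_space :: "'a::euclidean_space set \<Rightarrow> ('a \<Rightarrow> real) set" where
  "H1_space \<Omega> = {u \<in> L2_space \<Omega>. \<exists>g. is_weak_gradient \<Omega> u g}"

text \<open>Meaningful for \<open>u\<close> in \<open>H1_space \<Omega>\<close>, where it is unique up to null sets.\<close>

definition weak_gradient :: "'a::euclidean_space set \<Rightarrow> ('a \<Rightarrow> real) \<Rightarrow> 'a \<Rightarrow> 'a" where
  "weak_gradient \<Omega> u = (SOME g. is_weak_gradient \<Omega> u g)"

definition H1_norm :: "'a::euclidean_space set \<Rightarrow> ('a \<Rightarrow> real) \<Rightarrow> ennreal" where
  "H1_norm \<Omega> u = esqrt ((L2_norm_on \<Omega> u)\<^sup>2 + (L2_norm_on \<Omega> (weak_gradient \<Omega> u))\<^sup>2)"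

definition H10_space :: "'a::euclidean_space set \<Rightarrow> ('a \<Rightarrow> real) set" where
  "H10_space \<Omega> = {u \<in> H1_space \<Omega>. \<exists>\<phi>. (\<forall>n::nat. \<phi> n \<in> test_functions \<Omega>) \<and>
     (\<lambda>n. H1_norm \<Omega> (\<lambda>x. u x - \<phi> n x)) \<longlonglongrightarrow> 0}"

definition local_weak_solution ::
  "'a::euclidean_space set \<Rightarrow> ('a \<Rightarrow> real) \<Rightarrow> (('a \<Rightarrow> real) \<Rightarrow> real) \<Rightarrow> ('a \<Rightarrow> real) \<Rightarrow> bool" where
  "local_weak_solution \<Omega> a F u \<longleftrightarrow>
     u \<in> H10_space \<Omega> \<and>
     (\<forall>v\<in>H10_space \<Omega>.
        (LINT x:\<Omega>|lborel. a x * (weak_gradient \<Omega> u x \<bullet> weak_gradient \<Omega> v x)) = F v)"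

end

theory Submission
  imports Defs
begin

text \<open>
  Fix the parameter. Coercivity and the uniform bound on the data bound the solutions \<open>u\<^sup>\<delta>\<close> in the
  nonlocal energy norms. Near each boundary point mollify at scale \<open>\<delta>\<close> with a kernel shifted so
  that only values from further inside the Lipschitz domain are used, and glue with a partition of
  unity: this turns \<open>u\<^sup>\<delta>\<close> into test functions \<open>w\<^sup>\<delta>\<close> that are bounded in \<open>H\<^sup>1\<close> and differ from
  \<open>u\<^sup>\<delta>\<close> by \<open>O(\<delta>)\<close> in \<open>L\<^sup>2\<close>. A change of variables, the isotropy of the kernel and a polynomial
  approximation of the coefficient show that the nonlocal form of \<open>u\<^sup>\<delta>\<close> against a fixed test
  function tends to the local form of \<open>w\<^sup>\<delta>\<close>; hence \<open>w\<^sup>\<delta> - u\<^sup>0\<close> is weakly null in the energy space.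
  Weakly null sequences are strongly null in \<open>L\<^sup>2\<close>: by a Banach-Saks argument their mollifications
  tend to zero pointwise. The parameter is integrated by dominated convergence, with the uniform
  bound coming from the Poincare inequality.
\<close>

section \<open>Smooth functions and bump functions\<close>

text \<open>For s < d the kernel is integrable and \<open>S_space\<close> carries no regularity
  beyond L2; moreover the space changes with \<delta>. The obstacle is therefore to find compactness
  in one fixed space. The regularisation draws only on the lower bound D0 / \<delta>^(d+2) of the
  kernel within its range: it turns the energy into plain squared differences over distances below
  \<delta>, which is what a mollifier at scale \<delta> can absorb. The Lipschitz boundary keeps the
  mollified functions compactly supported in \<Omega>, so that test functions alone carry the weak
  convergence, and u0 is represented by test functions approximating it in H1. As both sequences
  produce the same limit f0 against every test function, no subsequence is extracted and no
  completion is formed. The coefficient is merely continuous, whereas consistency of the form moves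
  a difference quotient from u onto the flux a times grad \<psi>; replacing a by a polynomial makes
  that flux a test function. The value d in the normalisation of the kernel makes its second-moment
  matrix the identity, which is why no constant appears in the limit equation.\<close>

definition smooth :: "('a::euclidean_space \<Rightarrow> real) \<Rightarrow> bool" where
  "smooth \<phi> \<longleftrightarrow> (\<forall>k. C_k k \<phi>)"

definition pd :: "'a::euclidean_space \<Rightarrow> ('a \<Rightarrow> real) \<Rightarrow> 'a \<Rightarrow> real" where
  "pd b \<phi> x = frechet_derivative \<phi> (at x) b"

text \<open>Supplying the derivative as a separate function avoids computing with
  \<open>frechet_derivative\<close>; the closure properties below are inductions that pass through
  this rule.\<close>

lemma C_k_SucI:
  assumes "\<And>x. (\<phi> has_derivative D x) (at x)" "\<And>b. b \<in> Basis \<Longrightarrow> C_k k (\<lambda>x. D x b)"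
  shows "C_k (Suc k) \<phi>"
proof -
  have "D = (\<lambda>x. frechet_derivative \<phi> (at x))"
    by (rule ext) (rule frechet_derivative_at[OF assms(1)])
  then show ?thesis
    using assms by (auto simp: differentiable_def)
qed

lemma C_k_SucD:
  assumes "C_k (Suc k) \<phi>"
  shows "(\<phi> has_derivative frechet_derivative \<phi> (at x)) (at x)"
    "b \<in> Basis \<Longrightarrow> C_k k (pd b \<phi>)"
  using assms by (auto simp: pd_def[abs_def] frechet_derivative_works[symmetric])

lemma C_k_mono: "C_k (Suc k) \<phi> \<Longrightarrow> C_k k \<phi>"
proof (induction k arbitrary: \<phi>)
  case 0
  then show ?case
    by (auto simp: continuous_on_eq_continuous_within intro: differentiable_imp_continuous_within)
next
  case (Suc k)
  then show ?case
    by (metis C_k.simps(2))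
qed

lemma C_k_const: "C_k k (\<lambda>x. c)"
proof (induction k arbitrary: c)
  case (Suc k)
  show ?case
    by (rule C_k_SucI[where D="\<lambda>x h. 0"]) (auto intro: Suc)
qed auto

lemma C_k_add: "C_k k f \<Longrightarrow> C_k k g \<Longrightarrow> C_k k (\<lambda>x. f x + g x)"
proof (induction k arbitrary: f g)
  case (Suc k)
  show ?case
    by (rule C_k_SucI[OF has_derivative_add[OF C_k_SucD(1)[OF Suc.prems(1)] C_k_SucD(1)[OF Suc.prems(2)]]])
      (use Suc in auto)
qed (auto intro: continuous_intros)

lemma C_k_mult: "C_k k f \<Longrightarrow> C_k k g \<Longrightarrow> C_k k (\<lambda>x. f x * g x)"
proof (induction k arbitrary: f g)
  case (Suc k)
  show ?case
  proof (rule C_k_SucI[OF has_derivative_mult[OF C_k_SucD(1)[OF Suc.prems(1)] C_k_SucD(1)[OF Suc.prems(2)]]])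
    fix b :: 'a assume b: "b \<in> Basis"
    have "C_k k f" "C_k k g" using Suc.prems C_k_mono by blast+
    then show "C_k k (\<lambda>x. f x * frechet_derivative g (at x) b + frechet_derivative f (at x) b * g x)"
      using b Suc.prems Suc.IH by (intro C_k_add) auto
  qed
qed (auto intro: continuous_intros)

lemma C_k_bounded_linear: "bounded_linear f \<Longrightarrow> C_k k f"
proof (cases k)
  case (Suc m)
  assume "bounded_linear f"
  then show ?thesis
    unfolding Suc by (intro C_k_SucI[where D="\<lambda>x. f"] C_k_const) (rule bounded_linear_imp_has_derivative)
qed (auto simp: linear_continuous_on)

lemma C_k_inverse:
  assumes nz: "\<And>x. f x \<noteq> (0::real)"
  shows "C_k k f \<Longrightarrow> C_k k (\<lambda>x. inverse (f x))"
proof (induction k)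
  case (Suc k)
  show ?case
  proof (rule C_k_SucI[OF Deriv.has_derivative_inverse[OF nz C_k_SucD(1)[OF Suc.prems]]])
    fix b :: 'a assume b: "b \<in> Basis"
    have "C_k k (\<lambda>x. (-1) * (inverse (f x) * frechet_derivative f (at x) b * inverse (f x)))"
      using Suc b C_k_mono by (intro C_k_mult C_k_const) auto
    then show "C_k k (\<lambda>x. - (inverse (f x) * frechet_derivative f (at x) b * inverse (f x)))"
      by simp
  qed
qed (use nz in \<open>auto intro: continuous_intros\<close>)

text \<open>The functions \<open>p(1/t) exp(-1/t)\<close>, extended by zero to \<open>t \<le> 0\<close>, are closed under differentiation.\<close>

definition flat :: "real poly \<Rightarrow> real \<Rightarrow> real" where
  "flat p t = (if t > 0 then poly p (1 / t) * exp (- (1 / t)) else 0)"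

lemma poly_exp_tendsto_0: "((\<lambda>s. poly p s * exp (- s)) \<longlongrightarrow> (0::real)) at_top"
proof (induction p)
  case (pCons a p)
  have 1: "((\<lambda>s::real. a * exp (- s)) \<longlongrightarrow> a * 0) at_top"
    by (intro tendsto_mult tendsto_const filterlim_compose[OF exp_at_bot] filterlim_uminus_at_bot_at_top)
  have 2: "((\<lambda>s. s * (poly p s * exp (- s))) \<longlongrightarrow> (0::real)) at_top"
  proof -
    have "poly p s * s * exp (- s) = (\<Sum>i\<le>degree p. coeff p i * (s ^ Suc i * exp (-s)))" for s
      by (simp add: poly_altdef sum_distrib_right sum_distrib_left mult_ac)
    moreover have "((\<lambda>s. \<Sum>i\<le>degree p. coeff p i * (s ^ Suc i * exp (-s))) \<longlongrightarrow> (\<Sum>i\<le>degree p. coeff p i * 0)) at_top"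
    proof (intro tendsto_sum tendsto_mult tendsto_const)
      fix i
      show "((\<lambda>s. s ^ Suc i * exp (- s)) \<longlongrightarrow> (0::real)) at_top"
        using tendsto_power_div_exp_0[of "Suc i"] by (simp add: exp_minus field_simps)
    qed
    ultimately show ?thesis by (simp add: mult_ac)
  qed
  from tendsto_add[OF 1 2] show ?case by (simp add: algebra_simps)
qed simp

text \<open>With s = 1/t one has d/dt = - s^2 d/ds, and the derivative of p(s) exp(-s) in s is (p' -
  p)(s) exp(-s). This is the origin of the polynomial s^2 (p - p').\<close>

lemma flat_has_field_derivative:
  "(flat p has_field_derivative flat ([:0,0,1:] * (p - pderiv p)) t) (at t)"
proof -
  consider "t > 0" | "t < 0" | "t = 0" by linarith
  then show ?thesis
  proof cases
    case 1
    have "((\<lambda>t. poly p (1 / t) * exp (- (1 / t))) has_field_derivative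
        flat ([:0,0,1:] * (p - pderiv p)) t) (at t)"
      using 1 by (auto intro!: derivative_eq_intros poly_DERIV[THEN DERIV_chain2]
          simp: flat_def field_simps power2_eq_square)
    then show ?thesis
      by (rule has_field_derivative_transform_within_open[where S="{0<..}"]) (use 1 in \<open>auto simp: flat_def\<close>)
  next
    case 2
    have "((\<lambda>t. 0) has_field_derivative flat ([:0,0,1:] * (p - pderiv p)) t) (at t)"
      using 2 by (auto simp: flat_def)
    then show ?thesis
      by (rule has_field_derivative_transform_within_open[where S="{..<0}"]) (use 2 in \<open>auto simp: flat_def\<close>)
  next
    case 3
    \<comment> \<open>From the right, the difference quotient at 0 is s p(s) exp(-s) with s = 1/t,
      an expression of the same decaying kind with \<open>pCons 0 p\<close> in place of p.\<close>
    have r: "((\<lambda>t. flat p t / t) \<longlongrightarrow> 0) (at_right 0)"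
    proof -
      have "((\<lambda>t. poly (pCons 0 p) (inverse t) * exp (- inverse t)) \<longlongrightarrow> 0) (at_right (0::real))"
        by (rule filterlim_compose[OF poly_exp_tendsto_0 filterlim_inverse_at_top_right])
      moreover have "\<forall>\<^sub>F t in at_right (0::real). poly (pCons 0 p) (inverse t) * exp (- inverse t) = flat p t / t"
        by (auto simp: eventually_at_right_field flat_def field_simps intro!: exI[of _ 1])
      ultimately show ?thesis by (rule Lim_transform_eventually)
    qed
    have l: "((\<lambda>t. flat p t / t) \<longlongrightarrow> 0) (at_left 0)"
    proof -
      have "\<forall>\<^sub>F t in at_left (0::real). 0 = flat p t / t"
        by (auto simp: eventually_at_left_field flat_def intro!: exI[of _ "-1"])
      then show ?thesis by (rule Lim_transform_eventually[OF tendsto_const])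
    qed
    have "((\<lambda>t. flat p t / t) \<longlongrightarrow> 0) (at 0)"
      using l r filterlim_split_at by blast
    then show ?thesis
      using 3 by (simp add: has_field_derivative_iff flat_def)
  qed
qed

text \<open>The induction generalises the polynomial, since every derivative replaces it by another
  one.\<close>

lemma C_k_flat: "C_k k g \<Longrightarrow> C_k k (\<lambda>x. flat p (g x))"
proof (induction k arbitrary: p)
  case 0
  have "continuous_on UNIV (flat p)"
    using flat_has_field_derivative DERIV_isCont continuous_at_imp_continuous_on by blast
  with 0 show ?case
    by (auto intro: continuous_on_compose2)
next
  case (Suc k)
  show ?case
  proof (rule C_k_SucI)
    fix x
    show "((\<lambda>x. flat p (g x)) has_derivative
        (\<lambda>h. flat ([:0,0,1:] * (p - pderiv p)) (g x) * frechet_derivative g (at x) h)) (at x)"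
      using has_derivative_compose[OF C_k_SucD(1)[OF Suc.prems]
          flat_has_field_derivative[unfolded has_field_derivative_def]] by simp
  next
    fix b :: 'a assume "b \<in> Basis"
    then show "C_k k (\<lambda>x. flat ([:0,0,1:] * (p - pderiv p)) (g x) * frechet_derivative g (at x) b)"
      using Suc C_k_mono by (intro C_k_mult Suc.IH) auto
  qed
qed

lemma smooth_const [intro, simp]: "smooth (\<lambda>x. c)"
  by (simp add: smooth_def C_k_const)

lemma smooth_add [intro]: "smooth f \<Longrightarrow> smooth g \<Longrightarrow> smooth (\<lambda>x. f x + g x)"
  by (simp add: smooth_def C_k_add)

lemma smooth_mult [intro]: "smooth f \<Longrightarrow> smooth g \<Longrightarrow> smooth (\<lambda>x. f x * g x)"
  by (simp add: smooth_def C_k_mult)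

lemma smooth_diff [intro]: "smooth f \<Longrightarrow> smooth g \<Longrightarrow> smooth (\<lambda>x. f x - g x)"
  using smooth_add[OF _ smooth_mult[OF smooth_const[of "-1"], of g]] by fastforce

lemma smooth_sum [intro]: "(\<And>i. i \<in> I \<Longrightarrow> smooth (f i)) \<Longrightarrow> smooth (\<lambda>x. \<Sum>i\<in>I. f i x)"
  by (induction I rule: infinite_finite_induct) auto

lemma smooth_bounded_linear: "bounded_linear f \<Longrightarrow> smooth f"
  by (simp add: smooth_def C_k_bounded_linear)

lemma smooth_divide:
  "smooth f \<Longrightarrow> smooth g \<Longrightarrow> (\<And>x. g x \<noteq> 0) \<Longrightarrow> smooth (\<lambda>x. f x / g x)"
  by (simp add: smooth_def divide_inverse C_k_mult C_k_inverse)

lemma smooth_flat: "smooth g \<Longrightarrow> smooth (\<lambda>x. flat p (g x))"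
  by (simp add: smooth_def C_k_flat)

lemma smooth_real_polynomial_function: "real_polynomial_function f \<Longrightarrow> smooth f"
  by (induction rule: real_polynomial_function.induct) (auto intro: smooth_bounded_linear)

lemma smooth_has_derivative:
  assumes "smooth \<phi>"
  shows "(\<phi> has_derivative frechet_derivative \<phi> (at x)) (at x)"
  using assms C_k_SucD(1) unfolding smooth_def by blast

lemma frechet_derivative_pd:
  assumes "smooth \<phi>"
  shows "frechet_derivative \<phi> (at x) h = (\<Sum>b\<in>Basis. (h \<bullet> b) * pd b \<phi> x)"
proof -
  have l: "linear (frechet_derivative \<phi> (at x))"
    using smooth_has_derivative[OF assms] has_derivative_linear by blast
  have "frechet_derivative \<phi> (at x) h = frechet_derivative \<phi> (at x) (\<Sum>b\<in>Basis. (h \<bullet> b) *\<^sub>R b)"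
    by (simp add: euclidean_representation)
  also have "\<dots> = (\<Sum>b\<in>Basis. (h \<bullet> b) * pd b \<phi> x)"
    using l by (simp add: linear_sum linear_scale pd_def)
  finally show ?thesis .
qed

lemma smooth_has_derivative_pd:
  "smooth \<phi> \<Longrightarrow> (\<phi> has_derivative (\<lambda>h. \<Sum>b\<in>Basis. (h \<bullet> b) * pd b \<phi> x)) (at x)"
  using smooth_has_derivative[of \<phi> x] by (simp add: frechet_derivative_pd[symmetric])

lemma pd_eqI: "(\<phi> has_derivative D) (at x) \<Longrightarrow> pd b \<phi> x = D b"
  unfolding pd_def using frechet_derivative_at by metis

lemma smooth_pd: "smooth \<phi> \<Longrightarrow> b \<in> Basis \<Longrightarrow> smooth (pd b \<phi>)"
  using C_k_SucD(2) unfolding smooth_def by blast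

lemma smooth_continuous_on: "smooth \<phi> \<Longrightarrow> continuous_on S \<phi>"
  unfolding smooth_def by (metis C_k.simps(1) continuous_on_subset subset_UNIV)

lemma smooth_borel_measurable: "smooth \<phi> \<Longrightarrow> \<phi> \<in> borel_measurable borel"
  by (simp add: borel_measurable_continuous_onI smooth_continuous_on)

lemma pd_add: "smooth f \<Longrightarrow> smooth g \<Longrightarrow> pd b (\<lambda>x. f x + g x) x = pd b f x + pd b g x"
  unfolding pd_def[of b f] pd_def[of b g]
  by (rule pd_eqI) (intro derivative_intros smooth_has_derivative)

lemma pd_mult: "smooth f \<Longrightarrow> smooth g \<Longrightarrow> pd b (\<lambda>x. f x * g x) x = f x * pd b g x + pd b f x * g x"
  unfolding pd_def[of b f] pd_def[of b g]
  by (rule pd_eqI) (intro derivative_intros smooth_has_derivative)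

lemma pd_const: "pd b (\<lambda>x. c) x = 0"
  by (simp add: pd_def)

lemma pd_cmult: "smooth f \<Longrightarrow> pd b (\<lambda>x. c * f x) x = c * pd b f x"
  by (simp add: pd_mult pd_const)

lemma pd_diff: "smooth f \<Longrightarrow> smooth g \<Longrightarrow> pd b (\<lambda>x. f x - g x) x = pd b f x - pd b g x"
  unfolding pd_def[of b f] pd_def[of b g]
  by (rule pd_eqI) (intro derivative_intros smooth_has_derivative)

lemma pd_sum:
  "(\<And>i. i \<in> I \<Longrightarrow> smooth (f i)) \<Longrightarrow> pd b (\<lambda>x. \<Sum>i\<in>I. f i x) x = (\<Sum>i\<in>I. pd b (f i) x)"
  by (induction I rule: infinite_finite_induct) (auto simp: pd_const pd_add smooth_sum)

section \<open>Bump functions on balls\<close>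

definition bump :: "'a::euclidean_space \<Rightarrow> real \<Rightarrow> 'a \<Rightarrow> real" where
  "bump c r x = flat 1 (r\<^sup>2 - (x - c) \<bullet> (x - c))"

lemma bump_nonneg: "bump c r x \<ge> 0"
  by (simp add: bump_def flat_def)

lemma bump_pos_iff: "r > 0 \<Longrightarrow> bump c r x > 0 \<longleftrightarrow> x \<in> ball c r"
proof -
  assume "r > 0"
  then have "(x - c) \<bullet> (x - c) < r\<^sup>2 \<longleftrightarrow> norm (x - c) < r"
    by (metis abs_norm_cancel abs_of_pos power2_norm_eq_inner real_sqrt_abs real_sqrt_less_iff)
  then show ?thesis
    by (simp add: bump_def flat_def dist_norm norm_minus_commute)
qed

lemma smooth_bump: "smooth (bump c r)"
proof -
  have "smooth (\<lambda>x. \<Sum>b\<in>Basis. (x \<bullet> b - c \<bullet> b) * (x \<bullet> b - c \<bullet> b))"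
    by (intro smooth_sum smooth_mult smooth_diff smooth_bounded_linear bounded_linear_inner_left smooth_const)
  then have "smooth (\<lambda>x. (x - c) \<bullet> (x - c))"
    by (subst euclidean_inner) (simp add: inner_diff_left)
  then show ?thesis
    unfolding bump_def[abs_def] by (intro smooth_flat smooth_diff smooth_const)
qed

section \<open>Test functions\<close>

lemma test_functionsI:
  assumes "smooth \<phi>" "compact K" "K \<subseteq> \<Omega>" "\<And>x. x \<notin> K \<Longrightarrow> \<phi> x = 0"
  shows "\<phi> \<in> test_functions \<Omega>"
proof -
  have "{x. \<phi> x \<noteq> 0} \<subseteq> K" using assms(4) by auto
  then have sub: "closure {x. \<phi> x \<noteq> 0} \<subseteq> K"
    using assms(2) by (simp add: closure_minimal compact_imp_closed)
  then have "compact (closure {x. \<phi> x \<noteq> 0})"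
    using assms(2) by (metis closed_closure compact_Int_closed inf.absorb2)
  then show ?thesis
    using sub assms by (auto simp: test_functions_def smooth_def)
qed

text \<open>The closed support has an open complement, so the function vanishes near every outside
  point and its partial derivatives vanish there as well. This allows integrals over \<Omega> to be
  replaced by integrals over the whole space.\<close>

lemma test_functionsE:
  assumes "\<phi> \<in> test_functions \<Omega>"
  obtains K where "smooth \<phi>" "compact K" "K \<subseteq> \<Omega>" "\<And>x. x \<notin> K \<Longrightarrow> \<phi> x = 0"
    "\<And>b x. x \<notin> K \<Longrightarrow> pd b \<phi> x = 0"
proof
  let ?K = "closure {x. \<phi> x \<noteq> 0}"
  show "smooth \<phi>" "compact ?K" "?K \<subseteq> \<Omega>"
    using assms by (auto simp: test_functions_def smooth_def)
  show z: "\<phi> x = 0" if "x \<notin> ?K" for x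
    using that closure_subset[of "{x. \<phi> x \<noteq> 0}"] by blast
  show "pd b \<phi> x = 0" if "x \<notin> ?K" for b x
  proof -
    have "((\<lambda>x. 0) has_derivative (\<lambda>h. 0)) (at x)" by simp
    then have "(\<phi> has_derivative (\<lambda>h. 0)) (at x)"
      by (rule has_derivative_transform_within_open[where s="- ?K"]) (use that z[symmetric] in \<open>simp_all only: Compl_iff open_Compl closed_closure not_False_eq_True\<close>)
    then show ?thesis
      by (rule pd_eqI)
  qed
qed

lemma test_smooth: "\<phi> \<in> test_functions \<Omega> \<Longrightarrow> smooth \<phi>"
  by (simp add: test_functions_def smooth_def)

lemma test_zero: "\<phi> \<in> test_functions \<Omega> \<Longrightarrow> x \<notin> \<Omega> \<Longrightarrow> \<phi> x = 0"
  by (elim test_functionsE) auto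

lemma test_pd_zero: "\<phi> \<in> test_functions \<Omega> \<Longrightarrow> x \<notin> \<Omega> \<Longrightarrow> pd b \<phi> x = 0"
  by (elim test_functionsE) auto

lemma test_mono: "\<phi> \<in> test_functions \<Omega> \<Longrightarrow> \<Omega> \<subseteq> \<Omega>' \<Longrightarrow> \<phi> \<in> test_functions \<Omega>'"
  by (auto simp: test_functions_def)

lemma test_pd: "\<phi> \<in> test_functions \<Omega> \<Longrightarrow> b \<in> Basis \<Longrightarrow> pd b \<phi> \<in> test_functions \<Omega>"
  by (elim test_functionsE) (auto intro!: test_functionsI smooth_pd)

lemma test_mult: "smooth f \<Longrightarrow> \<phi> \<in> test_functions \<Omega> \<Longrightarrow> (\<lambda>x. f x * \<phi> x) \<in> test_functions \<Omega>"
  by (elim test_functionsE) (auto intro!: test_functionsI smooth_mult)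

lemma test_cmult: "\<phi> \<in> test_functions \<Omega> \<Longrightarrow> (\<lambda>x. c * \<phi> x) \<in> test_functions \<Omega>"
  by (rule test_mult) auto

lemma test_add:
  assumes "\<phi> \<in> test_functions \<Omega>" "\<psi> \<in> test_functions \<Omega>"
  shows "(\<lambda>x. \<phi> x + \<psi> x) \<in> test_functions \<Omega>"
proof -
  obtain K L where "smooth \<phi>" "compact K" "K \<subseteq> \<Omega>" "\<And>x. x \<notin> K \<Longrightarrow> \<phi> x = 0"
    "smooth \<psi>" "compact L" "L \<subseteq> \<Omega>" "\<And>x. x \<notin> L \<Longrightarrow> \<psi> x = 0"
    using assms by (metis test_functionsE)
  then show ?thesis
    by (intro test_functionsI[where K="K \<union> L"] smooth_add compact_Un) auto
qed

lemma test_0: "(\<lambda>x. 0) \<in> test_functions \<Omega>"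
  by (rule test_functionsI[where K="{}"]) auto

lemma test_diff:
  "\<phi> \<in> test_functions \<Omega> \<Longrightarrow> \<psi> \<in> test_functions \<Omega> \<Longrightarrow> (\<lambda>x. \<phi> x - \<psi> x) \<in> test_functions \<Omega>"
  using test_add[of \<phi> \<Omega> "\<lambda>x. (-1) * \<psi> x"] test_cmult[of \<psi> \<Omega> "-1"] by simp

lemma test_sum:
  "(\<And>i. i \<in> I \<Longrightarrow> f i \<in> test_functions \<Omega>) \<Longrightarrow> (\<lambda>x. \<Sum>i\<in>I. f i x) \<in> test_functions \<Omega>"
  by (induction I rule: infinite_finite_induct) (auto simp: test_0 intro!: test_add)

lemma test_bump: "0 < r \<Longrightarrow> cball c r \<subseteq> \<Omega> \<Longrightarrow> bump c r \<in> test_functions \<Omega>"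
  using bump_pos_iff[of r c] bump_nonneg[of c r]
  by (intro test_functionsI[where K="cball c r"] smooth_bump)
     (auto simp: order.order_iff_strict)

lemma test_borel: "\<phi> \<in> test_functions \<Omega> \<Longrightarrow> \<phi> \<in> borel_measurable borel"
  by (simp add: smooth_borel_measurable test_smooth)

lemma test_integrable:
  assumes "\<phi> \<in> test_functions \<Omega>"
  shows "integrable lborel \<phi>"
proof -
  obtain K where K: "smooth \<phi>" "compact K" "\<And>x. x \<notin> K \<Longrightarrow> \<phi> x = 0"
    using assms by (metis test_functionsE)
  have "integrable lborel (\<lambda>x. indicator K x *\<^sub>R \<phi> x)"
    using K by (intro borel_integrable_compact smooth_continuous_on)
  moreover have "(\<lambda>x. indicator K x *\<^sub>R \<phi> x) = \<phi>"
    using K(3) by (auto simp: fun_eq_iff indicator_def)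
  ultimately show ?thesis by simp
qed

lemma test_integrable_mult:
  "smooth f \<Longrightarrow> \<phi> \<in> test_functions \<Omega> \<Longrightarrow> integrable lborel (\<lambda>x. f x * \<phi> x)"
  by (intro test_integrable test_mult)

lemma test_integrable_square: "\<phi> \<in> test_functions \<Omega> \<Longrightarrow> integrable lborel (\<lambda>x. (\<phi> x)\<^sup>2)"
  unfolding power2_eq_square by (intro test_integrable_mult test_smooth)

lemma test_bounded:
  assumes "\<phi> \<in> test_functions \<Omega>"
  obtains B where "B > 0" "\<And>x. \<bar>\<phi> x\<bar> \<le> B"
proof -
  obtain K where K: "smooth \<phi>" "compact K" "\<And>x. x \<notin> K \<Longrightarrow> \<phi> x = 0"
    using assms by (metis test_functionsE)
  have "bounded (\<phi> ` K)"
    using K by (intro compact_imp_bounded compact_continuous_image smooth_continuous_on)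
  then obtain B where "B > 0" "\<And>x. x \<in> K \<Longrightarrow> norm (\<phi> x) \<le> B"
    by (auto simp: bounded_pos)
  then show thesis
    using that[of B] K(3) by fastforce
qed

section \<open>Uniform continuity and uniform first-order expansion of test functions\<close>

lemma test_uniformly_continuous:
  assumes "\<phi> \<in> test_functions \<Omega>"
  shows "uniformly_continuous_on UNIV \<phi>"
proof -
  obtain K where K: "smooth \<phi>" "compact K" "\<And>x. x \<notin> K \<Longrightarrow> \<phi> x = 0"
    using assms by (metis test_functionsE)
  obtain a where a: "K \<subseteq> cball 0 a"
    using compact_imp_bounded[OF K(2)] by (auto simp: bounded_iff subset_eq)
  have uc: "uniformly_continuous_on (cball 0 (a + 1)) \<phi>"
    using K by (intro compact_uniformly_continuous smooth_continuous_on) auto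
  show ?thesis
    unfolding uniformly_continuous_on_def
  proof (intro allI impI)
    fix e :: real assume "e > 0"
    then obtain d where d: "d > 0" "\<And>x y. x \<in> cball 0 (a + 1) \<Longrightarrow> y \<in> cball 0 (a + 1) \<Longrightarrow>
        dist y x < d \<Longrightarrow> dist (\<phi> y) (\<phi> x) < e"
      using uc unfolding uniformly_continuous_on_def by metis
    \<comment> \<open>The margin 1 in the radius matches the bound 1 on the distance: if one of the
      two points leaves the larger ball, neither can lie in K, and both values are 0.\<close>
    have "dist (\<phi> y) (\<phi> x) < e" if "dist y x < min d 1" for x y
    proof (cases "x \<in> cball 0 (a + 1) \<and> y \<in> cball 0 (a + 1)")
      case False
      have "norm x \<le> norm y + dist y x" "norm y \<le> norm x + dist y x"
        by (metis dist_norm norm_minus_commute norm_triangle_sub)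
          (metis dist_norm norm_triangle_sub)
      then have "x \<notin> K" "y \<notin> K"
        using False that a by fastforce+
      then show ?thesis using K(3) \<open>e > 0\<close> by simp
    qed (use d that in auto)
    then show "\<exists>d>0. \<forall>x\<in>UNIV. \<forall>y\<in>UNIV. dist y x < d \<longrightarrow> dist (\<phi> y) (\<phi> x) < e"
      using d(1) by (intro exI[of _ "min d 1"]) auto
  qed
qed

lemma sum_inner_le:
  fixes h :: "'a::euclidean_space" and c :: "'a \<Rightarrow> real"
  assumes "\<And>b. b \<in> Basis \<Longrightarrow> \<bar>c b\<bar> \<le> e"
  shows "\<bar>\<Sum>b\<in>Basis. (h \<bullet> b) * c b\<bar> \<le> real DIM('a) * e * norm h"
proof -
  have "\<bar>\<Sum>b\<in>Basis. (h \<bullet> b) * c b\<bar> \<le> (\<Sum>b\<in>(Basis::'a set). norm h * e)"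
    by (rule order_trans[OF sum_abs sum_mono])
      (auto simp: abs_mult Basis_le_norm intro!: mult_mono assms)
  then show ?thesis by (simp add: mult_ac)
qed

text \<open>The partial derivatives are uniformly continuous, so the mean value estimate on a
  segment holds with one d for all x. Each of them is controlled up to e / d with d the dimension,
  because \<open>sum_inner_le\<close> loses that factor.\<close>

lemma test_uniformly_differentiable:
  fixes \<phi> :: "'a::euclidean_space \<Rightarrow> real"
  assumes "\<phi> \<in> test_functions \<Omega>" "e > 0"
  obtains d where "d > 0"
    "\<And>x h. norm h < d \<Longrightarrow> \<bar>\<phi> (x + h) - \<phi> x - (\<Sum>b\<in>Basis. (h \<bullet> b) * pd b \<phi> x)\<bar> \<le> e * norm h"
proof -
  let ?e = "e / DIM('a)"
  have "\<exists>d>0. \<forall>x y. dist y x < d \<longrightarrow> dist (pd b \<phi> y) (pd b \<phi> x) < ?e" if "b \<in> Basis" for b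
    using test_uniformly_continuous[OF test_pd[OF assms(1) that]] assms(2)
    unfolding uniformly_continuous_on_def by (simp add: DIM_positive)
  then obtain D where D: "\<And>b. b \<in> Basis \<Longrightarrow> D b > 0"
    "\<And>b x y. b \<in> Basis \<Longrightarrow> dist y x < D b \<Longrightarrow> dist (pd b \<phi> y) (pd b \<phi> x) < ?e"
    by metis
  define d where "d = Min (D ` Basis)"
  have d: "d > 0" "\<And>b. b \<in> Basis \<Longrightarrow> d \<le> D b"
    using D(1) by (auto simp: d_def)
  show thesis
  proof (rule that[OF d(1)])
    fix x h :: 'a assume h: "norm h < d"
    have "norm (\<phi> (x + h) - \<phi> x - (\<Sum>b\<in>Basis. ((x + h - x) \<bullet> b) * pd b \<phi> x)) \<le> norm (x + h - x) * e"
    proof (rule differentiable_bound_linearization[where S="cball x (norm h)"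
          and f'="\<lambda>x h. \<Sum>b\<in>Basis. (h \<bullet> b) * pd b \<phi> x"])
      fix t :: real assume "t \<in> {0..1}"
      then show "x + t *\<^sub>R (x + h - x) \<in> cball x (norm h)"
        by (simp add: dist_norm mult_left_le_one_le)
    next
      fix y
      show "(\<phi> has_derivative (\<lambda>h. \<Sum>b\<in>Basis. (h \<bullet> b) * pd b \<phi> y)) (at y within cball x (norm h))"
        using smooth_has_derivative_pd test_smooth[OF assms(1)] has_derivative_at_withinI by blast
    next
      fix y assume y: "y \<in> cball x (norm h)"
      have "\<bar>pd b \<phi> y - pd b \<phi> x\<bar> \<le> ?e" if "b \<in> Basis" for b
        using D(2)[OF that, of y x] d(2)[OF that] y h by (force simp: dist_norm norm_minus_commute)
      then have "\<bar>\<Sum>b\<in>Basis. (h \<bullet> b) * (pd b \<phi> y - pd b \<phi> x)\<bar> \<le> DIM('a) * ?e * norm h" for h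
        by (rule sum_inner_le)
      then show "onorm ((\<lambda>h. \<Sum>b\<in>Basis. (h \<bullet> b) * pd b \<phi> y) - (\<lambda>h. \<Sum>b\<in>Basis. (h \<bullet> b) * pd b \<phi> x)) \<le> e"
        by (intro onorm_le) (simp add: sum_subtractf[symmetric] right_diff_distrib[symmetric])
    qed (simp)
    then show "\<bar>\<phi> (x + h) - \<phi> x - (\<Sum>b\<in>Basis. (h \<bullet> b) * pd b \<phi> x)\<bar> \<le> e * norm h"
      by (simp add: mult_ac)
  qed
qed

lemma test_pd_bounded:
  fixes \<phi> :: "'a::euclidean_space \<Rightarrow> real"
  assumes "\<phi> \<in> test_functions \<Omega>"
  obtains B where "B > 0" "\<And>b x. b \<in> Basis \<Longrightarrow> \<bar>pd b \<phi> x\<bar> \<le> B"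
proof -
  have "\<exists>B>0. \<forall>x. \<bar>pd b \<phi> x\<bar> \<le> B" if "b \<in> Basis" for b
    by (rule test_bounded[OF test_pd[OF assms that]]) blast
  then obtain B where B: "\<And>b. b \<in> Basis \<Longrightarrow> B b > 0" "\<And>b x. b \<in> Basis \<Longrightarrow> \<bar>pd b \<phi> x\<bar> \<le> B b"
    by metis
  have "\<bar>pd b \<phi> x\<bar> \<le> Max (B ` Basis)" if "b \<in> Basis" for b x
    using B(2)[OF that] that by (meson Max_ge finite_Basis finite_imageI image_eqI order_trans)
  moreover have "Max (B ` Basis) > 0"
    using B(1) by (subst Max_gr_iff) (auto intro: ex_in_conv[THEN iffD2])
  ultimately show thesis using that by blast
qed

lemma test_lipschitz:
  fixes \<phi> :: "'a::euclidean_space \<Rightarrow> real"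
  assumes "\<phi> \<in> test_functions \<Omega>"
  obtains L where "L > 0" "\<And>x h. \<bar>\<phi> (x + h) - \<phi> x\<bar> \<le> L * norm h"
proof -
  obtain B where B: "B > 0" "\<And>b x. b \<in> Basis \<Longrightarrow> \<bar>pd b \<phi> x\<bar> \<le> B"
    using test_pd_bounded[OF assms] by blast
  let ?L = "real DIM('a) * B"
  have "norm (\<phi> (x + h) - \<phi> x) \<le> ?L * norm (x + h - x)" for x h
  proof (rule differentiable_bound[where S=UNIV and f'="\<lambda>x h. \<Sum>b\<in>Basis. (h \<bullet> b) * pd b \<phi> x"])
    fix y
    show "(\<phi> has_derivative (\<lambda>h. \<Sum>b\<in>Basis. (h \<bullet> b) * pd b \<phi> y)) (at y)"
      using smooth_has_derivative_pd test_smooth[OF assms(1)] by blast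
    show "onorm (\<lambda>h. \<Sum>b\<in>Basis. (h \<bullet> b) * pd b \<phi> y) \<le> ?L"
      using sum_inner_le[OF B(2)] by (intro onorm_le) simp
  qed auto
  then show thesis
    using that[of ?L] B(1) by (simp add: DIM_positive)
qed

section \<open>Translation invariance and integration by parts\<close>

lemma lborel_translation:
  fixes f :: "'a::euclidean_space \<Rightarrow> real"
  shows "integral\<^sup>L lborel (\<lambda>x. f (x + a)) = integral\<^sup>L lborel f"
    and "integrable lborel (\<lambda>x. f (x + a)) \<longleftrightarrow> integrable lborel f"
proof -
  have *: "integrable lborel (\<lambda>x. g (x + c)) \<and> integral\<^sup>L lborel (\<lambda>x. g (x + c)) = integral\<^sup>L lborel g"
    if g: "integrable lborel g" for g :: "'a \<Rightarrow> real" and c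
  proof -
    have "integrable (distr lborel borel ((+) c)) g" "integral\<^sup>L (distr lborel borel ((+) c)) g = integral\<^sup>L lborel g"
      using g by (simp_all add: lborel_distr_plus)
    then show ?thesis
      using g by (simp add: integrable_distr_eq integral_distr add.commute)
  qed
  have "integrable lborel f" if "integrable lborel (\<lambda>x. f (x + a))"
    using *[OF that, of "- a"] by simp
  then show i: "integrable lborel (\<lambda>x. f (x + a)) \<longleftrightarrow> integrable lborel f"
    using * by blast
  show "integral\<^sup>L lborel (\<lambda>x. f (x + a)) = integral\<^sup>L lborel f"
    using * i by (metis not_integrable_integral_eq)
qed

lemma nn_integral_lborel_translation:
  fixes f :: "'a::euclidean_space \<Rightarrow> ennreal"
  assumes [measurable]: "f \<in> borel_measurable borel"
  shows "(\<integral>\<^sup>+x. f (x + a) \<partial>lborel) = (\<integral>\<^sup>+x. f x \<partial>lborel)"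
proof -
  have "(\<integral>\<^sup>+x. f x \<partial>lborel) = (\<integral>\<^sup>+x. f x \<partial>(distr lborel borel ((+) a)))"
    by (simp add: lborel_distr_plus)
  also have "\<dots> = (\<integral>\<^sup>+x. f (x + a) \<partial>lborel)"
    by (subst nn_integral_distr) (simp_all add: add.commute)
  finally show ?thesis by simp
qed

text \<open>The integral of \<open>\<phi>(x + t b) - \<phi>(x)\<close> vanishes for every \<open>t\<close>, and so does its derivative at \<open>t = 0\<close>.\<close>

lemma integral_pd_zero:
  fixes \<phi> :: "'a::euclidean_space \<Rightarrow> real"
  assumes \<phi>: "\<phi> \<in> test_functions \<Omega>" and b: "b \<in> Basis"
  shows "(\<integral>x. pd b \<phi> x \<partial>lborel) = 0"
proof -
  obtain K where K: "smooth \<phi>" "compact K" "\<And>x. x \<notin> K \<Longrightarrow> \<phi> x = 0" "\<And>b x. x \<notin> K \<Longrightarrow> pd b \<phi> x = 0"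
    using \<phi> by (metis test_functionsE)
  obtain a where a: "K \<subseteq> cball 0 a"
    using compact_imp_bounded[OF K(2)] by (auto simp: bounded_iff subset_eq)
  let ?C = "cball (0::'a) (a + 1)"
  define V where "V = measure lborel ?C"
  have V: "V \<ge> 0" by (simp add: V_def)
  have *: "\<bar>\<integral>x. pd b \<phi> x \<partial>lborel\<bar> \<le> e * V" if e: "e > 0" for e
  proof -
    obtain d where d: "d > 0"
      "\<And>x h. norm h < d \<Longrightarrow> \<bar>\<phi> (x + h) - \<phi> x - (\<Sum>c\<in>Basis. (h \<bullet> c) * pd c \<phi> x)\<bar> \<le> e * norm h"
      using test_uniformly_differentiable[OF \<phi> e] by blast
    \<comment> \<open>The bound t \<le> 1 guarantees that x + t b misses K whenever x lies outside
      the ball of radius a + 1, so the integrand is supported in \<open>?C\<close>.\<close>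
    define t where "t = min (d / 2) 1"
    have t: "0 < t" "t < d" "t \<le> 1" using d(1) by (auto simp: t_def)
    let ?f = "\<lambda>x. \<phi> (x + t *\<^sub>R b) - \<phi> x - t * pd b \<phi> x"
    have "\<bar>?f x\<bar> \<le> e * t * indicator ?C x" for x
    proof (cases "x \<in> ?C")
      case True
      have "(\<Sum>c\<in>Basis. ((t *\<^sub>R b) \<bullet> c) * pd c \<phi> x) = (\<Sum>c\<in>Basis. if c = b then t * pd b \<phi> x else 0)"
        using b by (intro sum.cong) (auto simp: inner_Basis)
      then show ?thesis
        using d(2)[of "t *\<^sub>R b" x] t b True by (simp add: mult_ac)
    next
      case False
      have "norm (x + t *\<^sub>R b) \<ge> norm x - norm (t *\<^sub>R b)"
        by (metis diff_ge_0_iff_ge le_diff_eq norm_diff_ineq)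
      then have "x \<notin> K" "x + t *\<^sub>R b \<notin> K"
        using a False t b by fastforce+
      then show ?thesis using K False by simp
    qed
    moreover have i: "integrable lborel (\<lambda>x. \<phi> (x + t *\<^sub>R b))" "integrable lborel \<phi>" "integrable lborel (pd b \<phi>)"
      using test_integrable[OF \<phi>] test_integrable[OF test_pd[OF \<phi> b]] lborel_translation(2)[of \<phi>]
      by auto
    ultimately have "\<bar>integral\<^sup>L lborel ?f\<bar> \<le> (\<integral>x. e * t * indicator ?C x \<partial>lborel)"
      by (intro order_trans[OF integral_abs_bound] integral_mono integrable_abs)
        (auto intro!: Bochner_Integration.integrable_mult_right integrable_real_indicator emeasure_lborel_cball_finite)
    also have "\<dots> = e * t * V" by (simp add: V_def)
    also have "integral\<^sup>L lborel ?f = - t * (\<integral>x. pd b \<phi> x \<partial>lborel)"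
      using i lborel_translation(1)[of \<phi>] by simp
    finally show ?thesis
      using t by (simp add: abs_mult mult_ac)
  qed
  have "\<bar>\<integral>x. pd b \<phi> x \<partial>lborel\<bar> \<le> 0 + e" if "e > 0" for e
  proof -
    have "\<bar>\<integral>x. pd b \<phi> x \<partial>lborel\<bar> \<le> e / (V + 1) * V"
      using that V by (intro *) (simp add: add_nonneg_pos)
    also have "\<dots> \<le> e"
      using that V by (simp add: field_simps add_nonneg_pos)
    finally show ?thesis by simp
  qed
  then show ?thesis by (meson abs_le_zero_iff field_le_epsilon)
qed

lemma integration_by_parts:
  assumes "smooth f" "\<phi> \<in> test_functions \<Omega>" "b \<in> Basis"
  shows "(\<integral>x. f x * pd b \<phi> x \<partial>lborel) = - (\<integral>x. pd b f x * \<phi> x \<partial>lborel)"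
proof -
  have "0 = (\<integral>x. pd b (\<lambda>x. f x * \<phi> x) x \<partial>lborel)"
    using integral_pd_zero[OF test_mult] assms by metis
  also have "\<dots> = (\<integral>x. f x * pd b \<phi> x + pd b f x * \<phi> x \<partial>lborel)"
    using assms by (simp add: pd_mult test_smooth)
  also have "\<dots> = (\<integral>x. f x * pd b \<phi> x \<partial>lborel) + (\<integral>x. pd b f x * \<phi> x \<partial>lborel)"
    using assms by (intro Bochner_Integration.integral_add test_integrable_mult test_pd smooth_pd)
  finally show ?thesis by simp
qed

section \<open>Smoothing by correlation\<close>

text \<open>Correlation rather than convolution: by \<open>corr_alt\<close> it averages v(x + h)
  with weight \<zeta>(h), which pairs directly with the differences v(x + h) - v(x) of the energy.
  The price is the minus sign in \<open>pd_corr\<close>.\<close>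

definition corr :: "('a::euclidean_space \<Rightarrow> real) \<Rightarrow> ('a \<Rightarrow> real) \<Rightarrow> 'a \<Rightarrow> real" where
  "corr \<zeta> v x = (\<integral>y. v y * \<zeta> (y - x) \<partial>lborel)"

lemma integrable_mult_bounded:
  fixes v g :: "'a::euclidean_space \<Rightarrow> real"
  assumes "integrable lborel v" "g \<in> borel_measurable borel" "\<And>x. \<bar>g x\<bar> \<le> B"
  shows "integrable lborel (\<lambda>x. v x * g x)"
proof (rule Bochner_Integration.integrable_bound[where f="\<lambda>x. B * v x"])
  show "AE x in lborel. norm (v x * g x) \<le> norm (B * v x)"
  proof (rule AE_I2)
    fix x
    have "\<bar>v x\<bar> * \<bar>g x\<bar> \<le> \<bar>v x\<bar> * \<bar>B\<bar>"
      using assms(3)[of x] by (intro mult_left_mono) auto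
    then show "norm (v x * g x) \<le> norm (B * v x)" by (simp add: abs_mult mult.commute)
  qed
qed (use assms in auto)

lemma corr_integrable:
  assumes "\<zeta> \<in> test_functions \<Omega>" "integrable lborel v"
  shows "integrable lborel (\<lambda>y. v y * \<zeta> (y - x))"
proof -
  obtain B where B: "\<And>x. \<bar>\<zeta> x\<bar> \<le> B"
    using test_bounded[OF assms(1)] by blast
  have [measurable]: "\<zeta> \<in> borel_measurable borel" using assms(1) by (rule test_borel)
  show ?thesis
    by (rule integrable_mult_bounded[OF assms(2) _ B]) measurable
qed

text \<open>Differentiation under the integral sign. The expansion of \<zeta> has an error uniform
  in the base point, so the error of the integral is at most that error times the L1 norm I of v;
  the tolerance e / (I + 1) also covers I = 0.\<close>

lemma corr_has_derivative:
  fixes \<zeta> :: "'a::euclidean_space \<Rightarrow> real"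
  assumes \<zeta>: "\<zeta> \<in> test_functions \<Omega>" and v: "integrable lborel v"
  shows "(corr \<zeta> v has_derivative (\<lambda>h. \<Sum>b\<in>Basis. (h \<bullet> b) * - corr (pd b \<zeta>) v x)) (at x)"
  unfolding has_derivative_at_alt
proof (intro conjI allI impI)
  show "bounded_linear (\<lambda>h. \<Sum>b\<in>Basis. (h \<bullet> b) * - corr (pd b \<zeta>) v x)"
    by (intro bounded_linear_sum bounded_linear_mult_const bounded_linear_inner_left)
  fix e :: real assume e: "e > 0"
  define I where "I = (\<integral>y. \<bar>v y\<bar> \<partial>lborel)"
  have I: "I \<ge> 0" by (simp add: I_def)
  obtain d where d: "d > 0" "\<And>x h. norm h < d \<Longrightarrow>
      \<bar>\<zeta> (x + h) - \<zeta> x - (\<Sum>b\<in>Basis. (h \<bullet> b) * pd b \<zeta> x)\<bar> \<le> e / (I + 1) * norm h"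
    using test_uniformly_differentiable[OF \<zeta>, of "e / (I + 1)"] e I by (auto simp: add_nonneg_pos)
  have "norm (corr \<zeta> v y - corr \<zeta> v x - (\<Sum>b\<in>Basis. ((y - x) \<bullet> b) * - corr (pd b \<zeta>) v x)) \<le> e * norm (y - x)"
    if y: "norm (y - x) < d" for y
  proof -
    let ?r = "\<lambda>z. \<zeta> (z - y) - \<zeta> (z - x) - (\<Sum>b\<in>Basis. ((x - y) \<bullet> b) * pd b \<zeta> (z - x))"
    have r: "\<bar>?r z\<bar> \<le> e / (I + 1) * norm (y - x)" for z
      using d(2)[of "x - y" "z - x"] y by (simp add: norm_minus_commute)
    have int: "integrable lborel (\<lambda>z. v z * \<zeta> (z - y))" "integrable lborel (\<lambda>z. v z * \<zeta> (z - x))"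
      "\<And>b. b \<in> Basis \<Longrightarrow> integrable lborel (\<lambda>z. v z * pd b \<zeta> (z - x))"
      using corr_integrable[OF \<zeta> v] corr_integrable[OF test_pd[OF \<zeta>] v] by simp_all
    have eq: "v z * ?r z = v z * \<zeta> (z - y) - v z * \<zeta> (z - x) -
        (\<Sum>b\<in>Basis. ((x - y) \<bullet> b) * (v z * pd b \<zeta> (z - x)))" for z
      by (simp add: algebra_simps sum_distrib_left)
    have i3: "integrable lborel (\<lambda>z. \<Sum>b\<in>Basis. ((x - y) \<bullet> b) * (v z * pd b \<zeta> (z - x)))"
      using int(3) by (intro Bochner_Integration.integrable_sum Bochner_Integration.integrable_mult_right) auto
    have ir: "integrable lborel (\<lambda>z. v z * ?r z)"
      unfolding eq using int i3 by (intro Bochner_Integration.integrable_diff) auto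
    have "(\<integral>z. v z * ?r z \<partial>lborel) = corr \<zeta> v y - corr \<zeta> v x -
        (\<Sum>b\<in>Basis. ((x - y) \<bullet> b) * corr (pd b \<zeta>) v x)"
      unfolding eq using int i3 by (simp add: corr_def Bochner_Integration.integral_sum)
    also have "\<dots> = corr \<zeta> v y - corr \<zeta> v x - (\<Sum>b\<in>Basis. ((y - x) \<bullet> b) * - corr (pd b \<zeta>) v x)"
      by (simp add: inner_diff_left algebra_simps sum_subtractf)
    finally have eqI: "(\<integral>z. v z * ?r z \<partial>lborel) = corr \<zeta> v y - corr \<zeta> v x -
        (\<Sum>b\<in>Basis. ((y - x) \<bullet> b) * - corr (pd b \<zeta>) v x)" .
    have "norm (corr \<zeta> v y - corr \<zeta> v x - (\<Sum>b\<in>Basis. ((y - x) \<bullet> b) * - corr (pd b \<zeta>) v x))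
        \<le> (\<integral>z. \<bar>v z * ?r z\<bar> \<partial>lborel)"
      unfolding eqI[symmetric] real_norm_def by (rule integral_abs_bound)
    also have "\<dots> \<le> (\<integral>z. \<bar>v z\<bar> * (e / (I + 1) * norm (y - x)) \<partial>lborel)"
      unfolding abs_mult using ir v r
      by (intro integral_mono mult_left_mono integrable_mult_left) (auto simp: abs_mult dest: integrable_abs)
    also have "\<dots> = I * (e / (I + 1) * norm (y - x))"
      by (simp add: I_def)
    also have "\<dots> = (I / (I + 1)) * (e * norm (y - x))"
      by simp
    also have "\<dots> \<le> 1 * (e * norm (y - x))"
      using I e by (intro mult_right_mono) auto
    finally show ?thesis by simp
  qed
  then show "\<exists>d>0. \<forall>y. norm (y - x) < d \<longrightarrow>
      norm (corr \<zeta> v y - corr \<zeta> v x - (\<Sum>b\<in>Basis. ((y - x) \<bullet> b) * - corr (pd b \<zeta>) v x)) \<le> e * norm (y - x)"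
    using d(1) by blast
qed

lemma pd_corr:
  assumes "\<zeta> \<in> test_functions \<Omega>" "integrable lborel v" "b \<in> Basis"
  shows "pd b (corr \<zeta> v) x = - corr (pd b \<zeta>) v x"
proof -
  have "pd b (corr \<zeta> v) x = (\<Sum>c\<in>Basis. (b \<bullet> c) * - corr (pd c \<zeta>) v x)"
    by (rule pd_eqI[OF corr_has_derivative[OF assms(1,2)]])
  also have "\<dots> = (\<Sum>c\<in>Basis. if c = b then - corr (pd b \<zeta>) v x else 0)"
    using assms(3) by (intro sum.cong) (auto simp: inner_Basis)
  finally show ?thesis using assms(3) by simp
qed

lemma smooth_corr:
  assumes "\<zeta> \<in> test_functions \<Omega>" "integrable lborel v"
  shows "smooth (corr \<zeta> v)"
proof -
  \<comment> \<open>Each derivative trades \<zeta> for one of its partial derivatives, so the claim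
    is proved for all test functions simultaneously.\<close>
  have "C_k k (corr \<zeta> v)" if "\<zeta> \<in> test_functions \<Omega>" for k \<zeta>
    using that
  proof (induction k arbitrary: \<zeta>)
    case 0
    then show ?case
      using corr_has_derivative[OF _ assms(2)] has_derivative_continuous
      by (fastforce simp: continuous_on_eq_continuous_within)
  next
    case (Suc k)
    show ?case
    proof (rule C_k_SucI[OF corr_has_derivative[OF Suc.prems assms(2)]])
      fix b :: 'a assume b: "b \<in> Basis"
      have "(\<Sum>c\<in>Basis. (b \<bullet> c) * - corr (pd c \<zeta>) v x) = (-1) * corr (pd b \<zeta>) v x" for x
        using pd_corr[OF Suc.prems assms(2) b] pd_eqI[OF corr_has_derivative[OF Suc.prems assms(2)]] by simp
      then show "C_k k (\<lambda>x. \<Sum>c\<in>Basis. (b \<bullet> c) * - corr (pd c \<zeta>) v x)"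
        using C_k_mult[OF C_k_const[of k "-1"] Suc.IH[OF test_pd[OF Suc.prems b]]] by simp
    qed
  qed
  then show ?thesis using assms by (simp add: smooth_def)
qed

text \<open>The indicator of an open set is a bounded pointwise limit of test functions.\<close>

lemma AE_zero_if_test_integrals_zero:
  fixes f :: "'a::euclidean_space \<Rightarrow> real"
  assumes f: "integrable lborel f" and \<Omega>: "open \<Omega>" "\<And>x. x \<notin> \<Omega> \<Longrightarrow> f x = 0"
    and test: "\<And>\<phi>. \<phi> \<in> test_functions \<Omega> \<Longrightarrow> (\<integral>x. f x * \<phi> x \<partial>lborel) = 0"
  shows "AE x in lborel. f x = 0"
proof -
  have fm[measurable]: "f \<in> borel_measurable borel" using f by auto
  have sub: "(\<integral>x. indicator U x * f x \<partial>lborel) = 0" if U: "open U" "U \<subseteq> \<Omega>" "U \<noteq> {}" for U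
  proof -
    define \<F> where "\<F> = {ball c r | c r. 0 < r \<and> cball c r \<subseteq> U}"
    have "U = \<Union>\<F>"
    proof (intro equalityI subsetI)
      fix x assume "x \<in> U"
      then obtain e where "e > 0" "cball x e \<subseteq> U"
        using U(1) open_contains_cball by blast
      then show "x \<in> \<Union>\<F>"
        unfolding \<F>_def by (intro UnionI[of "ball x e"]) auto
    next
      fix x assume "x \<in> \<Union>\<F>"
      then show "x \<in> U"
        unfolding \<F>_def using ball_subset_cball by blast
    qed
    moreover obtain \<F>' where F': "\<F>' \<subseteq> \<F>" "countable \<F>'" "\<Union>\<F>' = \<Union>\<F>"
      by (rule Lindelof[of \<F>]) (auto simp: \<F>_def)
    ultimately have U_eq: "U = \<Union>\<F>'" by simp
    then have "\<F>' \<noteq> {}" using U(3) by auto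
    then have B: "range (from_nat_into \<F>') = \<F>'"
      using F'(2) by (rule range_from_nat_into)
    define B where "B = from_nat_into \<F>'"
    note B = B[folded B_def]
    have "\<exists>c r. B k = ball c r \<and> 0 < r \<and> cball c r \<subseteq> U" for k :: nat
    proof -
      have "B k \<in> \<F>" using F'(1) B by blast
      then show ?thesis by (simp add: \<F>_def)
    qed
    then obtain c r where cr: "\<And>k. B k = ball (c k) (r k)" "\<And>k. 0 < r k" "\<And>k. cball (c k) (r k) \<subseteq> U"
      by metis
    define \<beta> where "\<beta> n x = (\<Sum>k\<le>n. bump (c k) (r k) x)" for n :: nat and x
    \<comment> \<open>The quotient lies between 0 and 1 and inherits the support of
      \<open>\<beta> n\<close>. Where some bump is positive it bounds \<open>\<beta> n x\<close>
      from below for all large n, so the quotient tends to 1; off U it is 0 for every n.\<close>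
    define s where "s n x = \<beta> n x / (\<beta> n x + 1 / real (Suc n))" for n x
    have \<beta>0: "\<beta> n x \<ge> 0" for n x
      by (auto simp: \<beta>_def intro: sum_nonneg bump_nonneg)
    have \<beta>t: "\<beta> n \<in> test_functions \<Omega>" for n
      unfolding \<beta>_def using cr(2) order_trans[OF cr(3) U(2)] by (intro test_sum test_bump)
    have pos: "\<beta> n x + 1 / real (Suc n) > 0" for n x
      using \<beta>0[of n x] by (simp add: add_nonneg_pos)
    have st: "s n \<in> test_functions \<Omega>" for n
    proof -
      have "(\<lambda>x. (1 / (\<beta> n x + 1 / real (Suc n))) * \<beta> n x) \<in> test_functions \<Omega>"
        using pos \<beta>t by (intro test_mult smooth_divide smooth_add test_smooth[OF \<beta>t]) (auto simp: less_le)
      then show ?thesis by (simp add: s_def[abs_def])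
    qed
    have s1: "0 \<le> s n x" "s n x \<le> 1" for n x
      using \<beta>0[of n x] pos[of n x] by (auto simp: s_def)
    have lim: "(\<lambda>n. s n x) \<longlonglongrightarrow> indicator U x" for x
    proof (cases "x \<in> U")
      case True
      then obtain k where k: "x \<in> ball (c k) (r k)"
        using U_eq B cr(1) by (metis UN_E)
      define q where "q = bump (c k) (r k) x"
      have q: "q > 0" using k cr(2) bump_pos_iff q_def by blast
      have ge: "\<beta> n x \<ge> q" if "n \<ge> k" for n
        unfolding \<beta>_def q_def using that by (intro member_le_sum) (auto simp: bump_nonneg)
      have "s n x \<ge> q / (q + 1 / real (Suc n))" if "n \<ge> k" for n
      proof -
        define t where "t = 1 / real (Suc n)"
        have "t > 0" by (simp add: t_def)
        then have "q * (\<beta> n x + t) \<le> \<beta> n x * (q + t)"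
          using ge[OF that] by (simp add: algebra_simps)
        then show ?thesis
          using q \<open>t > 0\<close> ge[OF that] unfolding s_def t_def[symmetric] by (simp add: divide_simps)
      qed
      then have ev: "\<forall>\<^sub>F n in sequentially. q / (q + 1 / real (Suc n)) \<le> s n x"
        by (rule eventually_sequentiallyI)
      have "(\<lambda>n. q / (q + 1 / real (Suc n))) \<longlonglongrightarrow> q / (q + 0)"
        using q by (intro tendsto_intros LIMSEQ_Suc[OF lim_1_over_n]) auto
      then have lo: "(\<lambda>n. q / (q + 1 / real (Suc n))) \<longlonglongrightarrow> 1"
        using q by simp
      have "(\<lambda>n. s n x) \<longlonglongrightarrow> 1"
        by (rule tendsto_sandwich[OF ev _ lo tendsto_const]) (simp add: s1)
      then show ?thesis using True by simp
    next
      case False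
      then have "x \<notin> ball (c k) (r k)" for k using cr(3) ball_subset_cball by blast
      then have "bump (c k) (r k) x = 0" for k
        using bump_pos_iff[OF cr(2)[of k], of "c k" x] bump_nonneg[of "c k" "r k" x] by auto
      then have "s n x = 0" for n by (simp add: s_def \<beta>_def)
      then show ?thesis using False by simp
    qed
    have "(\<lambda>n. \<integral>x. f x * s n x \<partial>lborel) \<longlonglongrightarrow> (\<integral>x. f x * indicator U x \<partial>lborel)"
    proof (rule integral_dominated_convergence[where w="\<lambda>x. \<bar>f x\<bar>"])
      show "(\<lambda>x. f x * indicator U x) \<in> borel_measurable lborel"
        using borel_open[OF U(1)] by measurable
      show "(\<lambda>x. f x * s n x) \<in> borel_measurable lborel" for n
        using test_borel[OF st[of n]] by measurable
      show "AE x in lborel. (\<lambda>n. f x * s n x) \<longlonglongrightarrow> f x * indicator U x"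
        using lim by (intro AE_I2 tendsto_intros)
      show "AE x in lborel. norm (f x * s n x) \<le> \<bar>f x\<bar>" for n
        using s1 by (intro AE_I2) (auto simp: abs_mult intro: mult_left_le)
    qed (use f in auto)
    then have "(\<integral>x. f x * indicator U x \<partial>lborel) = 0"
      using test[OF st] by (simp add: LIMSEQ_const_iff)
    then show ?thesis by (simp add: mult.commute)
  qed
  have op: "(LINT x:U|lborel. f x) = 0" if "open U" for U
  proof (cases "U \<inter> \<Omega> = {}")
    case True
    then have "(\<lambda>x. indicator U x *\<^sub>R f x) = (\<lambda>x. 0)" using \<Omega>(2) by (auto simp: indicator_def fun_eq_iff)
    then show ?thesis by (simp only: set_lebesgue_integral_def Bochner_Integration.integral_zero)
  next
    case False
    have "(\<lambda>x. indicator U x *\<^sub>R f x) = (\<lambda>x. indicator (U \<inter> \<Omega>) x * f x)"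
      using \<Omega>(2) by (auto simp: indicator_def fun_eq_iff)
    then show ?thesis
      using sub[of "U \<inter> \<Omega>"] that \<Omega>(1) False by (simp add: set_lebesgue_integral_def open_Int del: real_scaleR_def)
  qed
  have set_int: "set_integrable lborel A f" if "A \<in> sets borel" for A
    using that f integrable_mult_indicator[of A lborel f] by (simp add: set_integrable_def)
  have "(LINT x:A|lborel. f x) = 0" if "A \<in> sets borel" for A
  proof -
    \<comment> \<open>\<open>density_zero\<close> asks for vanishing integrals over all Borel sets.
      The open sets form a generator closed under intersection, so complements and disjoint unions
      suffice to reach them.\<close>
    have Int: "Int_stable {S::'a set. open S}" by (auto simp: Int_stable_def)
    have "A \<in> sigma_sets UNIV {S. open S}"
      using that by (simp add: borel_def)
    from Int _ this show ?thesis
    proof (rule sigma_sets_induct_disjoint)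
      fix A assume IH: "(LINT x:A|lborel. f x) = 0" and "A \<in> sigma_sets UNIV {S. open S}"
      then have A: "A \<in> sets borel" by (simp add: borel_def)
      have "(LINT x:A \<union> (UNIV - A)|lborel. f x) = (LINT x:A|lborel. f x) + (LINT x:UNIV - A|lborel. f x)"
        using A by (intro set_integral_Un set_int) auto
      then show "(LINT x:UNIV - A|lborel. f x) = 0" using op[of UNIV] IH by simp
    next
      fix A :: "nat \<Rightarrow> 'a set"
      assume dis: "disjoint_family A" and IH: "\<And>i. (LINT x:A i|lborel. f x) = 0"
        and "range A \<subseteq> sigma_sets UNIV {S. open S}"
      then have A: "\<And>i. A i \<in> sets lborel" by (auto simp: borel_def)
      have "(LINT x:(\<Union>i. A i)|lborel. f x) = (\<Sum>i. (LINT x:(A i)|lborel. f x))"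
        using A dis by (intro lebesgue_integral_countable_add)
          (auto simp: disjoint_family_on_def intro!: set_int)
      then show "(LINT x:(\<Union>i. A i)|lborel. f x) = 0" using IH by simp
    next
      show "(LINT x:{}|lborel. f x) = 0" by (simp add: set_lebesgue_integral_def)
    qed (use op in auto)
  qed
  then show ?thesis
    using sigma_finite_measure.density_zero[OF lborel.sigma_finite_measure_axioms f] by simp
qed

section \<open>Weak gradients of test functions\<close>

lemma esqrt_power2 [simp]: "(esqrt t)\<^sup>2 = t"
proof (cases t)
  case (real r)
  then show ?thesis by (simp add: esqrt_def ennreal_power)
qed (simp add: esqrt_def power2_eq_square)

lemma esqrt_less_top_iff [simp]: "esqrt t < top \<longleftrightarrow> t < top"
  by (auto simp: esqrt_def less_top)

lemma esqrt_0 [simp]: "esqrt 0 = 0"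
  by (simp add: esqrt_def)

lemma esqrt_mono: "s \<le> t \<Longrightarrow> esqrt s \<le> esqrt t"
  unfolding esqrt_def by (auto simp: top_unique intro!: ennreal_leI enn2real_mono simp: less_top)

text \<open>This permits every limit in the sequel to be taken for squared norms, that is, for plain
  integrals.\<close>

lemma esqrt_tendsto_0_iff: "((\<lambda>x. esqrt (f x)) \<longlongrightarrow> 0) F \<longleftrightarrow> (f \<longlongrightarrow> 0) F"
proof
  assume l: "((\<lambda>x. esqrt (f x)) \<longlongrightarrow> 0) F"
  then have "((\<lambda>x. (esqrt (f x))\<^sup>2) \<longlongrightarrow> 0\<^sup>2) F"
    unfolding power2_eq_square by (intro tendsto_mult_ennreal) auto
  then show "(f \<longlongrightarrow> 0) F" by simp
next
  assume l: "(f \<longlongrightarrow> 0) F"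
  show "((\<lambda>x. esqrt (f x)) \<longlongrightarrow> 0) F"
  proof (rule order_tendstoI)
    fix a :: ennreal assume "0 < a"
    then obtain r where r: "0 < r" "ennreal r < a"
    proof (cases a)
      case (real q)
      then show thesis using that[of "q / 2"] \<open>0 < a\<close> by (simp add: ennreal_less_iff)
    next
      case top
      then show thesis using that[of 1] by simp
    qed
    have "\<forall>\<^sub>F x in F. f x < ennreal (r\<^sup>2)"
      using order_tendstoD(2)[OF l, of "ennreal (r\<^sup>2)"] r(1) by (simp add: ennreal_less_zero_iff)
    then show "\<forall>\<^sub>F x in F. esqrt (f x) < a"
    proof eventually_elim
      case (elim x)
      have "esqrt (f x) \<le> esqrt (ennreal (r\<^sup>2))" using elim by (intro esqrt_mono) simp
      also have "\<dots> = ennreal r" using r(1) by (simp add: esqrt_def)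
      finally show ?case using r(2) by simp
    qed
  qed simp
qed

lemma L2_norm_on_power2: "(L2_norm_on S u)\<^sup>2 = (\<integral>\<^sup>+x\<in>S. ennreal ((norm (u x))\<^sup>2) \<partial>lborel)"
  by (simp add: L2_norm_on_def)

lemma set_nn_integral_eq_real:
  fixes u :: "'a::euclidean_space \<Rightarrow> real"
  shows "(\<integral>\<^sup>+x\<in>S. ennreal ((norm (u x))\<^sup>2) \<partial>lborel) = (\<integral>\<^sup>+x. ennreal ((indicator S x * u x)\<^sup>2) \<partial>lborel)"
  by (intro nn_integral_cong) (auto simp: indicator_def)

lemma L2_space_iff:
  fixes u :: "'a::euclidean_space \<Rightarrow> real"
  shows "u \<in> L2_space S \<longleftrightarrow> (\<lambda>x. indicator S x * u x) \<in> borel_measurable borel \<and>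
    integrable lborel (\<lambda>x. (indicator S x * u x)\<^sup>2)"
proof -
  have "L2_norm_on S u < \<infinity> \<longleftrightarrow> (\<integral>\<^sup>+x. ennreal ((indicator S x * u x)\<^sup>2) \<partial>lborel) < \<infinity>"
    unfolding L2_norm_on_def set_nn_integral_eq_real by simp
  then show ?thesis
    by (auto simp: L2_space_def set_borel_measurable_def integrable_iff_bounded)
qed

text \<open>On the support |f| is at most 1 + f^2, and a bounded set is contained in a ball of
  finite measure.\<close>

lemma square_integrable_imp_integrable:
  fixes f :: "'a::euclidean_space \<Rightarrow> real"
  assumes "f \<in> borel_measurable borel" "integrable lborel (\<lambda>x. (f x)\<^sup>2)" "bounded S" "\<And>x. x \<notin> S \<Longrightarrow> f x = 0"
  shows "integrable lborel f"
proof -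
  obtain a where a: "S \<subseteq> cball 0 a"
    using assms(3) by (auto simp: bounded_iff subset_eq)
  show ?thesis
  proof (rule Bochner_Integration.integrable_bound)
    show "integrable lborel (\<lambda>x. indicator (cball 0 a) x + (f x)\<^sup>2)"
      using assms(2) by (auto intro!: Bochner_Integration.integrable_add integrable_real_indicator emeasure_lborel_cball_finite)
    have "\<bar>f x\<bar> \<le> 1 + (f x)\<^sup>2" for x
      using zero_le_power2[of "\<bar>f x\<bar> - 1"] by (simp add: power2_diff)
    then show "AE x in lborel. norm (f x) \<le> norm (indicator (cball 0 a) x + (f x)\<^sup>2)"
      using a assms(4) by (intro AE_I2) (fastforce simp: indicator_def)
  qed (use assms in auto)
qed

lemma integrable_square_diff:
  fixes f g :: "'a::euclidean_space \<Rightarrow> real"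
  assumes [measurable]: "f \<in> borel_measurable borel" "g \<in> borel_measurable borel"
    and "integrable lborel (\<lambda>x. (f x)\<^sup>2)" "integrable lborel (\<lambda>x. (g x)\<^sup>2)"
  shows "integrable lborel (\<lambda>x. (f x - g x)\<^sup>2)"
proof (rule Bochner_Integration.integrable_bound)
  show "integrable lborel (\<lambda>x. 2 * (f x)\<^sup>2 + 2 * (g x)\<^sup>2)"
    using assms by auto
  have "(f x - g x)\<^sup>2 \<le> 2 * (f x)\<^sup>2 + 2 * (g x)\<^sup>2" for x
    using zero_le_power2[of "f x + g x"] by (simp add: power2_eq_square algebra_simps)
  then show "AE x in lborel. norm ((f x - g x)\<^sup>2) \<le> norm (2 * (f x)\<^sup>2 + 2 * (g x)\<^sup>2)"
    by (intro AE_I2) simp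
qed measurable

lemma L2_space_diff:
  fixes u v :: "'a::euclidean_space \<Rightarrow> real"
  assumes "u \<in> L2_space S" "v \<in> L2_space S"
  shows "(\<lambda>x. u x - v x) \<in> L2_space S"
  using assms integrable_square_diff[of "\<lambda>x. indicator S x * u x" "\<lambda>x. indicator S x * v x"]
  by (auto simp: L2_space_iff right_diff_distrib)

lemma norm_power2_Basis: "(norm (v::'a::euclidean_space))\<^sup>2 = (\<Sum>b\<in>Basis. (v \<bullet> b)\<^sup>2)"
  using euclidean_inner[of v v] by (simp add: power2_norm_eq_inner power2_eq_square[of "v \<bullet> _"])

lemma L2_space_vec_iff:
  fixes g :: "'a::euclidean_space \<Rightarrow> 'a"
  shows "g \<in> L2_space S \<longleftrightarrow> (\<forall>b\<in>Basis. (\<lambda>x. g x \<bullet> b) \<in> L2_space S)"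
proof
  assume g: "g \<in> L2_space S"
  then have m[measurable]: "(\<lambda>x. indicator S x *\<^sub>R g x) \<in> borel_measurable borel"
    and i: "(\<integral>\<^sup>+x\<in>S. ennreal ((norm (g x))\<^sup>2) \<partial>lborel) < \<infinity>"
    by (auto simp: L2_space_def set_borel_measurable_def L2_norm_on_def)
  show "\<forall>b\<in>Basis. (\<lambda>x. g x \<bullet> b) \<in> L2_space S"
  proof
    fix b :: 'a assume b: "b \<in> Basis"
    have "(\<lambda>x. (indicator S x *\<^sub>R g x) \<bullet> b) \<in> borel_measurable borel" by measurable
    moreover have "(\<integral>\<^sup>+x\<in>S. ennreal ((norm (g x \<bullet> b))\<^sup>2) \<partial>lborel) \<le> (\<integral>\<^sup>+x\<in>S. ennreal ((norm (g x))\<^sup>2) \<partial>lborel)"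
      using Basis_le_norm[OF b] by (intro nn_integral_mono mult_right_mono ennreal_leI power_mono) auto
    then have "(\<integral>\<^sup>+x\<in>S. ennreal ((norm (g x \<bullet> b))\<^sup>2) \<partial>lborel) < \<infinity>"
      using i by (rule le_less_trans)
    ultimately show "(\<lambda>x. g x \<bullet> b) \<in> L2_space S"
      by (simp add: L2_space_def set_borel_measurable_def L2_norm_on_def)
  qed
next
  assume *: "\<forall>b\<in>Basis. (\<lambda>x. g x \<bullet> b) \<in> L2_space S"
  have m[measurable]: "(\<lambda>x. indicator S x * (g x \<bullet> b)) \<in> borel_measurable borel" if "b \<in> Basis" for b
    using * that by (auto simp: L2_space_iff)
  have "(\<lambda>x. \<Sum>b\<in>Basis. (indicator S x * (g x \<bullet> b)) *\<^sub>R b) \<in> borel_measurable borel"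
    by measurable
  moreover have "(\<Sum>b\<in>Basis. (indicator S x * (g x \<bullet> b)) *\<^sub>R b) = indicator S x *\<^sub>R g x" for x
    by (cases "x \<in> S") (simp_all add: euclidean_representation)
  moreover have "(\<integral>\<^sup>+x\<in>S. ennreal ((norm (g x))\<^sup>2) \<partial>lborel) < \<infinity>"
  proof -
    have "(\<integral>\<^sup>+x\<in>S. ennreal ((norm (g x))\<^sup>2) \<partial>lborel) = (\<integral>\<^sup>+x. (\<Sum>b\<in>Basis. ennreal ((indicator S x * (g x \<bullet> b))\<^sup>2)) \<partial>lborel)"
    proof (rule nn_integral_cong)
      fix x
      show "ennreal ((norm (g x))\<^sup>2) * indicator S x = (\<Sum>b\<in>Basis. ennreal ((indicator S x * (g x \<bullet> b))\<^sup>2))"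
        by (cases "x \<in> S") (simp_all add: norm_power2_Basis sum_ennreal)
    qed
    also have "\<dots> = (\<Sum>b\<in>Basis. \<integral>\<^sup>+x. ennreal ((indicator S x * (g x \<bullet> b))\<^sup>2) \<partial>lborel)"
      by (intro nn_integral_sum) auto
    also have "\<dots> < \<infinity>"
      using * by (auto simp: L2_space_iff integrable_iff_bounded ennreal_sum_less_top)
    finally show ?thesis .
  qed
  ultimately show "g \<in> L2_space S"
    by (simp add: L2_space_def set_borel_measurable_def L2_norm_on_def)
qed

definition grad :: "('a::euclidean_space \<Rightarrow> real) \<Rightarrow> 'a \<Rightarrow> 'a" where
  "grad \<phi> x = (\<Sum>b\<in>Basis. pd b \<phi> x *\<^sub>R b)"

lemma grad_inner: "b \<in> Basis \<Longrightarrow> grad \<phi> x \<bullet> b = pd b \<phi> x"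
  by (simp add: grad_def)

lemma test_in_L2: "\<phi> \<in> test_functions \<Omega> \<Longrightarrow> \<phi> \<in> L2_space \<Omega>"
proof -
  assume \<phi>: "\<phi> \<in> test_functions \<Omega>"
  have "(\<lambda>x. indicator \<Omega> x * \<phi> x) = \<phi>" "(\<lambda>x. (indicator \<Omega> x * \<phi> x)\<^sup>2) = (\<lambda>x. (\<phi> x)\<^sup>2)"
    using test_zero[OF \<phi>] by (auto simp: indicator_def fun_eq_iff)
  then show ?thesis
    using test_borel[OF \<phi>] test_integrable_square[OF \<phi>] by (simp add: L2_space_iff)
qed

lemma set_integral_eq_mult:
  fixes f :: "'a::euclidean_space \<Rightarrow> real"
  assumes "\<And>x. x \<notin> S \<Longrightarrow> f x = 0"
  shows "(LINT x:S|lborel. f x) = (\<integral>x. f x \<partial>lborel)"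
  unfolding set_lebesgue_integral_def using assms
  by (intro Bochner_Integration.integral_cong) (auto simp: indicator_def)

lemma is_weak_gradient_test:
  assumes \<phi>: "\<phi> \<in> test_functions \<Omega>"
  shows "is_weak_gradient \<Omega> \<phi> (grad \<phi>)"
  unfolding is_weak_gradient_def
proof (intro conjI ballI)
  show "grad \<phi> \<in> L2_space \<Omega>"
    using \<phi> by (auto simp: L2_space_vec_iff grad_inner intro!: test_in_L2[OF test_pd])
  fix \<psi> b assume \<psi>: "\<psi> \<in> test_functions \<Omega>" and b: "(b::'a) \<in> Basis"
  have "(LINT x:\<Omega>|lborel. \<phi> x * frechet_derivative \<psi> (at x) b) = (\<integral>x. \<phi> x * pd b \<psi> x \<partial>lborel)"
    using test_zero[OF \<phi>] by (subst set_integral_eq_mult) (auto simp: pd_def)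
  moreover have "(LINT x:\<Omega>|lborel. (grad \<phi> x \<bullet> b) * \<psi> x) = (\<integral>x. pd b \<phi> x * \<psi> x \<partial>lborel)"
    using test_zero[OF \<psi>] b by (subst set_integral_eq_mult) (auto simp: grad_inner)
  ultimately show "(LINT x:\<Omega>|lborel. \<phi> x * frechet_derivative \<psi> (at x) b) =
      - (LINT x:\<Omega>|lborel. (grad \<phi> x \<bullet> b) * \<psi> x)"
    using integration_by_parts[OF test_smooth[OF \<phi>] \<psi> b] by simp
qed

section \<open>Uniqueness of weak gradients and approximation in \<open>H10_space\<close>\<close>

context
  fixes \<Omega> :: "'a::euclidean_space set"
  assumes dom: "open \<Omega>" "bounded \<Omega>"
begin

lemma L2_imp_integrable:
  "u \<in> L2_space \<Omega> \<Longrightarrow> integrable lborel (\<lambda>x. indicator \<Omega> x * u x)" for u :: "'a \<Rightarrow> real"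
  by (rule square_integrable_imp_integrable[OF _ _ dom(2)]) (auto simp: L2_space_iff)

lemma L2_mult_test_integrable:
  assumes "u \<in> L2_space \<Omega>" "\<psi> \<in> test_functions \<Omega>"
  shows "integrable lborel (\<lambda>x. indicator \<Omega> x * u x * \<psi> x)"
  by (rule test_bounded[OF assms(2)])
    (rule integrable_mult_bounded[OF L2_imp_integrable[OF assms(1)] test_borel[OF assms(2)]])

lemma is_weak_gradient_diff:
  assumes "is_weak_gradient \<Omega> u g" "is_weak_gradient \<Omega> v h" "u \<in> L2_space \<Omega>" "v \<in> L2_space \<Omega>"
  shows "is_weak_gradient \<Omega> (\<lambda>x. u x - v x) (\<lambda>x. g x - h x)"
  unfolding is_weak_gradient_def
proof (intro conjI ballI)
  have gh: "g \<in> L2_space \<Omega>" "h \<in> L2_space \<Omega>"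
    using assms by (auto simp: is_weak_gradient_def)
  then show "(\<lambda>x. g x - h x) \<in> L2_space \<Omega>"
    by (auto simp: L2_space_vec_iff inner_diff_left intro: L2_space_diff)
  fix \<psi> b assume \<psi>: "\<psi> \<in> test_functions \<Omega>" and b: "(b::'a) \<in> Basis"
  have i1: "integrable lborel (\<lambda>x. indicator \<Omega> x * u x * pd b \<psi> x)"
    "integrable lborel (\<lambda>x. indicator \<Omega> x * v x * pd b \<psi> x)"
    using L2_mult_test_integrable assms test_pd[OF \<psi> b] by blast+
  have i2: "integrable lborel (\<lambda>x. indicator \<Omega> x * (g x \<bullet> b) * \<psi> x)"
    "integrable lborel (\<lambda>x. indicator \<Omega> x * (h x \<bullet> b) * \<psi> x)"
    using L2_mult_test_integrable gh \<psi> b by (auto simp: L2_space_vec_iff)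
  have "(LINT x:\<Omega>|lborel. (u x - v x) * frechet_derivative \<psi> (at x) b) =
      (LINT x:\<Omega>|lborel. u x * frechet_derivative \<psi> (at x) b) - (LINT x:\<Omega>|lborel. v x * frechet_derivative \<psi> (at x) b)"
    using i1 by (simp add: set_lebesgue_integral_def pd_def algebra_simps flip: Bochner_Integration.integral_diff)
  moreover have "(LINT x:\<Omega>|lborel. ((g x - h x) \<bullet> b) * \<psi> x) =
      (LINT x:\<Omega>|lborel. (g x \<bullet> b) * \<psi> x) - (LINT x:\<Omega>|lborel. (h x \<bullet> b) * \<psi> x)"
    using i2 by (simp add: set_lebesgue_integral_def algebra_simps flip: Bochner_Integration.integral_diff)
  ultimately show "(LINT x:\<Omega>|lborel. (u x - v x) * frechet_derivative \<psi> (at x) b) =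
      - (LINT x:\<Omega>|lborel. ((g x - h x) \<bullet> b) * \<psi> x)"
    using assms \<psi> b by (simp add: is_weak_gradient_def)
qed

text \<open>Each component of g - h integrates to zero against every test function. As
  \<open>weak_gradient\<close> is an arbitrary choice, its values are accessible only through this
  uniqueness almost everywhere.\<close>

lemma weak_gradient_unique:
  assumes "is_weak_gradient \<Omega> u g" "is_weak_gradient \<Omega> u h"
  shows "AE x in lborel. x \<in> \<Omega> \<longrightarrow> g x = h x"
proof -
  have gh: "g \<in> L2_space \<Omega>" "h \<in> L2_space \<Omega>"
    using assms by (auto simp: is_weak_gradient_def)
  have "AE x in lborel. indicator \<Omega> x * ((g x - h x) \<bullet> b) = 0" if b: "b \<in> Basis" for b
  proof (rule AE_zero_if_test_integrals_zero[OF _ dom(1)])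
    show "integrable lborel (\<lambda>x. indicator \<Omega> x * ((g x - h x) \<bullet> b))"
      using gh b by (auto simp: L2_space_vec_iff inner_diff_left intro!: L2_imp_integrable L2_space_diff)
    fix \<psi> assume \<psi>: "\<psi> \<in> test_functions \<Omega>"
    have i2: "integrable lborel (\<lambda>x. indicator \<Omega> x * (g x \<bullet> b) * \<psi> x)"
      "integrable lborel (\<lambda>x. indicator \<Omega> x * (h x \<bullet> b) * \<psi> x)"
      using L2_mult_test_integrable gh \<psi> b by (auto simp: L2_space_vec_iff)
    have "(\<integral>x. indicator \<Omega> x * ((g x - h x) \<bullet> b) * \<psi> x \<partial>lborel) =
        (LINT x:\<Omega>|lborel. (g x \<bullet> b) * \<psi> x) - (LINT x:\<Omega>|lborel. (h x \<bullet> b) * \<psi> x)"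
      using i2 by (simp add: set_lebesgue_integral_def algebra_simps flip: Bochner_Integration.integral_diff)
    also have "\<dots> = 0"
      using bspec[OF bspec[OF conjunct2[OF assms(1)[unfolded is_weak_gradient_def]] \<psi>] b]
        bspec[OF bspec[OF conjunct2[OF assms(2)[unfolded is_weak_gradient_def]] \<psi>] b] by linarith
    finally show "(\<integral>x. indicator \<Omega> x * ((g x - h x) \<bullet> b) * \<psi> x \<partial>lborel) = 0" .
  qed auto
  then have "AE x in lborel. \<forall>b\<in>Basis. indicator \<Omega> x * ((g x - h x) \<bullet> b) = 0"
    by (intro AE_ball_countable') (auto simp: countable_finite)
  then show ?thesis
  proof eventually_elim
    case (elim x)
    then show ?case
      by (auto intro!: euclidean_eqI[of "g x"] simp: inner_diff_left)
  qed
qed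

lemma is_weak_gradient_weak_gradient: "u \<in> H1_space \<Omega> \<Longrightarrow> is_weak_gradient \<Omega> u (weak_gradient \<Omega> u)"
  unfolding weak_gradient_def H1_space_def using someI_ex[of "is_weak_gradient \<Omega> u"] by simp

lemma test_in_H1: "\<phi> \<in> test_functions \<Omega> \<Longrightarrow> \<phi> \<in> H1_space \<Omega>"
  using is_weak_gradient_test test_in_L2 by (auto simp: H1_space_def)

lemma weak_gradient_test:
  "\<phi> \<in> test_functions \<Omega> \<Longrightarrow> AE x in lborel. x \<in> \<Omega> \<longrightarrow> weak_gradient \<Omega> \<phi> x = grad \<phi> x"
  by (rule weak_gradient_unique[OF is_weak_gradient_weak_gradient[OF test_in_H1] is_weak_gradient_test])

lemma L2_norm_on_cong_AE:
  assumes "AE x in lborel. x \<in> \<Omega> \<longrightarrow> g x = h x"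
  shows "L2_norm_on \<Omega> g = L2_norm_on \<Omega> h"
proof -
  have "AE x in lborel. ennreal ((norm (g x))\<^sup>2) * indicator \<Omega> x = ennreal ((norm (h x))\<^sup>2) * indicator \<Omega> x"
    using assms by eventually_elim (simp add: indicator_def)
  then show ?thesis
    unfolding L2_norm_on_def by (intro arg_cong[where f=esqrt] nn_integral_cong_AE)
qed

lemma test_in_H10:
  assumes "\<phi> \<in> test_functions \<Omega>"
  shows "\<phi> \<in> H10_space \<Omega>"
proof -
  \<comment> \<open>Even for the zero function the chosen weak gradient is known to vanish only
    almost everywhere on \<Omega>.\<close>
  have "L2_norm_on \<Omega> (weak_gradient \<Omega> (\<lambda>x. 0)) = L2_norm_on \<Omega> (grad (\<lambda>x. 0))"
    by (intro L2_norm_on_cong_AE weak_gradient_test test_0)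
  then have "H1_norm \<Omega> (\<lambda>x. 0) = 0"
    by (simp add: H1_norm_def L2_norm_on_def grad_def[abs_def] pd_const)
  then show ?thesis
    using assms test_in_H1 by (auto simp: H10_space_def intro!: exI[of _ "\<lambda>n. \<phi>"])
qed

text \<open>The H1 norm of u - \<phi> contains the chosen gradient of the difference; uniqueness
  identifies it with the difference of the two gradients, and each component is bounded by the norm
  of that difference.\<close>

lemma H10_approximation:
  assumes "u \<in> H10_space \<Omega>"
  obtains \<phi> where "\<And>n. \<phi> n \<in> test_functions \<Omega>"
    "(\<lambda>n. \<integral>\<^sup>+x. ennreal ((indicator \<Omega> x * (u x - \<phi> n x))\<^sup>2) \<partial>lborel) \<longlonglongrightarrow> 0"
    "\<And>b. b \<in> Basis \<Longrightarrow> (\<lambda>n. \<integral>\<^sup>+x. ennreal ((indicator \<Omega> x * (weak_gradient \<Omega> u x \<bullet> b - pd b (\<phi> n) x))\<^sup>2) \<partial>lborel) \<longlonglongrightarrow> 0"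
proof -
  obtain \<phi> where \<phi>: "\<And>n::nat. \<phi> n \<in> test_functions \<Omega>"
    and lim: "(\<lambda>n. H1_norm \<Omega> (\<lambda>x. u x - \<phi> n x)) \<longlonglongrightarrow> 0" and u: "u \<in> H1_space \<Omega>"
    using assms by (auto simp: H10_space_def)
  define N1 where "N1 n = (L2_norm_on \<Omega> (\<lambda>x. u x - \<phi> n x))\<^sup>2" for n
  define N2 where "N2 n = (L2_norm_on \<Omega> (weak_gradient \<Omega> (\<lambda>x. u x - \<phi> n x)))\<^sup>2" for n
  have "(\<lambda>n. N1 n + N2 n) \<longlonglongrightarrow> 0"
    using lim by (simp add: H1_norm_def esqrt_tendsto_0_iff N1_def N2_def)
  then have l1: "N1 \<longlonglongrightarrow> 0" and l2: "N2 \<longlonglongrightarrow> 0"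
    by (auto intro!: tendsto_sandwich[OF _ _ tendsto_const, where h="\<lambda>n. N1 n + N2 n"])
  have N2: "N2 n = (\<integral>\<^sup>+x\<in>\<Omega>. ennreal ((norm (weak_gradient \<Omega> u x - grad (\<phi> n) x))\<^sup>2) \<partial>lborel)" for n
  proof -
    have L2: "u \<in> L2_space \<Omega>" "\<phi> n \<in> L2_space \<Omega>" using u test_in_L2[OF \<phi>] by (auto simp: H1_space_def)
    have w: "is_weak_gradient \<Omega> (\<lambda>x. u x - \<phi> n x) (\<lambda>x. weak_gradient \<Omega> u x - grad (\<phi> n) x)"
      by (intro is_weak_gradient_diff is_weak_gradient_weak_gradient u is_weak_gradient_test \<phi> L2)
    then have "(\<lambda>x. u x - \<phi> n x) \<in> H1_space \<Omega>"
      using L2 L2_space_diff by (auto simp: H1_space_def)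
    then have "AE x in lborel. x \<in> \<Omega> \<longrightarrow> weak_gradient \<Omega> (\<lambda>x. u x - \<phi> n x) x = weak_gradient \<Omega> u x - grad (\<phi> n) x"
      by (rule weak_gradient_unique[OF is_weak_gradient_weak_gradient w])
    then show ?thesis
      unfolding N2_def by (subst L2_norm_on_cong_AE) (auto simp: L2_norm_on_power2)
  qed
  show thesis
  proof (rule that[OF \<phi>])
    show "(\<lambda>n. \<integral>\<^sup>+x. ennreal ((indicator \<Omega> x * (u x - \<phi> n x))\<^sup>2) \<partial>lborel) \<longlonglongrightarrow> 0"
      using l1 unfolding N1_def[abs_def] L2_norm_on_power2 set_nn_integral_eq_real .
    fix b :: 'a assume b: "b \<in> Basis"
    show "(\<lambda>n. \<integral>\<^sup>+x. ennreal ((indicator \<Omega> x * (weak_gradient \<Omega> u x \<bullet> b - pd b (\<phi> n) x))\<^sup>2) \<partial>lborel) \<longlonglongrightarrow> 0"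
    proof (rule tendsto_sandwich[OF _ _ tendsto_const l2])
      have "ennreal ((indicator \<Omega> x * (weak_gradient \<Omega> u x \<bullet> b - pd b (\<phi> n) x))\<^sup>2)
          \<le> ennreal ((norm (weak_gradient \<Omega> u x - grad (\<phi> n) x))\<^sup>2) * indicator \<Omega> x" for n x
        using Basis_le_norm[OF b, of "weak_gradient \<Omega> u x - grad (\<phi> n) x"] b
        by (auto simp: indicator_def inner_diff_left grad_inner intro!: ennreal_leI abs_le_square_iff[THEN iffD1])
      then show "\<forall>\<^sub>F n in sequentially. (\<integral>\<^sup>+x. ennreal ((indicator \<Omega> x * (weak_gradient \<Omega> u x \<bullet> b - pd b (\<phi> n) x))\<^sup>2) \<partial>lborel) \<le> N2 n"
        unfolding N2 by (intro always_eventually allI nn_integral_mono)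
    qed auto
  qed
qed

end

section \<open>Square-integral estimates for mollification\<close>

lemma ball_borel [measurable]: "ball (c::'a::euclidean_space) r \<in> sets borel"
  by simp

lemma borel_measurable_lborel_pair:
  "f \<in> borel_measurable (borel \<Otimes>\<^sub>M borel) \<Longrightarrow> f \<in> borel_measurable (lborel \<Otimes>\<^sub>M lborel)"
  by (simp add: measurable_def sets_pair_measure_cong[of lborel borel lborel borel] space_pair_measure)

text \<open>Cauchy-Schwarz against the indicator of A. If f is not integrable, its Bochner integral
  has the default value 0 and the bound is trivial.\<close>

lemma integral_square_le:
  fixes f :: "'b \<Rightarrow> real"
  assumes A[measurable]: "A \<in> sets M" and f[measurable]: "f \<in> borel_measurable M"
    and z: "\<And>x. x \<notin> A \<Longrightarrow> f x = 0"
  shows "ennreal ((\<integral>x. f x \<partial>M)\<^sup>2) \<le> emeasure M A * (\<integral>\<^sup>+x. ennreal ((f x)\<^sup>2) \<partial>M)"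
proof -
  have "ennreal \<bar>\<integral>x. f x \<partial>M\<bar> \<le> (\<integral>\<^sup>+x. ennreal \<bar>f x\<bar> \<partial>M)"
    by (cases "integrable M f") (use integral_norm_bound_ennreal in \<open>force simp: not_integrable_integral_eq\<close>)+
  also have "\<dots> = (\<integral>\<^sup>+x. indicator A x * ennreal \<bar>f x\<bar> \<partial>M)"
    by (intro nn_integral_cong) (use z in \<open>auto simp: indicator_def\<close>)
  finally have "ennreal ((\<integral>x. f x \<partial>M)\<^sup>2) \<le> (\<integral>\<^sup>+x. indicator A x * ennreal \<bar>f x\<bar> \<partial>M)\<^sup>2"
    using power_mono[of "ennreal \<bar>\<integral>x. f x \<partial>M\<bar>" _ 2] by (simp add: ennreal_power)
  also have "\<dots> \<le> (\<integral>\<^sup>+x. (indicator A x)\<^sup>2 \<partial>M) * (\<integral>\<^sup>+x. (ennreal \<bar>f x\<bar>)\<^sup>2 \<partial>M)"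
    by (intro Cauchy_Schwarz_nn_integral) measurable
  also have "(\<integral>\<^sup>+x. (indicator A x)\<^sup>2 \<partial>M) = emeasure M A"
    by (simp add: power2_eq_square indicator_inter_arith[symmetric])
  also have "(\<integral>\<^sup>+x. (ennreal \<bar>f x\<bar>)\<^sup>2 \<partial>M) = (\<integral>\<^sup>+x. ennreal ((f x)\<^sup>2) \<partial>M)"
    by (simp add: ennreal_power)
  finally show ?thesis .
qed

text \<open>The nonlocal energy over the whole space with the kernel replaced by the indicator of
  its range: what remains after the lower bound on the kernel has been used.\<close>

definition diff_energy :: "real \<Rightarrow> ('a::euclidean_space \<Rightarrow> real) \<Rightarrow> ennreal" where
  "diff_energy \<delta> v = (\<integral>\<^sup>+x. \<integral>\<^sup>+h. indicator (ball 0 \<delta>) h * ennreal ((v (x + h) - v x)\<^sup>2) \<partial>lborel \<partial>lborel)"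

text \<open>Cauchy-Schwarz in h over the ball of radius \<delta>, followed by integration in x. The
  constant is the volume of that ball times the square of the bound on K.\<close>

lemma kernel_diff_estimate:
  fixes v :: "'a::euclidean_space \<Rightarrow> real"
  assumes [measurable]: "v \<in> borel_measurable borel" "K \<in> borel_measurable borel"
    and K: "\<And>h. \<bar>K h\<bar> \<le> \<kappa>" "\<And>h. h \<notin> ball 0 \<delta> \<Longrightarrow> K h = 0" and \<delta>: "\<delta> > 0"
  shows "(\<integral>\<^sup>+x. ennreal ((\<integral>h. K h * (v (x + h) - v x) \<partial>lborel)\<^sup>2) \<partial>lborel)
    \<le> ennreal (unit_ball_vol DIM('a) * \<delta> ^ DIM('a) * \<kappa>\<^sup>2) * diff_energy \<delta> v"
proof -
  let ?V = "unit_ball_vol (real DIM('a)) * \<delta> ^ DIM('a)"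
  have V: "emeasure lborel (ball (0::'a) \<delta>) = ennreal ?V"
    using \<delta> by (simp add: emeasure_ball)
  have V0: "?V \<ge> 0" using \<delta> by simp
  have "ennreal ((\<integral>h. K h * (v (x + h) - v x) \<partial>lborel)\<^sup>2)
      \<le> ennreal (?V * \<kappa>\<^sup>2) * (\<integral>\<^sup>+h. indicator (ball 0 \<delta>) h * ennreal ((v (x + h) - v x)\<^sup>2) \<partial>lborel)" for x
  proof -
    have "ennreal ((\<integral>h. K h * (v (x + h) - v x) \<partial>lborel)\<^sup>2)
        \<le> emeasure lborel (ball (0::'a) \<delta>) * (\<integral>\<^sup>+h. ennreal ((K h * (v (x + h) - v x))\<^sup>2) \<partial>lborel)"
      using K(2) by (intro integral_square_le) auto
    also have "\<dots> \<le> ennreal ?V * (\<integral>\<^sup>+h. ennreal (\<kappa>\<^sup>2) * (indicator (ball 0 \<delta>) h * ennreal ((v (x + h) - v x)\<^sup>2)) \<partial>lborel)"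
      unfolding V
    proof (intro mult_left_mono nn_integral_mono)
      fix h
      have "(K h)\<^sup>2 \<le> \<kappa>\<^sup>2" using K(1)[of h] by (metis abs_le_square_iff abs_of_nonneg abs_ge_zero order_trans)
      then show "ennreal ((K h * (v (x + h) - v x))\<^sup>2)
          \<le> ennreal (\<kappa>\<^sup>2) * (indicator (ball 0 \<delta>) h * ennreal ((v (x + h) - v x)\<^sup>2))"
        using K(2)[of h] by (cases "h \<in> ball 0 \<delta>")
          (auto simp: ennreal_mult[symmetric] power_mult_distrib intro!: ennreal_leI mult_right_mono)
    qed simp
    also have "\<dots> = ennreal (?V * \<kappa>\<^sup>2) * (\<integral>\<^sup>+h. indicator (ball 0 \<delta>) h * ennreal ((v (x + h) - v x)\<^sup>2) \<partial>lborel)"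
      unfolding ennreal_mult[OF V0 zero_le_power2]
      by (subst nn_integral_cmult) (measurable, simp only: mult.assoc)
    finally show ?thesis .
  qed
  then have "(\<integral>\<^sup>+x. ennreal ((\<integral>h. K h * (v (x + h) - v x) \<partial>lborel)\<^sup>2) \<partial>lborel)
    \<le> (\<integral>\<^sup>+x. ennreal (?V * \<kappa>\<^sup>2) * (\<integral>\<^sup>+h. indicator (ball 0 \<delta>) h * ennreal ((v (x + h) - v x)\<^sup>2) \<partial>lborel) \<partial>lborel)"
    by (intro nn_integral_mono)
  then show ?thesis
    unfolding diff_energy_def
    by (subst (asm) nn_integral_cmult)
      (auto intro!: lborel.borel_measurable_nn_integral borel_measurable_lborel_pair)
qed

lemma corr_alt: "corr \<zeta> v x = (\<integral>h. v (x + h) * \<zeta> h \<partial>lborel)"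
  unfolding corr_def
  by (subst lborel_translation(1)[symmetric, where a=x]) (simp add: add.commute)

lemma corr_integrable_alt:
  assumes "\<zeta> \<in> test_functions \<Omega>" "integrable lborel v"
  shows "integrable lborel (\<lambda>h. v (x + h) * \<zeta> h)"
  using corr_integrable[OF assms, of x] lborel_translation(2)[of "\<lambda>y. v y * \<zeta> (y - x)" x]
  by (simp add: add.commute)

lemma corr_diff_eq:
  assumes "\<zeta> \<in> test_functions \<Omega>" "integrable lborel v"
  shows "(\<integral>h. \<zeta> h * (v (x + h) - v x) \<partial>lborel) = corr \<zeta> v x - (\<integral>h. \<zeta> h \<partial>lborel) * v x"
  using corr_integrable_alt[OF assms, of x] test_integrable[OF assms(1)]
  by (simp add: corr_alt right_diff_distrib mult.commute)

text \<open>Subtracting the mass of \<zeta> times v makes one estimate serve two purposes: with mass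
  1 it measures the mollification error, and for a derivative of a mollifier, whose mass is 0, it
  bounds the gradient of the mollified function.\<close>

lemma corr_estimate:
  fixes v :: "'a::euclidean_space \<Rightarrow> real"
  assumes \<zeta>: "\<zeta> \<in> test_functions (ball 0 \<delta>)" and v: "integrable lborel v"
    and \<kappa>: "\<And>h. \<bar>\<zeta> h\<bar> \<le> \<kappa>" and \<delta>: "\<delta> > 0"
  shows "(\<integral>\<^sup>+x. ennreal ((corr \<zeta> v x - (\<integral>h. \<zeta> h \<partial>lborel) * v x)\<^sup>2) \<partial>lborel)
    \<le> ennreal (unit_ball_vol DIM('a) * \<delta> ^ DIM('a) * \<kappa>\<^sup>2) * diff_energy \<delta> v"
  using kernel_diff_estimate[of v \<zeta> \<kappa> \<delta>] v \<kappa> \<delta> test_zero[OF \<zeta>] test_borel[OF \<zeta>]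
  by (simp add: corr_diff_eq[OF \<zeta> v])

section \<open>Mollifiers at scale \<delta>\<close>

definition scaled :: "real \<Rightarrow> ('a::euclidean_space \<Rightarrow> real) \<Rightarrow> 'a \<Rightarrow> real" where
  "scaled \<delta> \<zeta> h = \<zeta> (h /\<^sub>R \<delta>) / \<delta> ^ DIM('a)"

lemma smooth_scale:
  fixes \<zeta> :: "'a::euclidean_space \<Rightarrow> real"
  assumes "smooth \<zeta>"
  shows "smooth (\<lambda>h. \<zeta> (c *\<^sub>R h))" "b \<in> Basis \<Longrightarrow> pd b (\<lambda>h. \<zeta> (c *\<^sub>R h)) x = c * pd b \<zeta> (c *\<^sub>R x)"
proof -
  have d: "((\<lambda>h. \<zeta> (c *\<^sub>R h)) has_derivative (\<lambda>h. frechet_derivative \<zeta> (at (c *\<^sub>R x)) (c *\<^sub>R h))) (at x)"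
    if "smooth \<zeta>" for \<zeta> :: "'a \<Rightarrow> real" and x
    by (rule has_derivative_compose[OF bounded_linear_imp_has_derivative smooth_has_derivative[OF that]])
      (rule bounded_linear_scaleR_right)
  have e: "frechet_derivative \<zeta> (at y) (c *\<^sub>R b) = c * pd b \<zeta> y" if "smooth \<zeta>" for \<zeta> :: "'a \<Rightarrow> real" and y b
    using has_derivative_linear[OF smooth_has_derivative[OF that]] by (simp add: linear_scale pd_def)
  have "C_k k (\<lambda>h. \<zeta> (c *\<^sub>R h))" if "smooth \<zeta>" for k and \<zeta> :: "'a \<Rightarrow> real"
    using that
  proof (induction k arbitrary: \<zeta>)
    case 0
    then show ?case
      unfolding C_k.simps
      by (intro continuous_on_compose2[OF smooth_continuous_on[of \<zeta> UNIV]] continuous_intros) auto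
  next
    case (Suc k)
    show ?case
    proof (rule C_k_SucI[OF d[OF Suc.prems]])
      fix b :: 'a assume "b \<in> Basis"
      then show "C_k k (\<lambda>x. frechet_derivative \<zeta> (at (c *\<^sub>R x)) (c *\<^sub>R b))"
        unfolding e[OF Suc.prems] using Suc by (intro C_k_mult C_k_const Suc.IH smooth_pd)
    qed
  qed
  then show "smooth (\<lambda>h. \<zeta> (c *\<^sub>R h))" using assms by (simp add: smooth_def)
  show "b \<in> Basis \<Longrightarrow> pd b (\<lambda>h. \<zeta> (c *\<^sub>R h)) x = c * pd b \<zeta> (c *\<^sub>R x)"
    using pd_eqI[OF d[OF assms]] e[OF assms] by simp
qed

lemma integral_scale:
  fixes f :: "'a::euclidean_space \<Rightarrow> real"
  assumes "\<delta> > 0" and f: "integrable lborel f"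
  shows "(\<integral>h. f (h /\<^sub>R \<delta>) \<partial>lborel) = \<delta> ^ DIM('a) * (\<integral>h. f h \<partial>lborel)"
proof -
  have [measurable]: "f \<in> borel_measurable borel" using f by auto
  let ?M = "density (distr lborel borel (\<lambda>x. 0 + \<delta> *\<^sub>R x)) (\<lambda>_. ennreal (\<bar>\<delta>\<bar> ^ DIM('a))) :: 'a measure"
  have "(\<integral>h. f (h /\<^sub>R \<delta>) \<partial>lborel) = (\<integral>h. f (h /\<^sub>R \<delta>) \<partial>?M)"
    using lborel_affine[of \<delta> "0::'a"] assms(1) by simp
  also have "\<dots> = (\<integral>h. \<bar>\<delta>\<bar> ^ DIM('a) * f h \<partial>lborel)"
    using assms(1) by (subst integral_density) (auto simp: integral_distr)
  finally show ?thesis using assms(1) by simp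
qed

lemma scaled_properties:
  fixes \<zeta> :: "'a::euclidean_space \<Rightarrow> real"
  assumes \<zeta>: "\<zeta> \<in> test_functions (ball 0 1)" and \<delta>: "\<delta> > 0"
  shows "scaled \<delta> \<zeta> \<in> test_functions (ball 0 \<delta>)"
    "(\<integral>h. scaled \<delta> \<zeta> h \<partial>lborel) = (\<integral>h. \<zeta> h \<partial>lborel)"
    "b \<in> Basis \<Longrightarrow> pd b (scaled \<delta> \<zeta>) x = scaled \<delta> (pd b \<zeta>) x / \<delta>"
proof -
  obtain K where K: "smooth \<zeta>" "compact K" "K \<subseteq> ball 0 1" "\<And>x. x \<notin> K \<Longrightarrow> \<zeta> x = 0"
    using \<zeta> by (metis test_functionsE)
  have s: "smooth (\<lambda>h. \<zeta> (h /\<^sub>R \<delta>))" by (rule smooth_scale(1)[OF K(1)])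
  have sm: "scaled \<delta> \<zeta> = (\<lambda>h. (1 / \<delta> ^ DIM('a)) * \<zeta> (h /\<^sub>R \<delta>))"
    by (simp add: scaled_def fun_eq_iff)
  show "scaled \<delta> \<zeta> \<in> test_functions (ball 0 \<delta>)"
  proof (rule test_functionsI)
    show "smooth (scaled \<delta> \<zeta>)" unfolding sm using s by (intro smooth_mult smooth_const)
    show "compact ((\<lambda>x. \<delta> *\<^sub>R x) ` K)"
      using K(2) by (intro compact_continuous_image continuous_intros)
    show "(\<lambda>x. \<delta> *\<^sub>R x) ` K \<subseteq> ball 0 \<delta>" using K(3) \<delta> by auto
    fix x assume "x \<notin> (\<lambda>x. \<delta> *\<^sub>R x) ` K"
    moreover have "x = \<delta> *\<^sub>R (x /\<^sub>R \<delta>)" using \<delta> by simp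
    ultimately have "x /\<^sub>R \<delta> \<notin> K" by blast
    then show "scaled \<delta> \<zeta> x = 0" by (simp add: scaled_def K(4))
  qed
  show "(\<integral>h. scaled \<delta> \<zeta> h \<partial>lborel) = (\<integral>h. \<zeta> h \<partial>lborel)"
    using integral_scale[OF \<delta> test_integrable[OF \<zeta>]] \<delta> by (simp add: sm)
  show "pd b (scaled \<delta> \<zeta>) x = scaled \<delta> (pd b \<zeta>) x / \<delta>" if "b \<in> Basis"
    unfolding sm pd_cmult[OF s] smooth_scale(2)[OF K(1) that] by (simp add: scaled_def divide_inverse)
qed

text \<open>A bump is positive on a ball of positive measure, so it can be normalised. The centre is
  arbitrary because the mollifiers at the boundary are shifted away from the origin.\<close>

lemma exists_mollifier:
  fixes c :: "'a::euclidean_space"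
  assumes "r > 0"
  obtains \<zeta> where "\<zeta> \<in> test_functions (ball c r)" "(\<integral>h. \<zeta> h \<partial>lborel) = 1"
proof -
  let ?b = "bump c (r / 2)"
  have b: "?b \<in> test_functions (ball c r)" using assms by (intro test_bump) auto
  have "(\<integral>h. ?b h \<partial>lborel) \<noteq> 0"
  proof
    assume "(\<integral>h. ?b h \<partial>lborel) = 0"
    then have "AE h in lborel. ?b h = 0"
      using test_integrable[OF b] bump_nonneg by (subst (asm) integral_nonneg_eq_0_iff_AE) auto
    then have "AE h in lborel. h \<notin> ball c (r / 2)"
    proof eventually_elim
      case (elim h)
      then show ?case using bump_pos_iff[of "r / 2" c h] assms by auto
    qed
    then have "emeasure lborel (ball c (r / 2)) = 0"
      by (subst (asm) AE_iff_measurable[of "ball c (r / 2)"]) auto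
    then show False using assms unit_ball_vol_pos[of "DIM('a)"] by (simp add: emeasure_ball)
  qed
  then show thesis
    by (intro that[of "\<lambda>h. (1 / (\<integral>h. ?b h \<partial>lborel)) * ?b h"] test_cmult b) simp
qed

section \<open>Dirichlet integral, translations and the Poincare inequality\<close>

definition dirichlet :: "('a::euclidean_space \<Rightarrow> real) \<Rightarrow> real" where
  "dirichlet z = (\<integral>x. (\<Sum>b\<in>Basis. (pd b z x)\<^sup>2) \<partial>lborel)"

lemma dirichlet_integrable:
  "z \<in> test_functions \<Omega> \<Longrightarrow> integrable lborel (\<lambda>x. \<Sum>b\<in>Basis. (pd b z x)\<^sup>2)"
  by (intro Bochner_Integration.integrable_sum test_integrable_square test_pd)

lemma dirichlet_nonneg: "dirichlet z \<ge> 0"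
  unfolding dirichlet_def by (intro integral_nonneg_AE AE_I2 sum_nonneg) auto

text \<open>The increment is the integral of the directional derivative along the segment from x to
  x + h. Cauchy-Schwarz in t, Tonelli and translation invariance in x remove the parameter
  t.\<close>

lemma translation_estimate:
  fixes z :: "'a::euclidean_space \<Rightarrow> real"
  assumes z: "z \<in> test_functions \<Omega>"
  shows "(\<integral>\<^sup>+x. ennreal ((z (x + h) - z x)\<^sup>2) \<partial>lborel) \<le> ennreal ((norm h)\<^sup>2 * dirichlet z)"
proof -
  define D where "D x = (\<Sum>b\<in>Basis. (h \<bullet> b) * pd b z x)" for x
  define S where "S x = (\<Sum>b\<in>Basis. (pd b z x)\<^sup>2)" for x
  have pdm: "pd b z \<in> borel_measurable borel" if "b \<in> Basis" for b
    using z that by (intro test_borel test_pd)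
  have [measurable]: "D \<in> borel_measurable borel" "S \<in> borel_measurable borel"
    unfolding D_def S_def using pdm by (auto intro!: borel_measurable_sum borel_measurable_times borel_measurable_power)
  have S0: "S x \<ge> 0" for x by (simp add: S_def sum_nonneg)
  have DS: "(D x)\<^sup>2 \<le> (norm h)\<^sup>2 * S x" for x
  proof -
    have "D x = h \<bullet> grad z x" by (simp add: D_def grad_def inner_sum_right mult.commute)
    moreover have "(norm (grad z x))\<^sup>2 = S x" by (simp add: norm_power2_Basis S_def grad_inner)
    ultimately show ?thesis
      using Cauchy_Schwarz_ineq2[of h "grad z x"]
      by (metis abs_le_square_iff abs_mult abs_norm_cancel power_mult_distrib)
  qed
  have pt: "ennreal ((z (x + h) - z x)\<^sup>2) \<le> (\<integral>\<^sup>+t. indicator {0..1} t * ennreal ((norm h)\<^sup>2 * S (x + t *\<^sub>R h)) \<partial>lborel)" for x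
  proof -
    have d: "((\<lambda>t. z (x + t *\<^sub>R h)) has_vector_derivative D (x + t *\<^sub>R h)) (at t within {0..1})" for t
    proof -
      have "((\<lambda>t. z (x + t *\<^sub>R h)) has_derivative (\<lambda>s. \<Sum>b\<in>Basis. ((s *\<^sub>R h) \<bullet> b) * pd b z (x + t *\<^sub>R h))) (at t within {0..1})"
        by (rule has_derivative_compose[OF _ smooth_has_derivative_pd[OF test_smooth[OF z]]])
          (auto intro!: derivative_eq_intros)
      then show ?thesis
        by (simp add: has_vector_derivative_def D_def sum_distrib_left mult.assoc)
    qed
    have c: "continuous_on {0..1} (\<lambda>t. D (x + t *\<^sub>R h))"
      unfolding D_def using z
      by (intro continuous_intros continuous_on_compose2[OF smooth_continuous_on[OF test_smooth[OF test_pd[OF z]]]]) auto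
    have "z (x + h) - z x = (\<integral>t. indicator {0..1} t *\<^sub>R D (x + t *\<^sub>R h) \<partial>lborel)"
      using integral_FTC_atLeastAtMost[of 0 1 "\<lambda>t. z (x + t *\<^sub>R h)" "\<lambda>t. D (x + t *\<^sub>R h)"] d c by simp
    then have "ennreal ((z (x + h) - z x)\<^sup>2) \<le> emeasure lborel {0..1::real} *
        (\<integral>\<^sup>+t. ennreal ((indicator {0..1} t *\<^sub>R D (x + t *\<^sub>R h))\<^sup>2) \<partial>lborel)"
      by (simp only:) (intro integral_square_le, auto)
    also have "\<dots> = (\<integral>\<^sup>+t. ennreal ((indicator {0..1} t *\<^sub>R D (x + t *\<^sub>R h))\<^sup>2) \<partial>lborel)"
      by simp
    also have "\<dots> \<le> (\<integral>\<^sup>+t. indicator {0..1} t * ennreal ((norm h)\<^sup>2 * S (x + t *\<^sub>R h)) \<partial>lborel)"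
      using DS by (intro nn_integral_mono) (auto simp: indicator_def intro!: ennreal_leI)
    finally show ?thesis .
  qed
  have "(\<integral>\<^sup>+x. ennreal ((z (x + h) - z x)\<^sup>2) \<partial>lborel)
      \<le> (\<integral>\<^sup>+x. \<integral>\<^sup>+t. indicator {0..1} t * ennreal ((norm h)\<^sup>2 * S (x + t *\<^sub>R h)) \<partial>lborel \<partial>lborel)"
    by (intro nn_integral_mono pt)
  also have "\<dots> = (\<integral>\<^sup>+t. \<integral>\<^sup>+x. indicator {0..1} t * ennreal ((norm h)\<^sup>2 * S (x + t *\<^sub>R h)) \<partial>lborel \<partial>lborel)"
    by (intro lborel_pair.Fubini' borel_measurable_lborel_pair) measurable
  also have "\<dots> = (\<integral>\<^sup>+t. indicator {0..1::real} t * (\<integral>\<^sup>+x. ennreal ((norm h)\<^sup>2 * S x) \<partial>lborel) \<partial>lborel)"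
  proof (intro nn_integral_cong)
    fix t :: real
    show "(\<integral>\<^sup>+x. indicator {0..1} t * ennreal ((norm h)\<^sup>2 * S (x + t *\<^sub>R h)) \<partial>lborel)
        = indicator {0..1} t * (\<integral>\<^sup>+x. ennreal ((norm h)\<^sup>2 * S x) \<partial>lborel)"
      using nn_integral_lborel_translation[of "\<lambda>x. ennreal ((norm h)\<^sup>2 * S x)" "t *\<^sub>R h"]
      by (subst nn_integral_cmult) auto
  qed
  also have "\<dots> = (\<integral>\<^sup>+x. ennreal ((norm h)\<^sup>2 * S x) \<partial>lborel)"
    by (subst nn_integral_multc) auto
  also have "\<dots> = ennreal ((norm h)\<^sup>2 * dirichlet z)"
    using dirichlet_integrable[OF z] S0
    by (subst nn_integral_eq_integral) (auto simp: dirichlet_def S_def)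
  finally show ?thesis .
qed

text \<open>Integrating \<open>translation_estimate\<close> over all h shorter than \<delta> gives
  the volume \<delta>^d and the squared length \<delta>^2; the resulting power \<delta>^(d+2) is the
  one that the kernel compensates.\<close>

lemma diff_energy_test:
  fixes z :: "'a::euclidean_space \<Rightarrow> real"
  assumes z: "z \<in> test_functions \<Omega>" and \<delta>: "\<delta> > 0"
  shows "diff_energy \<delta> z \<le> ennreal (unit_ball_vol DIM('a) * \<delta> ^ DIM('a) * (\<delta>\<^sup>2 * dirichlet z))"
proof -
  have [measurable]: "z \<in> borel_measurable borel" by (rule test_borel[OF z])
  have "diff_energy \<delta> z = (\<integral>\<^sup>+h. \<integral>\<^sup>+x. indicator (ball 0 \<delta>) h * ennreal ((z (x + h) - z x)\<^sup>2) \<partial>lborel \<partial>lborel)"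
    unfolding diff_energy_def by (intro lborel_pair.Fubini' borel_measurable_lborel_pair) measurable
  also have "\<dots> \<le> (\<integral>\<^sup>+h. indicator (ball (0::'a) \<delta>) h * ennreal (\<delta>\<^sup>2 * dirichlet z) \<partial>lborel)"
  proof (intro nn_integral_mono)
    fix h :: 'a
    have "(\<integral>\<^sup>+x. ennreal ((z (x + h) - z x)\<^sup>2) \<partial>lborel) \<le> ennreal (\<delta>\<^sup>2 * dirichlet z)" if "norm h < \<delta>"
      by (rule order_trans[OF translation_estimate[OF z]])
        (use that dirichlet_nonneg in \<open>auto intro!: ennreal_leI mult_right_mono power_mono\<close>)
    then show "(\<integral>\<^sup>+x. indicator (ball 0 \<delta>) h * ennreal ((z (x + h) - z x)\<^sup>2) \<partial>lborel)
        \<le> indicator (ball 0 \<delta>) h * ennreal (\<delta>\<^sup>2 * dirichlet z)"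
      by (subst nn_integral_cmult) (auto simp: indicator_def)
  qed
  also have "\<dots> = emeasure lborel (ball (0::'a) \<delta>) * ennreal (\<delta>\<^sup>2 * dirichlet z)"
    by (subst nn_integral_multc) auto
  also have "\<dots> = ennreal (unit_ball_vol DIM('a) * \<delta> ^ DIM('a) * (\<delta>\<^sup>2 * dirichlet z))"
    using \<delta> dirichlet_nonneg[of z] by (simp add: emeasure_ball ennreal_mult)
  finally show ?thesis .
qed

lemma poincare_test:
  fixes \<Omega> :: "'a::euclidean_space set"
  assumes "bounded \<Omega>"
  obtains P where "P > 0" "\<And>z. z \<in> test_functions \<Omega> \<Longrightarrow> (\<integral>x. (z x)\<^sup>2 \<partial>lborel) \<le> P * dirichlet z"
proof -
  obtain a where a: "a > 0" "\<Omega> \<subseteq> cball 0 a"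
    using assms by (auto simp: bounded_pos subset_eq)
  obtain b :: 'a where b: "b \<in> Basis" using nonempty_Basis by blast
  \<comment> \<open>The length 2 a + 1 exceeds the diameter of the ball containing \<Omega>. Thus z
    and its translate have disjoint supports, and the squared norm of their difference dominates
    that of z.\<close>
  define h where "h = (2 * a + 1) *\<^sub>R b"
  have nh: "norm h = 2 * a + 1" using b a by (simp add: h_def)
  have "(\<integral>x. (z x)\<^sup>2 \<partial>lborel) \<le> (2 * a + 1)\<^sup>2 * dirichlet z" if z: "z \<in> test_functions \<Omega>" for z
  proof -
    have disj: "z (x + h) * z x = 0" for x
    proof (rule ccontr)
      assume "z (x + h) * z x \<noteq> 0"
      then have "x \<in> \<Omega>" "x + h \<in> \<Omega>" using test_zero[OF z] by auto
      then have "norm x \<le> a" "norm (x + h) \<le> a" using a by auto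
      then show False using nh norm_triangle_ineq4[of "x + h" x] by simp
    qed
    have sq: "(z (x + h) - z x)\<^sup>2 = (z (x + h))\<^sup>2 + (z x)\<^sup>2" for x
      using disj[of x] by (simp add: power2_diff)
    have i: "integrable lborel (\<lambda>x. (z x)\<^sup>2)" "integrable lborel (\<lambda>x. (z (x + h))\<^sup>2)"
      using test_integrable_square[OF z] lborel_translation(2)[of "\<lambda>x. (z x)\<^sup>2" h] by auto
    have "ennreal (\<integral>x. (z x)\<^sup>2 \<partial>lborel) = (\<integral>\<^sup>+x. ennreal ((z x)\<^sup>2) \<partial>lborel)"
      using i by (subst nn_integral_eq_integral) auto
    also have "\<dots> \<le> (\<integral>\<^sup>+x. ennreal ((z (x + h) - z x)\<^sup>2) \<partial>lborel)"
      unfolding sq by (intro nn_integral_mono ennreal_leI) auto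
    also have "\<dots> \<le> ennreal ((2 * a + 1)\<^sup>2 * dirichlet z)"
      using translation_estimate[OF z, of h] by (simp add: nh)
    finally show ?thesis
      by (subst (asm) ennreal_le_iff) (simp_all add: dirichlet_nonneg)
  qed
  then show thesis using that[of "(2 * a + 1)\<^sup>2"] a by simp
qed

section \<open>Weak and strong convergence in the energy space\<close>

text \<open>A greedy Banach-Saks argument: if \<open>\<ell>(z n)\<close> stayed away from zero, then sums of multiples of
  almost orthogonal terms of the sequence would have \<open>\<ell>\<close> of order \<open>N\<close>, but energy of order \<open>N\<close> only.\<close>

lemma weakly_null_functional_tendsto_0:
  fixes z :: "nat \<Rightarrow> 'a \<Rightarrow> real"
  assumes V: "\<And>n. z n \<in> V" "(\<lambda>x. 0) \<in> V" "\<And>y w c. y \<in> V \<Longrightarrow> w \<in> V \<Longrightarrow> (\<lambda>x. y x + c * w x) \<in> V"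
    and B: "\<And>y w c. y \<in> V \<Longrightarrow> w \<in> V \<Longrightarrow>
        B (\<lambda>x. y x + c * w x) (\<lambda>x. y x + c * w x) = B y y + 2 * c * B w y + c\<^sup>2 * B w w"
      "B (\<lambda>x. 0) (\<lambda>x. 0) = (0::real)" "\<And>y. y \<in> V \<Longrightarrow> 0 \<le> B y y"
    and l: "\<And>y w c. y \<in> V \<Longrightarrow> w \<in> V \<Longrightarrow> l (\<lambda>x. y x + c * w x) = l y + c * l w" "l (\<lambda>x. 0) = (0::real)"
    and K: "\<And>y. y \<in> V \<Longrightarrow> (l y)\<^sup>2 \<le> K * B y y" "K \<ge> 0"
    and M: "\<And>n. B (z n) (z n) \<le> M"
    and weak: "\<And>y. y \<in> V \<Longrightarrow> (\<lambda>n. B (z n) y) \<longlonglongrightarrow> 0"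
  shows "(\<lambda>n. l (z n)) \<longlonglongrightarrow> 0"
proof (rule ccontr)
  assume "\<not> (\<lambda>n. l (z n)) \<longlonglongrightarrow> 0"
  then obtain c where c: "c > 0" "\<And>N. \<exists>n\<ge>N. c \<le> \<bar>l (z n)\<bar>"
    by (auto simp: LIMSEQ_iff not_less)
  have M0: "M \<ge> 0" using B(3)[OF V(1)] M order_trans by blast
  define L where "L = K * M"
  have L: "(l (z n))\<^sup>2 \<le> L" for n
    using K(1)[OF V(1)] mult_left_mono[OF M K(2)] order_trans unfolding L_def by blast
  have L0: "L \<ge> 0" using K(2) M0 by (simp add: L_def)
  have "\<exists>y\<in>V. real N * c\<^sup>2 \<le> l y \<and> B y y \<le> real N * (1 + L * M)" for N
  proof (induction N)
    case 0
    then show ?case using V(2) B(2) l(2) by (intro bexI[of _ "\<lambda>x. 0"]) auto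
  next
    case (Suc N)
    then obtain y where y: "y \<in> V" "real N * c\<^sup>2 \<le> l y" "B y y \<le> real N * (1 + L * M)" by blast
    \<comment> \<open>The threshold for almost orthogonality: since |l(z n)| is at most sqrt L, it
      keeps the cross term of the new energy at most 1.\<close>
    have "1 / (2 * (sqrt L + 1)) > 0" using L0 by (simp add: add_nonneg_pos)
    then obtain n0 where n0: "\<And>n. n \<ge> n0 \<Longrightarrow> \<bar>B (z n) y\<bar> < 1 / (2 * (sqrt L + 1))"
      using LIMSEQ_D[OF weak[OF y(1)]] by (metis diff_zero real_norm_def)
    obtain n where n: "n \<ge> n0" "c \<le> \<bar>l (z n)\<bar>" using c(2) by blast
    \<comment> \<open>Using l(z n) itself as coefficient makes the functional grow by its square,
      hence by at least c^2 irrespective of the sign, while the energy grows by at most 1 + L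
      M.\<close>
    let ?a = "l (z n)"
    have a: "\<bar>?a\<bar> \<le> sqrt L" using L[of n] by (metis real_sqrt_abs real_sqrt_le_mono)
    have "2 * ?a * B (z n) y \<le> 2 * (\<bar>?a\<bar> * \<bar>B (z n) y\<bar>)"
      by (metis abs_ge_self abs_mult mult.assoc mult_le_cancel_left_pos zero_less_numeral)
    also have "\<bar>?a\<bar> * \<bar>B (z n) y\<bar> \<le> (sqrt L + 1) * (1 / (2 * (sqrt L + 1)))"
      using a n0[OF n(1)] L0 by (intro mult_mono) auto
    also have "2 * ((sqrt L + 1) * (1 / (2 * (sqrt L + 1)))) = 1"
      using add_nonneg_pos[OF real_sqrt_ge_zero[OF L0] zero_less_one] by simp
    finally have 1: "2 * ?a * B (z n) y \<le> 1" by simp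
    have 2: "?a\<^sup>2 * B (z n) (z n) \<le> L * M"
      using L[of n] M[of n] B(3)[OF V(1)] L0 by (intro mult_mono) auto
    have 3: "c\<^sup>2 \<le> ?a * ?a"
      using n(2) c(1) by (metis abs_le_square_iff abs_of_pos power2_eq_square)
    show ?case
    proof (intro bexI conjI)
      show "real (Suc N) * c\<^sup>2 \<le> l (\<lambda>x. y x + ?a * z n x)"
        using y(2) 3 by (simp add: l(1)[OF y(1) V(1)] algebra_simps)
      show "B (\<lambda>x. y x + ?a * z n x) (\<lambda>x. y x + ?a * z n x) \<le> real (Suc N) * (1 + L * M)"
        using y(3) 1 2 by (simp add: B(1)[OF y(1) V(1)] algebra_simps)
      show "(\<lambda>x. y x + ?a * z n x) \<in> V" by (intro V y)
    qed
  qed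
  \<comment> \<open>The left side is quadratic in N and the right side linear, which is absurd for
    large N.\<close>
  then have *: "(real N * c\<^sup>2)\<^sup>2 \<le> K * (real N * (1 + L * M))" for N
  proof -
    obtain y where y: "y \<in> V" "real N * c\<^sup>2 \<le> l y" "B y y \<le> real N * (1 + L * M)"
      using \<open>\<And>N. \<exists>y\<in>V. real N * c\<^sup>2 \<le> l y \<and> B y y \<le> real N * (1 + L * M)\<close> by blast
    have "(real N * c\<^sup>2)\<^sup>2 \<le> (l y)\<^sup>2" using y(2) by (intro power_mono) auto
    also have "\<dots> \<le> K * B y y" by (rule K(1)[OF y(1)])
    also have "\<dots> \<le> K * (real N * (1 + L * M))" by (rule mult_left_mono[OF y(3) K(2)])
    finally show ?thesis .
  qed
  obtain N where N: "K * (1 + L * M) / c ^ 4 < real N" using reals_Archimedean2 by blast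
  have c4: "c ^ 4 > 0" using c(1) by simp
  then have N0: "real N > 0"
  proof -
    have "0 \<le> K * (1 + L * M) / c ^ 4" using K(2) L0 M0 c4 by simp
    then show ?thesis using N by linarith
  qed
  have "real N * (real N * c ^ 4) \<le> real N * (K * (1 + L * M))"
    using *[of N] by (simp add: power2_eq_square numeral_eq_Suc algebra_simps)
  then have "real N * c ^ 4 \<le> K * (1 + L * M)" using N0 by simp
  with N c4 show False by (simp add: divide_simps)
qed

section \<open>The local energy form and strong convergence in L2\<close>

definition energy :: "('a::euclidean_space \<Rightarrow> real) \<Rightarrow> ('a \<Rightarrow> real) \<Rightarrow> ('a \<Rightarrow> real) \<Rightarrow> real" where
  "energy a \<phi> \<psi> = (\<integral>x. (\<Sum>b\<in>Basis. pd b \<phi> x * pd b \<psi> x) * a x \<partial>lborel)"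

lemma energy_integrable:
  fixes a :: "'a::euclidean_space \<Rightarrow> real"
  assumes "a \<in> borel_measurable borel" "\<And>x. \<bar>a x\<bar> \<le> R"
    "\<phi> \<in> test_functions \<Omega>" "\<psi> \<in> test_functions \<Omega>"
  shows "integrable lborel (\<lambda>x. (\<Sum>b\<in>Basis. pd b \<phi> x * pd b \<psi> x) * a x)"
  using assms
  by (intro integrable_mult_bounded Bochner_Integration.integrable_sum test_integrable_mult
      smooth_pd test_pd test_smooth) auto

lemma energy_add:
  fixes a :: "'a::euclidean_space \<Rightarrow> real"
  assumes a: "a \<in> borel_measurable borel" "\<And>x. \<bar>a x\<bar> \<le> R"
    and t: "\<phi> \<in> test_functions \<Omega>" "\<psi> \<in> test_functions \<Omega>" "\<theta> \<in> test_functions \<Omega>"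
  shows "energy a (\<lambda>x. \<phi> x + c * \<psi> x) \<theta> = energy a \<phi> \<theta> + c * energy a \<psi> \<theta>"
proof -
  have "(\<Sum>b\<in>Basis. pd b (\<lambda>x. \<phi> x + c * \<psi> x) x * pd b \<theta> x) * a x =
      (\<Sum>b\<in>Basis. pd b \<phi> x * pd b \<theta> x) * a x + c * ((\<Sum>b\<in>Basis. pd b \<psi> x * pd b \<theta> x) * a x)" for x
    using t[THEN test_smooth]
    by (simp add: pd_add smooth_mult pd_cmult sum.distrib distrib_right sum_distrib_left sum_distrib_right mult.assoc)
  then show ?thesis
    using energy_integrable[OF a] t by (simp add: energy_def)
qed

lemma energy_commute: "energy a \<phi> \<psi> = energy a \<psi> \<phi>"
  by (simp add: energy_def mult.commute)

lemma energy_ge_dirichlet: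
  fixes a :: "'a::euclidean_space \<Rightarrow> real"
  assumes a: "a \<in> borel_measurable borel" "\<And>x. \<bar>a x\<bar> \<le> R" "\<And>x. x \<in> \<Omega> \<Longrightarrow> r \<le> a x"
    and t: "\<phi> \<in> test_functions \<Omega>"
  shows "r * dirichlet \<phi> \<le> energy a \<phi> \<phi>"
proof -
  have "r * dirichlet \<phi> = (\<integral>x. r * (\<Sum>b\<in>Basis. (pd b \<phi> x)\<^sup>2) \<partial>lborel)"
    by (simp add: dirichlet_def)
  also have "\<dots> \<le> energy a \<phi> \<phi>"
    unfolding energy_def
  proof (rule integral_mono)
    fix x
    show "r * (\<Sum>b\<in>Basis. (pd b \<phi> x)\<^sup>2) \<le> (\<Sum>b\<in>Basis. pd b \<phi> x * pd b \<phi> x) * a x"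
      using a(3)[of x] test_pd_zero[OF t, of x]
      by (cases "x \<in> \<Omega>") (auto simp: power2_eq_square mult.commute[of r] sum_nonneg intro!: mult_left_mono)
  qed (use dirichlet_integrable[OF t] energy_integrable[OF a(1,2) t t] in auto)
  finally show ?thesis .
qed

lemma energy_le_dirichlet:
  fixes a :: "'a::euclidean_space \<Rightarrow> real"
  assumes a: "a \<in> borel_measurable borel" "\<And>x. \<bar>a x\<bar> \<le> R"
    and t: "\<phi> \<in> test_functions \<Omega>"
  shows "energy a \<phi> \<phi> \<le> R * dirichlet \<phi>"
proof -
  have "energy a \<phi> \<phi> \<le> (\<integral>x. (\<Sum>b\<in>Basis. (pd b \<phi> x)\<^sup>2) * R \<partial>lborel)"
    unfolding energy_def
  proof (rule integral_mono)
    fix x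
    show "(\<Sum>b\<in>Basis. pd b \<phi> x * pd b \<phi> x) * a x \<le> (\<Sum>b\<in>Basis. (pd b \<phi> x)\<^sup>2) * R"
      using a(2)[of x] by (auto simp: power2_eq_square sum_nonneg intro!: mult_left_mono)
  qed (use dirichlet_integrable[OF t] energy_integrable[OF a(1,2) t t] in auto)
  then show ?thesis by (simp add: dirichlet_def mult.commute)
qed

lemma test_corr:
  fixes z :: "'a::euclidean_space \<Rightarrow> real"
  assumes \<eta>: "\<eta> \<in> test_functions (ball 0 \<epsilon>)" and z: "integrable lborel z" "\<And>x. x \<notin> cball 0 a \<Longrightarrow> z x = 0"
  shows "corr \<eta> z \<in> test_functions UNIV" "x \<notin> cball 0 (a + \<epsilon>) \<Longrightarrow> corr \<eta> z x = 0"
proof -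
  show *: "corr \<eta> z x = 0" if "x \<notin> cball 0 (a + \<epsilon>)" for x
  proof -
    have *: "z y * \<eta> (y - x) = 0" for y
    proof (cases "y \<in> cball 0 a")
      case True
      have "norm (y - x) \<ge> norm x - norm y" by (metis norm_minus_commute norm_triangle_ineq2)
      then have "y - x \<notin> ball 0 \<epsilon>" using True that by auto
      then show ?thesis using test_zero[OF \<eta>] by simp
    qed (use z in auto)
    show ?thesis unfolding corr_def * by simp
  qed
  show "corr \<eta> z \<in> test_functions UNIV"
    by (rule test_functionsI[where K="cball 0 (a + \<epsilon>)"]) (use * smooth_corr[OF \<eta> z(1)] in auto)
qed

text \<open>Compactness in the manner of Rellich. The bound M on the Dirichlet integrals makes the
  mollification error at scale \<epsilon> of order \<epsilon>^2 uniformly in n. For fixed \<epsilon>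
  the mollified functions are uniformly bounded, supported in one ball and pointwise null, so
  dominated convergence applies.\<close>

lemma weakly_null_imp_strongly_null:
  fixes \<Omega> :: "'a::euclidean_space set"
  assumes \<Omega>: "bounded \<Omega>"
    and a: "a \<in> borel_measurable borel" "\<And>x. \<bar>a x\<bar> \<le> R" "\<And>x. x \<in> \<Omega> \<Longrightarrow> r \<le> a x" "r > 0"
    and z: "\<And>n. z n \<in> test_functions \<Omega>" "\<And>n. dirichlet (z n) \<le> M"
    and weak: "\<And>\<psi>. \<psi> \<in> test_functions \<Omega> \<Longrightarrow> (\<lambda>n. energy a (z n) \<psi>) \<longlonglongrightarrow> 0"
  shows "(\<lambda>n. \<integral>x. (z n x)\<^sup>2 \<partial>lborel) \<longlonglongrightarrow> 0"
proof -
  let ?d = "DIM('a)"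
  define V where "V = unit_ball_vol (real ?d)"
  have V: "V > 0" by (simp add: V_def)
  have R: "R \<ge> 0" using a(2) abs_ge_zero order_trans by blast
  have M0: "M \<ge> 0" using z(2) dirichlet_nonneg order_trans by blast
  obtain a0 where a0: "a0 > 0" "\<Omega> \<subseteq> cball 0 a0"
    using \<Omega> by (auto simp: bounded_pos subset_eq)
  have z0: "\<And>y x. y \<in> test_functions \<Omega> \<Longrightarrow> x \<notin> cball 0 a0 \<Longrightarrow> y x = 0" using test_zero a0(2) by blast
  obtain P where P: "P > 0" "\<And>z. z \<in> test_functions \<Omega> \<Longrightarrow> (\<integral>x. (z x)\<^sup>2 \<partial>lborel) \<le> P * dirichlet z"
    using poincare_test[OF \<Omega>] by blast
  obtain \<zeta> :: "'a \<Rightarrow> real" where \<zeta>: "\<zeta> \<in> test_functions (ball 0 1)" "(\<integral>h. \<zeta> h \<partial>lborel) = 1"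
    using exists_mollifier[of 1] by auto
  obtain C where C: "C > 0" "\<And>x. \<bar>\<zeta> x\<bar> \<le> C" using test_bounded[OF \<zeta>(1)] by blast
  have smooth_part: "(\<lambda>n. \<integral>x. (corr \<eta> (z n) x)\<^sup>2 \<partial>lborel) \<longlonglongrightarrow> 0" if \<eta>: "\<eta> \<in> test_functions (ball 0 \<epsilon>)" for \<eta> \<epsilon>
  proof -
    obtain B where B: "B > 0" "\<And>x. \<bar>\<eta> x\<bar> \<le> B" using test_bounded[OF \<eta>] by blast
    define W where "W = measure lborel (cball (0::'a) a0)"
    have W: "W \<ge> 0" "emeasure lborel (cball (0::'a) a0) = ennreal W"
      using emeasure_lborel_cball_finite[of "0::'a" a0] by (simp_all add: W_def emeasure_eq_ennreal_measure)
    \<comment> \<open>Evaluating the correlation at x is a bounded functional for the energy: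
      Cauchy-Schwarz on the ball contributes W B^2, the Poincare inequality P, and coercivity 1 /
      r.\<close>
    define K where "K = W * B\<^sup>2 * P / r"
    have K: "(corr \<eta> y x)\<^sup>2 \<le> K * energy a y y" if y: "y \<in> test_functions \<Omega>" for y x
    proof -
      have ym[measurable]: "y \<in> borel_measurable borel" "\<eta> \<in> borel_measurable borel"
        using test_borel y \<eta> by blast+
      have iy: "integrable lborel (\<lambda>x. (y x)\<^sup>2)" by (rule test_integrable_square[OF y])
      have "ennreal ((corr \<eta> y x)\<^sup>2) \<le> ennreal W * (\<integral>\<^sup>+t. ennreal ((y t * \<eta> (t - x))\<^sup>2) \<partial>lborel)"
        unfolding corr_def W(2)[symmetric] by (rule integral_square_le) (use z0[OF y] in auto)
      also have "\<dots> \<le> ennreal W * (\<integral>\<^sup>+t. ennreal (B\<^sup>2 * (y t)\<^sup>2) \<partial>lborel)"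
      proof (intro mult_left_mono nn_integral_mono ennreal_leI)
        fix t
        have "(\<eta> (t - x))\<^sup>2 \<le> B\<^sup>2" using B(2)[of "t - x"] B(1) by (simp add: abs_le_square_iff[symmetric])
        then show "(y t * \<eta> (t - x))\<^sup>2 \<le> B\<^sup>2 * (y t)\<^sup>2"
          unfolding power_mult_distrib mult.commute[of "(y t)\<^sup>2"] by (rule mult_right_mono) simp
      qed simp
      also have "\<dots> = ennreal (W * (B\<^sup>2 * (\<integral>t. (y t)\<^sup>2 \<partial>lborel)))"
        using iy W(1) by (subst nn_integral_eq_integral) (auto simp: ennreal_mult)
      finally have "(corr \<eta> y x)\<^sup>2 \<le> W * (B\<^sup>2 * (\<integral>t. (y t)\<^sup>2 \<partial>lborel))"
        using W(1) by (subst (asm) ennreal_le_iff) auto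
      also have "\<dots> \<le> W * (B\<^sup>2 * (P * (energy a y y / r)))"
      proof -
        have "dirichlet y \<le> energy a y y / r"
          using energy_ge_dirichlet[OF a(1-3) y] a(4) by (simp add: field_simps)
        then have "(\<integral>t. (y t)\<^sup>2 \<partial>lborel) \<le> P * (energy a y y / r)"
          using P(2)[OF y] P(1) by (meson mult_le_cancel_left_pos order_trans)
        then show ?thesis using W(1) by (intro mult_left_mono) auto
      qed
      finally show ?thesis by (simp add: K_def)
    qed
    have K0: "K \<ge> 0" using W P(1) a(4) by (simp add: K_def)
    have eM: "energy a (z n) (z n) \<le> R * M" for n
      by (rule order_trans[OF energy_le_dirichlet[OF a(1,2) z(1)] mult_left_mono[OF z(2) R]])
    have pt: "(\<lambda>n. corr \<eta> (z n) x) \<longlonglongrightarrow> 0" for x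
    proof (rule weakly_null_functional_tendsto_0[where V="test_functions \<Omega>" and B="energy a" and l="\<lambda>y. corr \<eta> y x"])
      fix y w c assume yw: "y \<in> test_functions \<Omega>" "w \<in> test_functions \<Omega>"
      show yc: "(\<lambda>x. y x + c * w x) \<in> test_functions \<Omega>" for c
        using yw by (intro test_add test_cmult)
      show "energy a (\<lambda>x. y x + c * w x) (\<lambda>x. y x + c * w x) = energy a y y + 2 * c * energy a w y + c\<^sup>2 * energy a w w"
        unfolding energy_add[OF a(1,2) yw yc] energy_commute[of a y "\<lambda>x. y x + c * w x"]
          energy_commute[of a w "\<lambda>x. y x + c * w x"] energy_add[OF a(1,2) yw yw(1)]
          energy_add[OF a(1,2) yw yw(2)] energy_commute[of a y w]
        by (simp add: power2_eq_square algebra_simps)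
      show "corr \<eta> (\<lambda>x. y x + c * w x) x = corr \<eta> y x + c * corr \<eta> w x"
        using corr_integrable[OF \<eta> test_integrable[OF yw(1)], of x] corr_integrable[OF \<eta> test_integrable[OF yw(2)], of x]
        by (simp add: corr_def distrib_right mult.assoc)
      show "0 \<le> energy a y y"
        using order_trans[OF mult_nonneg_nonneg[OF less_imp_le[OF a(4)] dirichlet_nonneg[of y]]
            energy_ge_dirichlet[OF a(1-3) yw(1)]] .
      show "(corr \<eta> y x)\<^sup>2 \<le> K * energy a y y" by (rule K[OF yw(1)])
      show "(\<lambda>n. energy a (z n) y) \<longlonglongrightarrow> 0" by (rule weak[OF yw(1)])
    next
      show "energy a (\<lambda>x. 0) (\<lambda>x. 0) = 0" by (simp add: energy_def pd_const)
      show "corr \<eta> (\<lambda>x. 0) x = 0" by (simp add: corr_def)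
    qed (rule z(1) test_0 K0 eM)+
    have "(\<lambda>n. \<integral>x. (corr \<eta> (z n) x)\<^sup>2 \<partial>lborel) \<longlonglongrightarrow> (\<integral>x. 0 \<partial>(lborel::'a measure))"
    proof (rule integral_dominated_convergence[where w="\<lambda>x. indicator (cball 0 (a0 + \<epsilon>)) x * (K * (R * M))"])
      show "(\<lambda>x. (corr \<eta> (z n) x)\<^sup>2) \<in> borel_measurable lborel" for n
        using test_borel[OF test_corr(1)[OF \<eta> test_integrable[OF z(1)] z0[OF z(1)]]] by measurable
      show "integrable lborel (\<lambda>x::'a. indicator (cball 0 (a0 + \<epsilon>)) x * (K * (R * M)))"
        by (intro integrable_mult_left integrable_real_indicator) (auto simp: emeasure_lborel_cball_finite[unfolded infinity_ennreal_def])
      show "AE x in lborel. (\<lambda>n. (corr \<eta> (z n) x)\<^sup>2) \<longlonglongrightarrow> 0"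
        using tendsto_power[OF pt, of _ 2] by (intro AE_I2) simp
      show "AE x in lborel. norm ((corr \<eta> (z n) x)\<^sup>2) \<le> indicator (cball 0 (a0 + \<epsilon>)) x * (K * (R * M))" for n
      proof (rule AE_I2)
        fix x
        have "(corr \<eta> (z n) x)\<^sup>2 \<le> K * (R * M)"
          using K[OF z(1)] mult_left_mono[OF eM K0] order_trans by blast
        then show "norm ((corr \<eta> (z n) x)\<^sup>2) \<le> indicator (cball 0 (a0 + \<epsilon>)) x * (K * (R * M))"
          using test_corr(2)[OF \<eta> test_integrable[OF z(1)[of n]] z0[OF z(1)[of n]], where x=x]
          by (cases "x \<in> cball 0 (a0 + \<epsilon>)") auto
      qed
    qed simp
    then show ?thesis by simp
  qed
  \<comment> \<open>The product of the constants of \<open>corr_estimate\<close> and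
    \<open>diff_energy_test\<close>, in which the powers of \<epsilon>^d cancel.\<close>
  define Q where "Q = V\<^sup>2 * C\<^sup>2 * M"
  have Q: "Q \<ge> 0" using M0 by (simp add: Q_def)
  have main: "(\<integral>x. (z n x)\<^sup>2 \<partial>lborel) \<le> 2 * (Q * \<epsilon>\<^sup>2) + 2 * (\<integral>x. (corr (scaled \<epsilon> \<zeta>) (z n) x)\<^sup>2 \<partial>lborel)"
    if \<epsilon>: "\<epsilon> > 0" for \<epsilon> n
  proof -
    let ?\<eta> = "scaled \<epsilon> \<zeta>"
    note \<eta> = scaled_properties[OF \<zeta>(1) \<epsilon>]
    have zi: "integrable lborel (z n)" by (rule test_integrable[OF z(1)])
    have ct: "corr ?\<eta> (z n) \<in> test_functions UNIV"
      by (rule test_corr(1)[OF \<eta>(1) zi z0[OF z(1)]])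
    have dt: "(\<lambda>x. corr ?\<eta> (z n) x - z n x) \<in> test_functions UNIV"
      by (intro test_diff ct test_mono[OF z(1)]) simp
    have bd: "\<bar>?\<eta> h\<bar> \<le> C / \<epsilon> ^ ?d" for h
      using C(2)[of "h /\<^sub>R \<epsilon>"] \<epsilon> by (simp add: scaled_def divide_right_mono)
    have "ennreal (\<integral>x. (corr ?\<eta> (z n) x - z n x)\<^sup>2 \<partial>lborel) = (\<integral>\<^sup>+x. ennreal ((corr ?\<eta> (z n) x - z n x)\<^sup>2) \<partial>lborel)"
      using test_integrable_square[OF dt] by (subst nn_integral_eq_integral) auto
    also have "\<dots> \<le> ennreal (V * \<epsilon> ^ ?d * (C / \<epsilon> ^ ?d)\<^sup>2) * diff_energy \<epsilon> (z n)"
      using corr_estimate[OF \<eta>(1) zi bd \<epsilon>] by (simp add: \<eta>(2) \<zeta>(2) V_def)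
    also have "\<dots> \<le> ennreal (V * \<epsilon> ^ ?d * (C / \<epsilon> ^ ?d)\<^sup>2) * ennreal (V * \<epsilon> ^ ?d * (\<epsilon>\<^sup>2 * dirichlet (z n)))"
      using diff_energy_test[OF z(1) \<epsilon>] by (intro mult_left_mono) (auto simp: V_def)
    also have "\<dots> = ennreal (V * \<epsilon> ^ ?d * (C / \<epsilon> ^ ?d)\<^sup>2 * (V * \<epsilon> ^ ?d * (\<epsilon>\<^sup>2 * dirichlet (z n))))"
      using V \<epsilon> dirichlet_nonneg[of "z n"] by (intro ennreal_mult[symmetric] mult_nonneg_nonneg) auto
    also have "V * \<epsilon> ^ ?d * (C / \<epsilon> ^ ?d)\<^sup>2 * (V * \<epsilon> ^ ?d * (\<epsilon>\<^sup>2 * dirichlet (z n))) = V\<^sup>2 * C\<^sup>2 * \<epsilon>\<^sup>2 * dirichlet (z n)"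
      using \<epsilon> by (simp add: power2_eq_square divide_simps)
    also have "ennreal \<dots> \<le> ennreal (Q * \<epsilon>\<^sup>2)"
      unfolding Q_def using mult_left_mono[OF z(2)[of n], of "V\<^sup>2 * C\<^sup>2 * \<epsilon>\<^sup>2"] by (intro ennreal_leI) (simp add: mult_ac)
    finally have 1: "(\<integral>x. (corr ?\<eta> (z n) x - z n x)\<^sup>2 \<partial>lborel) \<le> Q * \<epsilon>\<^sup>2"
      using Q by (subst (asm) ennreal_le_iff) auto
    have "(\<integral>x. (z n x)\<^sup>2 \<partial>lborel) \<le> (\<integral>x. 2 * (corr ?\<eta> (z n) x - z n x)\<^sup>2 + 2 * (corr ?\<eta> (z n) x)\<^sup>2 \<partial>lborel)"
    proof (rule integral_mono)
      fix x
      show "(z n x)\<^sup>2 \<le> 2 * (corr ?\<eta> (z n) x - z n x)\<^sup>2 + 2 * (corr ?\<eta> (z n) x)\<^sup>2"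
        using zero_le_power2[of "z n x - 2 * corr ?\<eta> (z n) x"] by (simp add: power2_eq_square algebra_simps)
    qed (use test_integrable_square[OF z(1)] test_integrable_square[OF ct] test_integrable_square[OF dt] in auto)
    also have "\<dots> = 2 * (\<integral>x. (corr ?\<eta> (z n) x - z n x)\<^sup>2 \<partial>lborel) + 2 * (\<integral>x. (corr ?\<eta> (z n) x)\<^sup>2 \<partial>lborel)"
      using test_integrable_square[OF ct] test_integrable_square[OF dt] by simp
    finally show ?thesis using 1 by simp
  qed
  show ?thesis
  proof (rule LIMSEQ_I)
    fix e :: real assume e: "e > 0"
    \<comment> \<open>With Q + 1 in the denominator, which is positive even for Q = 0, the error
      term 2 Q \<epsilon>^2 stays below e / 2.\<close>
    define \<epsilon> where "\<epsilon> = sqrt (e / (4 * (Q + 1)))"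
    have \<epsilon>: "\<epsilon> > 0" "\<epsilon>\<^sup>2 = e / (4 * (Q + 1))" using e Q by (auto simp: \<epsilon>_def)
    have "2 * (Q * \<epsilon>\<^sup>2) < e / 2 + e / 4"
      unfolding \<epsilon>(2) using e Q by (simp add: divide_simps)
    obtain N where N: "\<And>n. n \<ge> N \<Longrightarrow> \<bar>\<integral>x. (corr (scaled \<epsilon> \<zeta>) (z n) x)\<^sup>2 \<partial>lborel\<bar> < e / 8"
      using LIMSEQ_D[OF smooth_part[OF scaled_properties(1)[OF \<zeta>(1) \<epsilon>(1)]], of "e / 8"] e by auto
    have "norm ((\<integral>x. (z n x)\<^sup>2 \<partial>lborel) - 0) < e" if "n \<ge> N" for n
    proof -
      have "(\<integral>x. (z n x)\<^sup>2 \<partial>lborel) < e"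
        using main[OF \<epsilon>(1), of n] N[OF that] \<open>2 * (Q * \<epsilon>\<^sup>2) < e / 2 + e / 4\<close> by linarith
      moreover have "0 \<le> (\<integral>x. (z n x)\<^sup>2 \<partial>lborel)" by simp
      ultimately show ?thesis by simp
    qed
    then show "\<exists>N. \<forall>n\<ge>N. norm ((\<integral>x. (z n x)\<^sup>2 \<partial>lborel) - 0) < e" by blast
  qed
qed

section \<open>Regularisation on Lipschitz domains\<close>

text \<open>The power \<delta>^(d+2) is the normalisation of the kernel; by
  \<open>diff_energy_test\<close> it keeps the energy of a fixed test function bounded as \<delta>
  tends to 0.\<close>

definition scaled_energy :: "real \<Rightarrow> ('a::euclidean_space \<Rightarrow> real) \<Rightarrow> ennreal" where
  "scaled_energy \<delta> v = ennreal (1 / \<delta> ^ (DIM('a) + 2)) * diff_energy \<delta> v"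

text \<open>The scaled mollifier is of size \<delta>^(-d), its derivative of size \<delta>^(-d-1),
  and both enter squared, multiplied by the volume \<delta>^d. Measured against
  \<open>scaled_energy\<close> this leaves \<delta>^2 for the L2 error and a constant for the
  gradient.\<close>

lemma mollifier_estimates:
  fixes \<zeta> :: "'a::euclidean_space \<Rightarrow> real"
  assumes \<zeta>: "\<zeta> \<in> test_functions (ball 0 1)" "(\<integral>h. \<zeta> h \<partial>lborel) = 1"
  obtains C where "C > 0"
    "\<And>\<delta> v. \<delta> > 0 \<Longrightarrow> integrable lborel v \<Longrightarrow>
      (\<integral>\<^sup>+x. ennreal ((corr (scaled \<delta> \<zeta>) v x - v x)\<^sup>2) \<partial>lborel) \<le> ennreal (C * \<delta>\<^sup>2) * scaled_energy \<delta> v"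
    "\<And>\<delta> v b. \<delta> > 0 \<Longrightarrow> integrable lborel v \<Longrightarrow> b \<in> Basis \<Longrightarrow>
      (\<integral>\<^sup>+x. ennreal ((pd b (corr (scaled \<delta> \<zeta>) v) x)\<^sup>2) \<partial>lborel) \<le> ennreal C * scaled_energy \<delta> v"
proof -
  let ?d = "DIM('a)"
  define V where "V = unit_ball_vol (real ?d)"
  have V: "V > 0" by (simp add: V_def)
  obtain C1 where C1: "C1 > 0" "\<And>x. \<bar>\<zeta> x\<bar> \<le> C1" using test_bounded[OF \<zeta>(1)] by blast
  obtain C2 where C2: "C2 > 0" "\<And>b x. b \<in> Basis \<Longrightarrow> \<bar>pd b \<zeta> x\<bar> \<le> C2" using test_pd_bounded[OF \<zeta>(1)] by blast
  define C where "C = V * (C1 + C2)\<^sup>2"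
  have C: "C > 0" using V C1 C2 by (simp add: C_def add_pos_pos)
  have 1: "(\<integral>\<^sup>+x. ennreal ((corr (scaled \<delta> \<zeta>) v x - v x)\<^sup>2) \<partial>lborel) \<le> ennreal (C * \<delta>\<^sup>2) * scaled_energy \<delta> v"
    if \<delta>: "\<delta> > 0" and v: "integrable lborel v" for \<delta> v
  proof -
    note s = scaled_properties[OF \<zeta>(1) \<delta>]
    have bd: "\<bar>scaled \<delta> \<zeta> h\<bar> \<le> C1 / \<delta> ^ ?d" for h
      using C1(2)[of "h /\<^sub>R \<delta>"] \<delta> by (simp add: scaled_def divide_right_mono)
    have "(\<integral>\<^sup>+x. ennreal ((corr (scaled \<delta> \<zeta>) v x - v x)\<^sup>2) \<partial>lborel)
        \<le> ennreal (V * \<delta> ^ ?d * (C1 / \<delta> ^ ?d)\<^sup>2) * diff_energy \<delta> v"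
      using corr_estimate[OF s(1) v bd \<delta>] by (simp add: s(2) \<zeta>(2) V_def)
    also have "V * \<delta> ^ ?d * (C1 / \<delta> ^ ?d)\<^sup>2 = (V * C1\<^sup>2 * \<delta>\<^sup>2) * (1 / \<delta> ^ (?d + 2))"
      using \<delta> by (simp add: power_add power2_eq_square divide_simps)
    also have "ennreal \<dots> \<le> ennreal ((C * \<delta>\<^sup>2) * (1 / \<delta> ^ (?d + 2)))"
      unfolding C_def using V C1 C2 \<delta> by (intro ennreal_leI mult_right_mono mult_left_mono power_mono) auto
    also have "\<dots> * diff_energy \<delta> v = ennreal (C * \<delta>\<^sup>2) * scaled_energy \<delta> v"
      using C \<delta> unfolding scaled_energy_def by (subst ennreal_mult) (auto simp: mult.assoc)
    finally show ?thesis by (simp add: mult_right_mono)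
  qed
  have 2: "(\<integral>\<^sup>+x. ennreal ((pd b (corr (scaled \<delta> \<zeta>) v) x)\<^sup>2) \<partial>lborel) \<le> ennreal C * scaled_energy \<delta> v"
    if \<delta>: "\<delta> > 0" and v: "integrable lborel v" and b: "b \<in> Basis" for \<delta> v b
  proof -
    note s = scaled_properties[OF \<zeta>(1) \<delta>]
    have t: "pd b (scaled \<delta> \<zeta>) \<in> test_functions (ball 0 \<delta>)" by (rule test_pd[OF s(1) b])
    have bd: "\<bar>pd b (scaled \<delta> \<zeta>) h\<bar> \<le> C2 / \<delta> ^ ?d / \<delta>" for h
      using C2(2)[OF b, of "h /\<^sub>R \<delta>"] \<delta> by (simp add: s(3)[OF b] scaled_def divide_right_mono)
    have "(\<integral>\<^sup>+x. ennreal ((pd b (corr (scaled \<delta> \<zeta>) v) x)\<^sup>2) \<partial>lborel)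
        \<le> ennreal (V * \<delta> ^ ?d * (C2 / \<delta> ^ ?d / \<delta>)\<^sup>2) * diff_energy \<delta> v"
      using corr_estimate[OF t v bd \<delta>] by (simp add: pd_corr[OF s(1) v b] integral_pd_zero[OF s(1) b] V_def)
    also have "V * \<delta> ^ ?d * (C2 / \<delta> ^ ?d / \<delta>)\<^sup>2 = (V * C2\<^sup>2) * (1 / \<delta> ^ (?d + 2))"
      using \<delta> by (simp add: power_add power2_eq_square divide_simps)
    also have "ennreal \<dots> \<le> ennreal (C * (1 / \<delta> ^ (?d + 2)))"
      unfolding C_def using V C1 C2 \<delta> by (intro ennreal_leI mult_right_mono mult_left_mono power_mono) auto
    also have "\<dots> * diff_energy \<delta> v = ennreal C * scaled_energy \<delta> v"
      using C \<delta> unfolding scaled_energy_def by (subst ennreal_mult) (auto simp: mult.assoc)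
    finally show ?thesis by (simp add: mult_right_mono)
  qed
  show thesis by (rule that[OF C 1 2])
qed

text \<open>At a boundary point the mollifier is supported near \<open>-e/2\<close>, so that the value of the
  smoothed function at \<open>x\<close> only depends on points lying above \<open>x\<close> by more than the Lipschitz
  constant allows the graph to rise.\<close>

lemma shifted_mollifier:
  fixes \<Omega> :: "'a::euclidean_space set"
  assumes lip: "lipschitz_domain \<Omega>" and p: "p \<in> closure \<Omega>"
  shows "\<exists>\<rho> \<zeta> m. 0 < \<rho> \<and> 0 < m \<and> \<zeta> \<in> test_functions (ball 0 1) \<and> (\<integral>h. \<zeta> h \<partial>lborel) = 1 \<and>
    (\<forall>\<delta> x h. 0 < \<delta> \<longrightarrow> \<delta> < \<rho> \<longrightarrow> x \<in> ball p \<rho> \<longrightarrow> scaled \<delta> \<zeta> h \<noteq> 0 \<longrightarrow> x + h \<in> \<Omega> \<longrightarrow> cball x (m * \<delta>) \<subseteq> \<Omega>)"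
proof (cases "p \<in> \<Omega>")
  case True
  have "open \<Omega>" using lip by (simp add: lipschitz_domain_def)
  then obtain e where e: "e > 0" "ball p e \<subseteq> \<Omega>" using True open_contains_ball by blast
  obtain \<zeta> :: "'a \<Rightarrow> real" where \<zeta>: "\<zeta> \<in> test_functions (ball 0 1)" "(\<integral>h. \<zeta> h \<partial>lborel) = 1"
    using exists_mollifier[of 1] by auto
  \<comment> \<open>At an interior point a centred mollifier will do: half the radius of an
    inscribed ball serves as the localisation radius, and m = 1.\<close>
  have "cball x (1 * \<delta>) \<subseteq> \<Omega>" if "\<delta> < e / 2" "x \<in> ball p (e / 2)" for \<delta> x
  proof
    fix y assume "y \<in> cball x (1 * \<delta>)"
    then have "dist p y < e" using that dist_triangle[of p y x] by (simp add: dist_commute)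
    then show "y \<in> \<Omega>" using e by auto
  qed
  then show ?thesis
    using e \<zeta> by (intro exI[of _ "e / 2"] exI[of _ \<zeta>] exI[of _ 1]) auto
next
  case False
  have "open \<Omega>" using lip by (simp add: lipschitz_domain_def)
  then have "p \<in> frontier \<Omega>" using p False by (simp add: frontier_def interior_open)
  then obtain e \<rho>0 L \<psi> where e: "norm e = 1" "\<rho>0 > 0" and L: "L-lipschitz_on UNIV \<psi>"
    and eq: "\<Omega> \<inter> ball p \<rho>0 = {x \<in> ball p \<rho>0. (\<psi> (x - (x \<bullet> e) *\<^sub>R e) :: real) < x \<bullet> e}"
    using lip unfolding lipschitz_domain_def by blast
  have L0: "L \<ge> 0" using L by (simp add: lipschitz_on_def)
  \<comment> \<open>Chosen such that 4 L s + 2 s = 1/2. A displacement of length at most 2 s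
    \<delta> has a horizontal part of at most 4 s \<delta>, over which the graph rises by at most 4
    L s \<delta>, and a vertical part of at most 2 s \<delta>; together they do not exceed the shift
    \<delta> / 2.\<close>
  define s where "s = 1 / (4 * (2 * L + 1))"
  have s: "0 < s" "s \<le> 1 / 4" "2 * L * (2 * s) + 2 * s \<le> 1 / 2"
    using L0 by (auto simp: s_def divide_simps)
  obtain \<zeta> where \<zeta>: "\<zeta> \<in> test_functions (ball (- (1/2) *\<^sub>R e) s)" "(\<integral>h. \<zeta> h \<partial>lborel) = 1"
    using exists_mollifier[OF s(1)] by blast
  have sub: "ball (- (1/2) *\<^sub>R e) s \<subseteq> ball 0 1"
  proof
    fix x assume "x \<in> ball (- (1/2) *\<^sub>R e) s"
    then have "norm (- (1/2) *\<^sub>R e - x) < 1/4" using s(2) by (simp add: dist_norm)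
    moreover have "norm x \<le> norm (- (1/2) *\<^sub>R e) + norm (- (1/2) *\<^sub>R e - x)"
      by (metis norm_minus_commute norm_triangle_sub)
    ultimately show "x \<in> ball 0 1" using e(1) by simp
  qed
  have key: "cball x (s * \<delta>) \<subseteq> \<Omega>"
    if \<delta>: "0 < \<delta>" "\<delta> < \<rho>0 / 4" and x: "x \<in> ball p (\<rho>0 / 4)" and h: "scaled \<delta> \<zeta> h \<noteq> 0" and xh: "x + h \<in> \<Omega>" for \<delta> x h
  proof
    fix y assume y: "y \<in> cball x (s * \<delta>)"
    have h1: "h /\<^sub>R \<delta> \<in> ball (- (1/2) *\<^sub>R e) s"
      using h test_zero[OF \<zeta>(1)] by (auto simp: scaled_def)
    define k where "k = h /\<^sub>R \<delta> + (1/2) *\<^sub>R e"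
    have k: "norm k < s" using h1 by (simp add: k_def dist_norm norm_minus_commute add.commute)
    have hk: "h = \<delta> *\<^sub>R k - (\<delta> / 2) *\<^sub>R e"
      using \<delta>(1) by (simp add: k_def scaleR_right_distrib)
    define w where "w = (y - x) - \<delta> *\<^sub>R k"
    \<comment> \<open>The point y is reached from x + h, which lies above the graph, by going up
      \<delta> / 2 and then moving by the small error w, made of the radius of the ball around x and
      of the width of the mollifier.\<close>
    have yw: "y = (x + h) + (\<delta> / 2) *\<^sub>R e + w" by (simp add: w_def hk)
    have nw: "norm w \<le> 2 * s * \<delta>"
    proof -
      have "norm w \<le> norm (y - x) + norm (\<delta> *\<^sub>R k)" unfolding w_def by (rule norm_triangle_ineq4)
      also have "\<dots> \<le> s * \<delta> + \<delta> * s"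
        using y k \<delta>(1) by (intro add_mono) (auto simp: dist_norm norm_minus_commute)
      finally show ?thesis by (simp add: mult_ac)
    qed
    have nh: "norm h < \<delta>"
      using subsetD[OF sub h1] \<delta>(1) by (simp add: divide_simps)
    have "dist p (x + h) \<le> dist p x + norm h" by (metis dist_norm dist_triangle add_diff_cancel_left' dist_commute)
    then have "x + h \<in> ball p \<rho>0" using x nh \<delta> by simp
    then have g: "\<psi> ((x + h) - ((x + h) \<bullet> e) *\<^sub>R e) < (x + h) \<bullet> e" using eq xh by blast
    have ee: "e \<bullet> e = 1" using e(1) by (simp add: norm_eq_1)
    have we: "\<bar>w \<bullet> e\<bar> \<le> norm w" using Cauchy_Schwarz_ineq2[of w e] e(1) by simp
    have proj: "(y - (y \<bullet> e) *\<^sub>R e) - ((x + h) - ((x + h) \<bullet> e) *\<^sub>R e) = w - (w \<bullet> e) *\<^sub>R e"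
      unfolding yw by (simp add: inner_add_left ee algebra_simps)
    have "norm (w - (w \<bullet> e) *\<^sub>R e) \<le> norm w + norm w"
      using norm_triangle_ineq4[of w "(w \<bullet> e) *\<^sub>R e"] we e(1) by simp
    then have "norm ((y - (y \<bullet> e) *\<^sub>R e) - ((x + h) - ((x + h) \<bullet> e) *\<^sub>R e)) \<le> 4 * s * \<delta>"
      unfolding proj using nw by simp
    then have "L * norm ((y - (y \<bullet> e) *\<^sub>R e) - ((x + h) - ((x + h) \<bullet> e) *\<^sub>R e)) \<le> L * (4 * s * \<delta>)"
      using L0 by (rule mult_left_mono)
    moreover have "\<bar>\<psi> (y - (y \<bullet> e) *\<^sub>R e) - \<psi> ((x + h) - ((x + h) \<bullet> e) *\<^sub>R e)\<bar>
        \<le> L * norm ((y - (y \<bullet> e) *\<^sub>R e) - ((x + h) - ((x + h) \<bullet> e) *\<^sub>R e))"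
      using lipschitz_onD[OF L, of "y - (y \<bullet> e) *\<^sub>R e" "(x + h) - ((x + h) \<bullet> e) *\<^sub>R e"] by (simp add: dist_norm)
    moreover have "y \<bullet> e = (x + h) \<bullet> e + \<delta> / 2 + w \<bullet> e" unfolding yw by (simp add: inner_add_left ee)
    moreover have "(2 * L * (2 * s) + 2 * s) * \<delta> \<le> 1 / 2 * \<delta>" using s(3) \<delta>(1) by (intro mult_right_mono) auto
    then have "L * (4 * s * \<delta>) + 2 * s * \<delta> \<le> \<delta> / 2" by (simp add: algebra_simps)
    ultimately have "\<psi> (y - (y \<bullet> e) *\<^sub>R e) < y \<bullet> e" using g we nw by linarith
    moreover have "y \<in> ball p \<rho>0"
    proof -
      have "dist p y \<le> dist p x + dist x y" by (rule dist_triangle)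
      moreover have "s * \<delta> \<le> 1/4 * \<delta>" using s \<delta> by (intro mult_right_mono) auto
      moreover have "dist x y \<le> s * \<delta>" "dist p x < \<rho>0 / 4" using x y by auto
      ultimately have "dist p y < \<rho>0" using \<delta> by linarith
      then show ?thesis by simp
    qed
    ultimately show "y \<in> \<Omega>" using eq by blast
  qed
  show ?thesis
    using e s \<zeta> key test_mono[OF \<zeta>(1) sub] by (intro exI[of _ "\<rho>0 / 4"] exI[of _ \<zeta>] exI[of _ s]) auto
qed

lemma smooth_partition:
  fixes K :: "'a::euclidean_space set"
  assumes K: "compact K" "K \<noteq> {}" "K \<subseteq> (\<Union>p\<in>I. ball p (\<rho> p))" and I: "finite I" "\<And>p. p \<in> I \<Longrightarrow> \<rho> p > 0"
  obtains \<theta> where "\<And>p. p \<in> I \<Longrightarrow> \<theta> p \<in> test_functions UNIV" "\<And>p x. p \<in> I \<Longrightarrow> \<bar>\<theta> p x\<bar> \<le> 1"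
    "\<And>p x. p \<in> I \<Longrightarrow> x \<notin> ball p (\<rho> p) \<Longrightarrow> \<theta> p x = 0" "\<And>x. x \<in> K \<Longrightarrow> (\<Sum>p\<in>I. \<theta> p x) = 1"
proof -
  define \<beta> where "\<beta> p = bump p (\<rho> p)" for p
  define S where "S x = (\<Sum>p\<in>I. \<beta> p x)" for x
  have \<beta>: "\<beta> p x \<ge> 0" "smooth (\<beta> p)" for p x by (auto simp: \<beta>_def bump_nonneg smooth_bump)
  have S: "smooth S" unfolding S_def using \<beta> by (intro smooth_sum)
  have S0: "S x \<ge> 0" for x unfolding S_def using \<beta> by (intro sum_nonneg)
  have Spos: "S x > 0" if x: "x \<in> K" for x
  proof -
    obtain p where p: "p \<in> I" "x \<in> ball p (\<rho> p)" using x K(3) by blast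
    then have "\<beta> p x > 0" using bump_pos_iff[OF I(2)[OF p(1)], of p x] by (simp add: \<beta>_def)
    then show ?thesis unfolding S_def using I(1) p(1) \<beta>(1) by (intro sum_pos2[of I p]) auto
  qed
  obtain x0 where x0: "x0 \<in> K" "\<And>x. x \<in> K \<Longrightarrow> S x0 \<le> S x"
    using continuous_attains_inf[OF K(1,2) smooth_continuous_on[OF S]] by blast
  \<comment> \<open>Dividing by S alone fails where all bumps vanish. On K the argument S x0 - S x
    is nonpositive, so the added term is 0 there; where S vanishes it equals the positive number S
    x0. Hence G is smooth, everywhere positive and equal to S on K.\<close>
  define G where "G x = S x + flat 1 (S x0 - S x)" for x
  have G: "smooth G" unfolding G_def by (intro smooth_add smooth_flat smooth_diff S smooth_const)
  have G0: "G x > 0" "S x \<le> G x" for x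
  proof -
    have f: "flat 1 t \<ge> 0" "t > 0 \<Longrightarrow> flat 1 t > 0" for t by (auto simp: flat_def)
    show "S x \<le> G x" using f by (simp add: G_def)
    show "G x > 0"
    proof (cases "S x > 0")
      case False
      then show ?thesis using f(2)[of "S x0 - S x"] Spos[OF x0(1)] S0[of x] by (simp add: G_def)
    qed (use f in \<open>simp add: G_def add_pos_nonneg\<close>)
  qed
  have GK: "G x = S x" if "x \<in> K" for x using x0(2)[OF that] by (simp add: G_def flat_def)
  show thesis
  proof (rule that[of "\<lambda>p x. \<beta> p x / G x"])
    fix p assume p: "p \<in> I"
    have "(\<lambda>x. (1 / G x) * \<beta> p x) \<in> test_functions UNIV"
      unfolding \<beta>_def using I(2)[OF p] G0(1) by (intro test_mult test_bump smooth_divide smooth_const G) (auto simp: less_imp_neq[symmetric])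
    then show "(\<lambda>x. \<beta> p x / G x) \<in> test_functions UNIV" by simp
    fix x
    have "\<beta> p x \<le> S x" unfolding S_def using p I(1) \<beta>(1) by (intro member_le_sum) auto
    then show "\<bar>\<beta> p x / G x\<bar> \<le> 1" using G0[of x] \<beta>(1)[of p x] by simp
    show "\<beta> p x / G x = 0" if "x \<notin> ball p (\<rho> p)"
      using that bump_pos_iff[OF I(2)[OF p], of p x] \<beta>(1)[of p x] by (simp add: \<beta>_def)
  next
    fix x assume "x \<in> K"
    then show "(\<Sum>p\<in>I. \<beta> p x / G x) = 1"
      using GK Spos by (simp add: sum_divide_distrib[symmetric] S_def[symmetric] less_imp_neq[symmetric])
  qed
qed


lemma sum_square_le:
  fixes f :: "'i \<Rightarrow> real"
  shows "(\<Sum>i\<in>I. f i)\<^sup>2 \<le> card I * (\<Sum>i\<in>I. (f i)\<^sup>2)"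
  using sum_squared_le_sum_of_squares[of f I] by (simp add: mult.commute)

text \<open>The local mollifications are averaged with the weights of the partition of unity. For
  the L2 error the weights sum to 1 wherever v is nonzero. In the gradient the product rule also
  differentiates the weights, and this is why the L2 norm of v joins the energy on the
  right.\<close>

theorem regularisation:
  fixes \<Omega> :: "'a::euclidean_space set"
  assumes bdd: "bounded \<Omega>" and lip: "lipschitz_domain \<Omega>"
  obtains C \<delta>1 where "C > 0" "0 < \<delta>1"
    "\<And>\<delta> v. 0 < \<delta> \<Longrightarrow> \<delta> < \<delta>1 \<Longrightarrow> v \<in> borel_measurable borel \<Longrightarrow> integrable lborel (\<lambda>x. (v x)\<^sup>2) \<Longrightarrow>
      (\<And>x. x \<notin> \<Omega> \<Longrightarrow> v x = 0) \<Longrightarrow>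
      \<exists>w\<in>test_functions \<Omega>.
        (\<integral>\<^sup>+x. ennreal ((w x - v x)\<^sup>2) \<partial>lborel) \<le> ennreal (C * \<delta>\<^sup>2) * scaled_energy \<delta> v \<and>
        (\<forall>b\<in>Basis. (\<integral>\<^sup>+x. ennreal ((pd b w x)\<^sup>2) \<partial>lborel)
          \<le> ennreal C * (scaled_energy \<delta> v + (\<integral>\<^sup>+x. ennreal ((v x)\<^sup>2) \<partial>lborel)))"
proof -
  have cK: "compact (closure \<Omega>)" using bdd by (simp add: compact_closure)
  have nK: "closure \<Omega> \<noteq> {}" using lip by (simp add: lipschitz_domain_def)
  obtain \<rho> \<zeta> m where loc: "\<And>p. p \<in> closure \<Omega> \<Longrightarrow> 0 < \<rho> p \<and> 0 < m p \<and> \<zeta> p \<in> test_functions (ball (0::'a) 1) \<and>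
      (\<integral>h. \<zeta> p h \<partial>lborel) = 1 \<and>
      (\<forall>\<delta> x h. 0 < \<delta> \<longrightarrow> \<delta> < \<rho> p \<longrightarrow> x \<in> ball p (\<rho> p) \<longrightarrow> scaled \<delta> (\<zeta> p) h \<noteq> 0 \<longrightarrow> x + h \<in> \<Omega> \<longrightarrow> cball x (m p * \<delta>) \<subseteq> \<Omega>)"
    using shifted_mollifier[OF lip] by metis
  have cover: "closure \<Omega> \<subseteq> (\<Union>p\<in>closure \<Omega>. ball p (\<rho> p))"
    using loc by (auto intro: centre_in_ball[THEN iffD2])
  obtain I where I: "I \<subseteq> closure \<Omega>" "finite I" "closure \<Omega> \<subseteq> (\<Union>p\<in>I. ball p (\<rho> p))"
    by (rule compactE_image[OF cK _ cover]) auto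
  have \<rho>: "\<And>p. p \<in> I \<Longrightarrow> \<rho> p > 0" using I loc by blast
  obtain \<theta> where \<theta>: "\<And>p. p \<in> I \<Longrightarrow> \<theta> p \<in> test_functions UNIV" "\<And>p x. p \<in> I \<Longrightarrow> \<bar>\<theta> p x\<bar> \<le> 1"
    "\<And>p x. p \<in> I \<Longrightarrow> x \<notin> ball p (\<rho> p) \<Longrightarrow> \<theta> p x = 0" "\<And>x. x \<in> closure \<Omega> \<Longrightarrow> (\<Sum>p\<in>I. \<theta> p x) = 1"
    using smooth_partition[OF cK nK I(3,2) \<rho>] by blast
  have I0: "I \<noteq> {}" using I nK by auto
  have "\<exists>D>0. \<forall>x. \<forall>b\<in>Basis. \<bar>pd b (\<theta> p) x\<bar> \<le> D" if "p \<in> I" for p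
    by (rule test_pd_bounded[OF \<theta>(1)[OF that]]) blast
  then obtain D where D: "\<And>p. p \<in> I \<Longrightarrow> D p > 0" "\<And>p x b. p \<in> I \<Longrightarrow> b \<in> Basis \<Longrightarrow> \<bar>pd b (\<theta> p) x\<bar> \<le> D p"
    by metis
  define Q where "Q p C \<longleftrightarrow> C > 0 \<and>
      (\<forall>\<delta> v. \<delta> > 0 \<longrightarrow> integrable lborel v \<longrightarrow>
        (\<integral>\<^sup>+x. ennreal ((corr (scaled \<delta> (\<zeta> p)) v x - v x)\<^sup>2) \<partial>lborel) \<le> ennreal (C * \<delta>\<^sup>2) * scaled_energy \<delta> v) \<and>
      (\<forall>\<delta> v. \<forall>b\<in>Basis. \<delta> > 0 \<longrightarrow> integrable lborel v \<longrightarrow>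
        (\<integral>\<^sup>+x. ennreal ((pd b (corr (scaled \<delta> (\<zeta> p)) v) x)\<^sup>2) \<partial>lborel) \<le> ennreal C * scaled_energy \<delta> v)" for p C
  have "\<forall>p\<in>I. \<exists>C. Q p C"
  proof
    fix p assume p: "p \<in> I"
    have z: "\<zeta> p \<in> test_functions (ball 0 1)" "(\<integral>h. \<zeta> p h \<partial>lborel) = 1"
      using loc[of p] I(1) p by auto
    show "\<exists>C. Q p C"
      by (rule mollifier_estimates[OF z]) (simp add: Q_def, blast)
  qed
  then obtain Cm where "\<forall>p\<in>I. Q p (Cm p)" using bchoice by blast
  then have Cm: "\<And>p. p \<in> I \<Longrightarrow> Cm p > 0"
    "\<And>p \<delta> v. p \<in> I \<Longrightarrow> \<delta> > 0 \<Longrightarrow> integrable lborel v \<Longrightarrow>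
      (\<integral>\<^sup>+x. ennreal ((corr (scaled \<delta> (\<zeta> p)) v x - v x)\<^sup>2) \<partial>lborel) \<le> ennreal (Cm p * \<delta>\<^sup>2) * scaled_energy \<delta> v"
    "\<And>p \<delta> v b. p \<in> I \<Longrightarrow> \<delta> > 0 \<Longrightarrow> integrable lborel v \<Longrightarrow> b \<in> Basis \<Longrightarrow>
      (\<integral>\<^sup>+x. ennreal ((pd b (corr (scaled \<delta> (\<zeta> p)) v) x)\<^sup>2) \<partial>lborel) \<le> ennreal (Cm p) * scaled_energy \<delta> v"
    by (simp_all add: Q_def)
  define m0 where "m0 = Min (m ` I)"
  have m0: "m0 > 0" "\<And>p. p \<in> I \<Longrightarrow> m0 \<le> m p"
    using I I0 loc by (auto simp: m0_def subset_eq)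
  \<comment> \<open>Scales below every localisation radius make the support property of each local
    mollifier available; the bound 1 lets \<delta>^2 be dropped in the gradient estimate.\<close>
  define \<delta>1 where "\<delta>1 = min 1 (Min (\<rho> ` I))"
  have \<delta>1: "\<delta>1 > 0" "\<delta>1 \<le> 1" "\<And>p. p \<in> I \<Longrightarrow> \<delta>1 \<le> \<rho> p"
    using I I0 \<rho> by (auto simp: \<delta>1_def min_le_iff_disj)
  define N where "N = real (card I)"
  have N: "N > 0" using I I0 by (simp add: N_def card_gt_0_iff)
  define C1 where "C1 = N * (\<Sum>p\<in>I. Cm p)"
  define C2 where "C2 = 3 * N * (\<Sum>p\<in>I. (D p)\<^sup>2 * Cm p)"
  define C3 where "C3 = 3 * N * (\<Sum>p\<in>I. (D p)\<^sup>2)"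
  define C4 where "C4 = 3 * N * (\<Sum>p\<in>I. Cm p)"
  have Cpos: "C1 \<ge> 0" "C2 \<ge> 0" "C3 \<ge> 0" "C4 \<ge> 0"
    using N Cm(1) D(1) unfolding C1_def C2_def C3_def C4_def
    by (auto intro!: mult_nonneg_nonneg sum_nonneg simp: less_imp_le)
  define C where "C = 1 + C1 + C2 + C3 + C4"
  have C: "C > 0" using Cpos by (simp add: C_def)
  show thesis
  proof (rule that[OF C \<delta>1(1)])
    fix \<delta> and v :: "'a \<Rightarrow> real"
    assume \<delta>: "0 < \<delta>" "\<delta> < \<delta>1" and vm[measurable]: "v \<in> borel_measurable borel"
      and vi: "integrable lborel (\<lambda>x. (v x)\<^sup>2)" and v0: "\<And>x. x \<notin> \<Omega> \<Longrightarrow> v x = 0"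
    have v: "integrable lborel v" by (rule square_integrable_imp_integrable[OF vm vi bdd v0])
    define E where "E = scaled_energy \<delta> v"
    define N2 where "N2 = (\<integral>\<^sup>+x. ennreal ((v x)\<^sup>2) \<partial>lborel)"
    have \<zeta>: "\<zeta> p \<in> test_functions (ball 0 1)" "scaled \<delta> (\<zeta> p) \<in> test_functions (ball 0 \<delta>)" if "p \<in> I" for p
      using loc I that scaled_properties(1)[OF _ \<delta>(1)] by blast+
    define c where "c p = corr (scaled \<delta> (\<zeta> p)) v" for p
    have c: "smooth (c p)" if "p \<in> I" for p unfolding c_def by (rule smooth_corr[OF \<zeta>(2)[OF that] v])
    have cm[measurable]: "c p \<in> borel_measurable borel" if "p \<in> I" for p
      by (rule smooth_borel_measurable[OF c[OF that]])
    have pcm[measurable]: "pd b (c p) \<in> borel_measurable borel" if "p \<in> I" "b \<in> Basis" for p b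
      by (rule smooth_borel_measurable[OF smooth_pd[OF c[OF that(1)] that(2)]])
    define w where "w x = (\<Sum>p\<in>I. \<theta> p x * c p x)" for x
    have th: "smooth (\<theta> p)" if "p \<in> I" for p using test_smooth[OF \<theta>(1)[OF that]] .
    have ws: "smooth w" unfolding w_def using th c by (intro smooth_sum smooth_mult)
    \<comment> \<open>The function w vanishes off A, whose points keep the distance m0 \<delta> from
      the complement. A limit point of A lies within m0 \<delta> of a point of A, hence still in
      \<Omega>, so the support is compact in \<Omega>.\<close>
    define A where "A = {x. cball x (m0 * \<delta>) \<subseteq> \<Omega>}"
    have wA: "x \<in> A" if wx: "w x \<noteq> 0" for x
    proof -
      obtain p where p: "p \<in> I" "\<theta> p x * c p x \<noteq> 0"
        using wx unfolding w_def by (meson sum.neutral)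
      have xb: "x \<in> ball p (\<rho> p)" using \<theta>(3)[OF p(1)] p(2) by auto
      have "\<exists>h. v (x + h) * scaled \<delta> (\<zeta> p) h \<noteq> 0"
      proof (rule ccontr)
        assume "\<not> ?thesis"
        then have "(\<lambda>h. v (x + h) * scaled \<delta> (\<zeta> p) h) = (\<lambda>h. 0)" by blast
        then have "c p x = 0" unfolding c_def corr_alt by simp
        then show False using p(2) by simp
      qed
      then obtain h where h: "v (x + h) \<noteq> 0" "scaled \<delta> (\<zeta> p) h \<noteq> 0" by auto
      then have "x + h \<in> \<Omega>" using v0 by blast
      then have "cball x (m p * \<delta>) \<subseteq> \<Omega>"
        using loc[of p] I(1) p(1) \<delta> \<delta>1(3)[OF p(1)] xb h(2) by (meson less_le_trans subsetD)
      moreover have "m0 * \<delta> \<le> m p * \<delta>" using m0(2)[OF p(1)] \<delta>(1) by simp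
      ultimately show ?thesis unfolding A_def using subset_cball by blast
    qed
    have "w \<in> test_functions \<Omega>"
    proof (rule test_functionsI[OF ws])
      have "A \<subseteq> \<Omega>" using m0(1) \<delta>(1) by (auto simp: A_def subset_eq)
      then show "compact (closure A)" using bdd bounded_subset compact_closure by blast
      show "closure A \<subseteq> \<Omega>"
      proof
        fix x assume "x \<in> closure A"
        then obtain y where "y \<in> A" "dist y x < m0 * \<delta>"
          using m0(1) \<delta>(1) closure_approachable[of x A] by (metis mult_pos_pos)
        then show "x \<in> \<Omega>" by (auto simp: A_def subset_eq)
      qed
      show "w x = 0" if "x \<notin> closure A" for x using that wA closure_subset[of A] by blast
    qed
    moreover have "(\<integral>\<^sup>+x. ennreal ((w x - v x)\<^sup>2) \<partial>lborel) \<le> ennreal (C * \<delta>\<^sup>2) * E"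
    proof -
      have "(w x - v x)\<^sup>2 \<le> N * (\<Sum>p\<in>I. (c p x - v x)\<^sup>2)" for x
      proof -
        have "v x = (\<Sum>p\<in>I. \<theta> p x) * v x"
          using \<theta>(4)[of x] v0[of x] closure_subset[of \<Omega>] by (cases "x \<in> \<Omega>") auto
        then have "w x - v x = (\<Sum>p\<in>I. \<theta> p x * c p x) - (\<Sum>p\<in>I. \<theta> p x) * v x"
          unfolding w_def by simp
        also have "\<dots> = (\<Sum>p\<in>I. \<theta> p x * (c p x - v x))"
          by (simp add: sum_distrib_right right_diff_distrib sum_subtractf)
        finally have "(w x - v x)\<^sup>2 \<le> N * (\<Sum>p\<in>I. (\<theta> p x * (c p x - v x))\<^sup>2)"
          unfolding N_def using sum_square_le[of "\<lambda>p. \<theta> p x * (c p x - v x)" I] by simp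
        also have "\<dots> \<le> N * (\<Sum>p\<in>I. (c p x - v x)\<^sup>2)"
        proof (intro mult_left_mono sum_mono)
          fix p assume "p \<in> I"
          then have "(\<theta> p x)\<^sup>2 \<le> 1" using \<theta>(2) by (simp add: abs_square_le_1)
          then show "(\<theta> p x * (c p x - v x))\<^sup>2 \<le> (c p x - v x)\<^sup>2"
            by (simp add: power_mult_distrib mult_left_le_one_le)
        qed (use N in simp)
        finally show ?thesis .
      qed
      then have "(\<integral>\<^sup>+x. ennreal ((w x - v x)\<^sup>2) \<partial>lborel) \<le> (\<integral>\<^sup>+x. ennreal N * (\<Sum>p\<in>I. ennreal ((c p x - v x)\<^sup>2)) \<partial>lborel)"
        using N by (intro nn_integral_mono) (simp add: sum_ennreal ennreal_mult[symmetric] sum_nonneg ennreal_leI)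
      also have "\<dots> = ennreal N * (\<Sum>p\<in>I. \<integral>\<^sup>+x. ennreal ((c p x - v x)\<^sup>2) \<partial>lborel)"
      proof -
        have "(\<integral>\<^sup>+x. (\<Sum>p\<in>I. ennreal ((c p x - v x)\<^sup>2)) \<partial>lborel) = (\<Sum>p\<in>I. \<integral>\<^sup>+x. ennreal ((c p x - v x)\<^sup>2) \<partial>lborel)"
          by (rule nn_integral_sum) auto
        then show ?thesis by (subst nn_integral_cmult) (auto simp del: sum_ennreal)
      qed
      also have "\<dots> \<le> ennreal N * (\<Sum>p\<in>I. ennreal (Cm p * \<delta>\<^sup>2) * E)"
        unfolding c_def E_def using Cm(2) \<delta>(1) v by (intro mult_left_mono sum_mono) auto
      also have "\<dots> = ennreal (C1 * \<delta>\<^sup>2) * E"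
        unfolding sum_distrib_right[symmetric] C1_def using Cm(1) N
        by (simp add: sum_ennreal less_imp_le ennreal_mult[symmetric] sum_nonneg sum_distrib_left sum_distrib_right mult_ac)
      also have "\<dots> \<le> ennreal (C * \<delta>\<^sup>2) * E"
        using Cpos by (intro mult_right_mono ennreal_leI) (auto simp: C_def)
      finally show ?thesis .
    qed
    moreover have "(\<integral>\<^sup>+x. ennreal ((pd b w x)\<^sup>2) \<partial>lborel) \<le> ennreal C * (E + N2)" if b: "b \<in> Basis" for b
    proof -
      have "(pd b w x)\<^sup>2 \<le> (\<Sum>p\<in>I. 3 * N * ((D p)\<^sup>2 * (c p x - v x)\<^sup>2 + (D p)\<^sup>2 * (v x)\<^sup>2 + (pd b (c p) x)\<^sup>2))" for x
      proof -
        have "pd b w x = (\<Sum>p\<in>I. \<theta> p x * pd b (c p) x + pd b (\<theta> p) x * c p x)"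
          unfolding w_def using th c by (simp add: pd_sum smooth_mult pd_mult)
        then have "(pd b w x)\<^sup>2 \<le> N * (\<Sum>p\<in>I. (\<theta> p x * pd b (c p) x + pd b (\<theta> p) x * c p x)\<^sup>2)"
          unfolding N_def using sum_square_le[of "\<lambda>p. \<theta> p x * pd b (c p) x + pd b (\<theta> p) x * c p x" I] by simp
        also have "\<dots> \<le> N * (\<Sum>p\<in>I. 3 * ((D p)\<^sup>2 * (c p x - v x)\<^sup>2 + (D p)\<^sup>2 * (v x)\<^sup>2 + (pd b (c p) x)\<^sup>2))"
        proof (intro mult_left_mono sum_mono)
          fix p assume p: "p \<in> I"
          have t1: "(\<theta> p x)\<^sup>2 \<le> 1" using \<theta>(2) p by (simp add: abs_square_le_1)
          have t2: "(pd b (\<theta> p) x)\<^sup>2 \<le> (D p)\<^sup>2"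
            using D(2)[OF p b, of x] D(1)[OF p] by (simp add: abs_le_square_iff[symmetric])
          have three: "(X + Y + Z)\<^sup>2 \<le> 3 * (X\<^sup>2 + Y\<^sup>2 + Z\<^sup>2)" for X Y Z :: real
            using zero_le_power2[of "X - Y"] zero_le_power2[of "Y - Z"] zero_le_power2[of "X - Z"]
            by (simp add: power2_eq_square algebra_simps)
          \<comment> \<open>The energy controls c p only through its difference from v; splitting c
            p = (c p - v) + v produces the three terms.\<close>
          have "(\<theta> p x * pd b (c p) x + pd b (\<theta> p) x * c p x)\<^sup>2 =
              (pd b (\<theta> p) x * (c p x - v x) + pd b (\<theta> p) x * v x + \<theta> p x * pd b (c p) x)\<^sup>2"
            by (simp add: algebra_simps)
          also have "\<dots> \<le> 3 * ((pd b (\<theta> p) x * (c p x - v x))\<^sup>2 + (pd b (\<theta> p) x * v x)\<^sup>2 + (\<theta> p x * pd b (c p) x)\<^sup>2)"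
            by (rule three)
          also have "\<dots> \<le> 3 * ((D p)\<^sup>2 * (c p x - v x)\<^sup>2 + (D p)\<^sup>2 * (v x)\<^sup>2 + (pd b (c p) x)\<^sup>2)"
            unfolding power_mult_distrib using t1 t2
            by (intro mult_left_mono add_mono mult_right_mono) (auto intro: mult_left_le_one_le)
          finally show "(\<theta> p x * pd b (c p) x + pd b (\<theta> p) x * c p x)\<^sup>2 \<le> 3 * ((D p)\<^sup>2 * (c p x - v x)\<^sup>2 + (D p)\<^sup>2 * (v x)\<^sup>2 + (pd b (c p) x)\<^sup>2)" .
        qed (use N in simp)
        finally show ?thesis by (simp add: sum_distrib_left mult_ac)
      qed
      then have "(\<integral>\<^sup>+x. ennreal ((pd b w x)\<^sup>2) \<partial>lborel) \<le>
          (\<integral>\<^sup>+x. (\<Sum>p\<in>I. ennreal (3 * N * (D p)\<^sup>2) * ennreal ((c p x - v x)\<^sup>2) + (ennreal (3 * N * (D p)\<^sup>2) * ennreal ((v x)\<^sup>2)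
            + ennreal (3 * N) * ennreal ((pd b (c p) x)\<^sup>2))) \<partial>lborel)"
        using N by (intro nn_integral_mono)
          (simp add: sum_ennreal ennreal_mult[symmetric] ennreal_plus[symmetric] sum_nonneg ennreal_leI distrib_left mult.assoc add.assoc
            del: ennreal_plus)
      also have "\<dots> = (\<Sum>p\<in>I. ennreal (3 * N * (D p)\<^sup>2) * (\<integral>\<^sup>+x. ennreal ((c p x - v x)\<^sup>2) \<partial>lborel) + (ennreal (3 * N * (D p)\<^sup>2) * N2
            + ennreal (3 * N) * (\<integral>\<^sup>+x. ennreal ((pd b (c p) x)\<^sup>2) \<partial>lborel)))"
        unfolding N2_def using b
        by (subst nn_integral_sum) (auto intro!: sum.cong simp: nn_integral_add nn_integral_cmult)
      also have "\<dots> \<le> (\<Sum>p\<in>I. ennreal (3 * N * (D p)\<^sup>2) * (ennreal (Cm p) * E) + (ennreal (3 * N * (D p)\<^sup>2) * N2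
            + ennreal (3 * N) * (ennreal (Cm p) * E)))"
      proof (intro sum_mono add_mono mult_left_mono order_refl)
        fix p assume p: "p \<in> I"
        have "\<delta>\<^sup>2 \<le> 1" using \<delta> \<delta>1(2) by (simp add: abs_square_le_1)
        then have "ennreal (Cm p * \<delta>\<^sup>2) * E \<le> ennreal (Cm p) * E"
          using Cm(1)[OF p] by (intro mult_right_mono ennreal_leI) (auto intro: mult_left_le)
        then show "(\<integral>\<^sup>+x. ennreal ((c p x - v x)\<^sup>2) \<partial>lborel) \<le> ennreal (Cm p) * E"
          using Cm(2)[OF p \<delta>(1) v] unfolding c_def E_def by (rule order_trans[rotated])
        show "(\<integral>\<^sup>+x. ennreal ((pd b (c p) x)\<^sup>2) \<partial>lborel) \<le> ennreal (Cm p) * E"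
          unfolding c_def E_def by (rule Cm(3)[OF p \<delta>(1) v b])
      qed auto
      also have "\<dots> = ennreal C2 * E + (ennreal C3 * N2 + ennreal C4 * E)"
        unfolding sum.distrib C2_def C3_def C4_def mult.assoc[symmetric] sum_distrib_right[symmetric]
        using Cm(1) N
        by (simp add: sum_ennreal less_imp_le ennreal_mult[symmetric] sum_nonneg sum_distrib_left mult.assoc[symmetric])
      also have "\<dots> = ennreal (C2 + C4) * E + ennreal C3 * N2"
        using Cpos by (simp add: distrib_right add_ac)
      also have "\<dots> \<le> ennreal C * E + ennreal C * N2"
        using Cpos by (intro add_mono mult_right_mono ennreal_leI) (auto simp: C_def)
      finally show ?thesis by (simp add: distrib_left)
    qed
    ultimately show "\<exists>w\<in>test_functions \<Omega>.
        (\<integral>\<^sup>+x. ennreal ((w x - v x)\<^sup>2) \<partial>lborel) \<le> ennreal (C * \<delta>\<^sup>2) * scaled_energy \<delta> v \<and>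
        (\<forall>b\<in>Basis. (\<integral>\<^sup>+x. ennreal ((pd b w x)\<^sup>2) \<partial>lborel)
          \<le> ennreal C * (scaled_energy \<delta> v + (\<integral>\<^sup>+x. ennreal ((v x)\<^sup>2) \<partial>lborel)))"
      unfolding E_def N2_def by blast
  qed
qed

section \<open>The rescaled kernel\<close>

lemma nn_integral_shear:
  fixes f :: "'a::euclidean_space \<times> 'a \<Rightarrow> ennreal"
  assumes f: "f \<in> borel_measurable borel"
  shows "(\<integral>\<^sup>+p. f p \<partial>lborel) = (\<integral>\<^sup>+x. \<integral>\<^sup>+h. f (x, x + h) \<partial>lborel \<partial>lborel)"
proof -
  have [measurable]: "f \<in> borel_measurable (borel \<Otimes>\<^sub>M borel)" using f by (simp add: borel_prod)
  have "f \<in> borel_measurable (lborel \<Otimes>\<^sub>M lborel)" by (intro borel_measurable_lborel_pair) measurable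
  then have "(\<integral>\<^sup>+p. f p \<partial>lborel) = (\<integral>\<^sup>+x. \<integral>\<^sup>+y. f (x, y) \<partial>lborel \<partial>lborel)"
    by (subst lborel_prod[symmetric]) (rule lborel.nn_integral_fst[symmetric])
  also have "\<dots> = (\<integral>\<^sup>+x. \<integral>\<^sup>+h. f (x, x + h) \<partial>lborel \<partial>lborel)"
  proof (rule nn_integral_cong)
    fix x
    have "(\<lambda>y. f (x, y)) \<in> borel_measurable borel" by measurable
    from nn_integral_lborel_translation[OF this, of x]
    show "(\<integral>\<^sup>+y. f (x, y) \<partial>lborel) = (\<integral>\<^sup>+h. f (x, x + h) \<partial>lborel)" by (simp add: add.commute)
  qed
  finally show ?thesis .
qed

lemma lborel_shear:
  "distr lborel borel (\<lambda>p. (fst p, fst p + snd p)) = (lborel :: ('a::euclidean_space \<times> 'a) measure)"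
proof (rule measure_eqI)
  have T: "(\<lambda>p::'a \<times> 'a. (fst p, fst p + snd p)) \<in> borel \<rightarrow>\<^sub>M borel"
    by (intro borel_measurable_continuous_onI continuous_intros)
  fix A :: "('a \<times> 'a) set" assume "A \<in> sets (distr lborel borel (\<lambda>p. (fst p, fst p + snd p)))"
  then have A[measurable]: "A \<in> sets borel" by simp
  have "emeasure (distr lborel borel (\<lambda>p. (fst p, fst p + snd p))) A = (\<integral>\<^sup>+p. indicator A p \<partial>distr lborel borel (\<lambda>p. (fst p, fst p + snd p)))"
    by simp
  also have "\<dots> = (\<integral>\<^sup>+p. indicator A (fst p, fst p + snd p) \<partial>lborel)"
    using T by (subst nn_integral_distr) auto
  also have "\<dots> = (\<integral>\<^sup>+x. \<integral>\<^sup>+h. indicator A (x, x + h) \<partial>lborel \<partial>lborel)"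
  proof -
    have m: "(\<lambda>p. indicator A (fst p, fst p + snd p) :: ennreal) \<in> borel_measurable (lborel \<Otimes>\<^sub>M lborel)"
      using T by (simp add: lborel_prod)
    show ?thesis
      using lborel.nn_integral_fst[OF m] by (simp add: lborel_prod)
  qed
  also have "\<dots> = (\<integral>\<^sup>+p. indicator A p \<partial>lborel)"
    by (subst nn_integral_shear) auto
  finally show "emeasure (distr lborel borel (\<lambda>p. (fst p, fst p + snd p))) A = emeasure lborel A" by simp
qed simp

text \<open>The displacement h is placed in the outer integral, so that for fixed h a translation in
  x can move the difference from one factor to the other.\<close>

lemma integral_shear_Fubini:
  fixes f :: "'a::euclidean_space \<times> 'a \<Rightarrow> real"
  assumes f: "integrable lborel f"
  shows "integrable lborel (\<lambda>h. \<integral>x. f (x, x + h) \<partial>lborel)"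
    "(\<integral>p. f p \<partial>lborel) = (\<integral>h. (\<integral>x. f (x, x + h) \<partial>lborel) \<partial>lborel)"
proof -
  have T: "(\<lambda>p::'a \<times> 'a. (fst p, fst p + snd p)) \<in> borel_measurable lborel"
    by (simp, intro borel_measurable_continuous_onI continuous_intros)
  have fm: "f \<in> borel_measurable borel" using f by auto
  have "integrable (distr lborel borel (\<lambda>p. (fst p, fst p + snd p))) f"
    using f by (simp add: lborel_shear)
  then have "integrable lborel (\<lambda>p. f (fst p, fst p + snd p))"
    using integrable_distr[OF T] by blast
  then have i: "integrable (lborel \<Otimes>\<^sub>M lborel) (\<lambda>(x, h). f (x, x + h))"
    by (simp add: lborel_prod case_prod_beta')
  have "(\<integral>p. f p \<partial>lborel) = (\<integral>p. f p \<partial>distr lborel borel (\<lambda>p. (fst p, fst p + snd p)))"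
    by (simp add: lborel_shear)
  also have "\<dots> = (\<integral>p. f (fst p, fst p + snd p) \<partial>lborel)"
    by (rule integral_distr[OF T fm])
  also have "\<dots> = (\<integral>h. (\<integral>x. f (x, x + h) \<partial>lborel) \<partial>lborel)"
    using lborel_pair.integral_snd[OF i] by (simp add: lborel_prod case_prod_beta')
  finally show "(\<integral>p. f p \<partial>lborel) = (\<integral>h. (\<integral>x. f (x, x + h) \<partial>lborel) \<partial>lborel)" .
  show "integrable lborel (\<lambda>h. \<integral>x. f (x, x + h) \<partial>lborel)"
    using lborel_pair.integrable_snd[OF i] by simp
qed

text \<open>A null set in either coordinate gives a null set of pairs; this is how a function in a
  double integral is exchanged for its zero extension.\<close>

lemma AE_lborel_pair:
  assumes "AE x in lborel. P x"
  shows "AE p in (lborel :: ('a::euclidean_space \<times> 'a) measure). P (fst p) \<and> P (snd p)"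
proof -
  obtain N where N: "{x. \<not> P x} \<subseteq> N" "N \<in> null_sets lborel"
    using assms by (auto elim!: AE_E simp: null_sets_def)
  have "N \<times> UNIV \<in> null_sets (lborel \<Otimes>\<^sub>M (lborel :: 'a measure))" "UNIV \<times> N \<in> null_sets ((lborel :: 'a measure) \<Otimes>\<^sub>M lborel)"
    using N(2) by (auto intro: lborel.times_in_null_sets1 lborel.times_in_null_sets2)
  then have "N \<times> UNIV \<union> UNIV \<times> N \<in> null_sets (lborel :: ('a \<times> 'a) measure)"
    unfolding lborel_prod by (rule null_sets.Un)
  then show ?thesis
    by (rule AE_I') (use N(1) in auto)
qed

section \<open>Isometries behind the isotropy of the kernel\<close>

definition swap_coords :: "'a \<Rightarrow> 'a \<Rightarrow> 'a::euclidean_space \<Rightarrow> 'a" where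
  "swap_coords b c x = (\<Sum>i\<in>Basis. (x \<bullet> Transposition.transpose b c i) *\<^sub>R i)"

lemma swap_coords_inner: "i \<in> Basis \<Longrightarrow> swap_coords b c x \<bullet> i = x \<bullet> Transposition.transpose b c i"
  by (simp add: swap_coords_def)

lemma transpose_Basis: "b \<in> Basis \<Longrightarrow> c \<in> Basis \<Longrightarrow> bij_betw (Transposition.transpose b c) Basis Basis"
  by (intro bij_betwI[where g="Transposition.transpose b c"]) (auto simp: Transposition.transpose_def)

lemma norm_swap_coords:
  assumes "b \<in> Basis" "c \<in> Basis"
  shows "norm (swap_coords b c x) = norm x"
proof -
  have "(norm (swap_coords b c x))\<^sup>2 = (\<Sum>i\<in>Basis. (x \<bullet> Transposition.transpose b c i)\<^sup>2)"
    by (simp add: norm_power2_Basis swap_coords_inner)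
  also have "\<dots> = (norm x)\<^sup>2"
    unfolding norm_power2_Basis by (rule sum.reindex_bij_betw[OF transpose_Basis[OF assms]])
  finally show ?thesis by simp
qed

text \<open>Lebesgue measure is determined by its values on boxes. The preimage of a box is the box
  with permuted coordinates, whose volume is the same product.\<close>

lemma lborel_swap_coords:
  fixes b c :: "'a::euclidean_space"
  assumes bc: "b \<in> Basis" "c \<in> Basis"
  shows "distr lborel borel (swap_coords b c) = lborel"
proof (rule lborel_eqI[symmetric])
  have T: "swap_coords b c \<in> borel_measurable borel"
    unfolding swap_coords_def by (intro borel_measurable_continuous_onI continuous_intros)
  have tb: "Transposition.transpose b c i \<in> Basis" if "i \<in> Basis" for i
    using bc that by (auto simp: Transposition.transpose_def)
  fix l u :: 'a assume lu: "\<And>i. i \<in> Basis \<Longrightarrow> l \<bullet> i \<le> u \<bullet> i"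
  have "swap_coords b c -` box l u = box (swap_coords b c l) (swap_coords b c u)"
  proof (intro set_eqI)
    fix x
    have "(\<forall>i\<in>Basis. l \<bullet> i < x \<bullet> Transposition.transpose b c i \<and> x \<bullet> Transposition.transpose b c i < u \<bullet> i) \<longleftrightarrow>
        (\<forall>i\<in>Basis. l \<bullet> Transposition.transpose b c i < x \<bullet> i \<and> x \<bullet> i < u \<bullet> Transposition.transpose b c i)"
      using tb by (metis transpose_involutory)
    then show "x \<in> swap_coords b c -` box l u \<longleftrightarrow> x \<in> box (swap_coords b c l) (swap_coords b c u)"
      by (simp add: mem_box swap_coords_inner)
  qed
  then have "emeasure (distr lborel borel (swap_coords b c)) (box l u)
      = emeasure lborel (box (swap_coords b c l) (swap_coords b c u))"
    using T by (simp add: emeasure_distr)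
  also have "\<dots> = (\<Prod>i\<in>Basis. (swap_coords b c u - swap_coords b c l) \<bullet> i)"
    using lu tb by (intro emeasure_lborel_box) (simp add: swap_coords_inner)
  also have "\<dots> = (\<Prod>i\<in>Basis. (u - l) \<bullet> Transposition.transpose b c i)"
    by (intro arg_cong[where f=ennreal] prod.cong) (auto simp: inner_diff_left swap_coords_inner)
  also have "\<dots> = (\<Prod>i\<in>Basis. (u - l) \<bullet> i)"
    using prod.reindex_bij_betw[OF transpose_Basis[OF bc], of "\<lambda>i. (u - l) \<bullet> i"] by simp
  finally show "emeasure (distr lborel borel (swap_coords b c)) (box l u) = (\<Prod>i\<in>Basis. (u - l) \<bullet> i)" .
qed simp

text \<open>Written in the shape of the affine maps of \<open>lborel_affine_euclidean\<close>,
  including the zero summand, so that this result applies directly.\<close>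

definition flip_coord :: "'a \<Rightarrow> 'a::euclidean_space \<Rightarrow> 'a" where
  "flip_coord b x = 0 + (\<Sum>j\<in>Basis. ((if j = b then -1 else 1) * (x \<bullet> j)) *\<^sub>R j)"

lemma flip_coord_inner: "i \<in> Basis \<Longrightarrow> flip_coord b x \<bullet> i = (if i = b then - (x \<bullet> i) else x \<bullet> i)"
  by (simp add: flip_coord_def)

lemma norm_flip_coord: "norm (flip_coord b x) = norm x"
proof -
  have "(norm (flip_coord b x))\<^sup>2 = (norm x)\<^sup>2"
    unfolding norm_power2_Basis by (intro sum.cong) (auto simp: flip_coord_inner)
  then show ?thesis by simp
qed

lemma lborel_flip_coord: "distr lborel borel (flip_coord b) = (lborel :: 'a::euclidean_space measure)"
proof -
  have "(\<Prod>j\<in>(Basis::'a set). \<bar>if j = b then -1 else 1 :: real\<bar>) = 1"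
    by (intro prod.neutral) auto
  then show ?thesis
    using lborel_affine_euclidean[of "\<lambda>j. if j = b then -1 else 1" "0::'a"]
    by (simp add: flip_coord_def[abs_def] density_1)
qed

text \<open>The value of the kernel at the origin is not controlled by the hypotheses and is reset to zero.\<close>

definition knl :: "(real \<Rightarrow> real) \<Rightarrow> real \<Rightarrow> 'a::euclidean_space \<Rightarrow> real" where
  "knl \<gamma>1 \<delta> h = (if h = 0 then 0 else scaled_kernel DIM('a) \<gamma>1 \<delta> (norm h))"

context
  fixes D0 s :: real and \<gamma>1 :: "real \<Rightarrow> real"
  assumes kernel: "nonlocal_kernel TYPE('a::euclidean_space) D0 s \<gamma>1"
begin

lemma kernel_D0: "D0 > 0"
  using kernel by (simp add: nonlocal_kernel_def)

lemma kernel_eq: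
  fixes h :: 'a
  assumes "\<delta> > 0"
  shows "knl \<gamma>1 \<delta> h = (if h \<noteq> 0 \<and> norm h < \<delta> then D0 / (norm h / \<delta>) powr s / \<delta> ^ (DIM('a) + 2) else 0)"
proof -
  have k: "\<And>t. 0 < t \<Longrightarrow> t < 1 \<Longrightarrow> \<gamma>1 t = D0 / t powr s" "\<And>t. t \<ge> 1 \<Longrightarrow> \<gamma>1 t = 0"
    using kernel by (auto simp: nonlocal_kernel_def)
  show ?thesis
    using k(1)[of "norm h / \<delta>"] k(2)[of "norm h / \<delta>"] assms by (auto simp: knl_def scaled_kernel_def)
qed

lemma kernel_nonneg: "\<delta> > 0 \<Longrightarrow> knl \<gamma>1 \<delta> (h::'a) \<ge> 0"
  using kernel_D0 by (simp add: kernel_eq)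

lemma kernel_zero: "\<delta> > 0 \<Longrightarrow> norm h \<ge> \<delta> \<Longrightarrow> knl \<gamma>1 \<delta> (h::'a) = 0"
  by (simp add: kernel_eq)

lemma kernel_borel [measurable]: "\<delta> > 0 \<Longrightarrow> (knl \<gamma>1 \<delta> :: 'a \<Rightarrow> real) \<in> borel_measurable borel"
proof -
  assume "\<delta> > 0"
  then have "(knl \<gamma>1 \<delta> :: 'a \<Rightarrow> real) = (\<lambda>h. if h \<noteq> 0 \<and> norm h < \<delta> then D0 / (norm h / \<delta>) powr s / \<delta> ^ (DIM('a) + 2) else 0)"
    by (intro ext kernel_eq)
  then show ?thesis by simp
qed

text \<open>Comparing \<gamma>1 at 1/4 and 1/2 shows that monotonicity forces s \<ge> 0; hence t^s
  \<le> 1 for t below 1, and the singular factor only increases the kernel.\<close>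

lemma kernel_lower:
  fixes h :: 'a
  assumes "\<delta> > 0" "norm h < \<delta>" "h \<noteq> 0"
  shows "knl \<gamma>1 \<delta> h \<ge> D0 / \<delta> ^ (DIM('a) + 2)"
proof -
  have "antimono_on {0<..} \<gamma>1"
    using kernel by (simp add: nonlocal_kernel_def)
  from monotone_onD[OF this, of "1/4" "1/2"] have anti: "\<gamma>1 (1/2) \<le> \<gamma>1 (1/4)"
    by simp
  have k: "\<And>t. 0 < t \<Longrightarrow> t < 1 \<Longrightarrow> \<gamma>1 t = D0 / t powr s"
    using kernel by (auto simp: nonlocal_kernel_def)
  have s: "s \<ge> 0"
  proof (rule ccontr)
    assume "\<not> s \<ge> 0"
    then have "(1/2::real) powr s < (1/4) powr s" by (intro powr_less_mono2_neg) auto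
    then have "D0 / (1/4) powr s < D0 / (1/2) powr s"
      using kernel_D0 by (intro divide_strict_left_mono) auto
    moreover have "\<gamma>1 (1/2) = D0 / (1/2) powr s" "\<gamma>1 (1/4) = D0 / (1/4) powr s" by (rule k; simp)+
    ultimately show False using anti by linarith
  qed
  have "(norm h / \<delta>) powr s \<le> 1" using s assms by (intro powr_le1) auto
  then have "D0 \<le> D0 / (norm h / \<delta>) powr s"
    using kernel_D0 assms by (simp add: le_divide_eq mult_left_le)
  then have "D0 / \<delta> ^ (DIM('a) + 2) \<le> D0 / (norm h / \<delta>) powr s / \<delta> ^ (DIM('a) + 2)"
    using assms(1) by (intro divide_right_mono) auto
  then show ?thesis
    using assms by (simp only: kernel_eq) simp
qed

text \<open>Since a function that is not integrable has integral 0, a second moment equal to d > 0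
  already entails integrability. Under scaling, the factor \<delta>^(-d-2) is balanced by the volume
  \<delta>^d and the squared length \<delta>^2.\<close>

lemma kernel_second_moment:
  assumes \<delta>: "\<delta> > 0"
  shows "(\<integral>h. knl \<gamma>1 \<delta> (h::'a) * (norm h)\<^sup>2 \<partial>lborel) = DIM('a)"
    "integrable lborel (\<lambda>h::'a. knl \<gamma>1 \<delta> h * (norm h)\<^sup>2)"
proof -
  define f where "f z = knl \<gamma>1 1 z * (norm z)\<^sup>2" for z :: 'a
  have "(\<integral>z. f z \<partial>lborel) = (LINT z:ball (0::'a) 1|lborel. \<gamma>1 (norm z) * (norm z)\<^sup>2)"
    unfolding set_lebesgue_integral_def using kernel
    by (intro Bochner_Integration.integral_cong)
      (auto simp: f_def knl_def scaled_kernel_def indicator_def nonlocal_kernel_def)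
  also have "\<dots> = DIM('a)" using kernel by (simp add: nonlocal_kernel_def)
  finally have f: "(\<integral>z. f z \<partial>lborel) = DIM('a)" .
  then have fi: "integrable lborel f"
    by (rule_tac ccontr) (use DIM_positive[where 'a='a] in \<open>simp add: not_integrable_integral_eq\<close>)
  have eq: "knl \<gamma>1 \<delta> h * (norm h)\<^sup>2 = f (h /\<^sub>R \<delta>) / \<delta> ^ DIM('a)" for h :: 'a
    using \<delta> by (simp add: f_def knl_def scaled_kernel_def power_add power2_eq_square divide_simps)
  show 1: "(\<integral>h. knl \<gamma>1 \<delta> (h::'a) * (norm h)\<^sup>2 \<partial>lborel) = DIM('a)"
    unfolding eq using integral_scale[OF \<delta> fi] f \<delta> by simp
  then show "integrable lborel (\<lambda>h::'a. knl \<gamma>1 \<delta> h * (norm h)\<^sup>2)"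
    by (rule_tac ccontr) (use DIM_positive[where 'a='a] in \<open>simp add: not_integrable_integral_eq\<close>)
qed

lemma kernel_moment_integrable:
  assumes \<delta>: "\<delta> > 0" and "b \<in> Basis" "c \<in> Basis"
  shows "integrable lborel (\<lambda>h::'a. knl \<gamma>1 \<delta> h * ((h \<bullet> b) * (h \<bullet> c)))"
proof (rule Bochner_Integration.integrable_bound[OF kernel_second_moment(2)[OF \<delta>]])
  show "(\<lambda>h::'a. knl \<gamma>1 \<delta> h * ((h \<bullet> b) * (h \<bullet> c))) \<in> borel_measurable lborel"
    using \<delta> by measurable
  show "AE h::'a in lborel. norm (knl \<gamma>1 \<delta> h * ((h \<bullet> b) * (h \<bullet> c))) \<le> norm (knl \<gamma>1 \<delta> h * (norm h)\<^sup>2)"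
  proof (rule AE_I2)
    fix h :: 'a
    have "\<bar>(h \<bullet> b) * (h \<bullet> c)\<bar> \<le> norm h * norm h"
      unfolding abs_mult using assms by (intro mult_mono Basis_le_norm) auto
    then show "norm (knl \<gamma>1 \<delta> h * ((h \<bullet> b) * (h \<bullet> c))) \<le> norm (knl \<gamma>1 \<delta> h * (norm h)\<^sup>2)"
      using kernel_nonneg[OF \<delta>, of h] by (simp add: abs_mult[of "knl _ _ _"] power2_eq_square mult_left_mono)
  qed
qed

text \<open>Reflecting one coordinate changes the sign of a mixed moment, which must therefore
  vanish. Swapping coordinates shows that the d pure moments coincide, and their sum is the second
  moment d.\<close>

lemma kernel_isotropic:
  assumes \<delta>: "\<delta> > 0" and b: "b \<in> Basis" and c: "c \<in> Basis"
  shows "(\<integral>h. knl \<gamma>1 \<delta> (h::'a) * ((h \<bullet> b) * (h \<bullet> c)) \<partial>lborel) = (if b = c then 1 else 0)"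
proof -
  have inv: "(\<integral>h. f (T h) \<partial>lborel) = (\<integral>h. f h \<partial>lborel)"
    if "distr lborel borel T = (lborel :: 'a measure)" "T \<in> borel_measurable lborel" "f \<in> borel_measurable borel"
    for T and f :: "'a \<Rightarrow> real"
    using integral_distr[OF that(2,3)] that(1) by simp
  have fT: "flip_coord b' \<in> borel_measurable (lborel :: 'a measure)" for b'
    unfolding flip_coord_def measurable_lborel2 by (intro borel_measurable_continuous_onI continuous_intros)
  have sT: "swap_coords b' c' \<in> borel_measurable (lborel :: 'a measure)" for b' c'
    unfolding swap_coords_def measurable_lborel2 by (intro borel_measurable_continuous_onI continuous_intros)
  have fm: "(\<lambda>h::'a. knl \<gamma>1 \<delta> h * ((h \<bullet> b) * (h \<bullet> c))) \<in> borel_measurable borel" for b c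
    using \<delta> by measurable
  have kn: "knl \<gamma>1 \<delta> h = knl \<gamma>1 \<delta> h'" if "norm h = norm h'" for h h' :: 'a
    using that norm_eq_zero[of h] norm_eq_zero[of h'] by (auto simp: knl_def)
  define M where "M b c = (\<integral>h. knl \<gamma>1 \<delta> (h::'a) * ((h \<bullet> b) * (h \<bullet> c)) \<partial>lborel)" for b c
  have "M b c = 0" if "b \<noteq> c"
  proof -
    have "M b c = (\<integral>h. knl \<gamma>1 \<delta> (flip_coord b h) * ((flip_coord b h \<bullet> b) * (flip_coord b h \<bullet> c)) \<partial>lborel)"
      unfolding M_def by (rule inv[OF lborel_flip_coord fT fm, symmetric])
    also have "\<dots> = (\<integral>h. - (knl \<gamma>1 \<delta> h * ((h \<bullet> b) * (h \<bullet> c))) \<partial>lborel)"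
      using that b c by (intro Bochner_Integration.integral_cong refl)
        (simp add: flip_coord_inner kn[OF norm_flip_coord])
    also have "\<dots> = - M b c" by (simp add: M_def)
    finally show ?thesis by simp
  qed
  moreover have "M b b = 1" if b: "b \<in> Basis" for b
  proof -
    have eq: "M c c = M b b" if c: "c \<in> Basis" for c
    proof -
      have "M c c = (\<integral>h. knl \<gamma>1 \<delta> (swap_coords b c h) * ((swap_coords b c h \<bullet> c) * (swap_coords b c h \<bullet> c)) \<partial>lborel)"
        unfolding M_def by (rule inv[OF lborel_swap_coords[OF b c] sT fm, symmetric])
      also have "\<dots> = M b b"
        unfolding M_def using c b by (intro Bochner_Integration.integral_cong refl)
          (simp add: swap_coords_inner kn[OF norm_swap_coords])
      finally show ?thesis .
    qed
    have "real DIM('a) = (\<integral>h. (\<Sum>c\<in>Basis. knl \<gamma>1 \<delta> (h::'a) * ((h \<bullet> c) * (h \<bullet> c))) \<partial>lborel)"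
      unfolding kernel_second_moment(1)[OF \<delta>, symmetric]
      by (simp add: norm_power2_Basis sum_distrib_left flip: power2_eq_square)
    also have "\<dots> = (\<Sum>c\<in>Basis. M c c)"
      unfolding M_def using kernel_moment_integrable[OF \<delta>] by (intro Bochner_Integration.integral_sum) auto
    also have "\<dots> = real DIM('a) * M b b" using eq by simp
    finally show ?thesis by (simp add: DIM_positive)
  qed
  ultimately show ?thesis using b c by (auto simp: M_def)
qed

end

section \<open>The extended domain and zero extensions\<close>

lemma open_subset_extended: "\<Omega> \<subseteq> extended_domain \<Omega> \<delta>"
  by (auto simp: extended_domain_def)

text \<open>The segment from a point of \<Omega> to a point outside crosses the boundary, so the
  outside point is closer than \<delta> to it. Interactions starting in \<Omega> therefore never
  leave the extended domain.\<close>

lemma near_in_extended: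
  assumes x: "x \<in> \<Omega>" and "norm (y - x) < \<delta>"
  shows "y \<in> extended_domain \<Omega> \<delta>"
proof (cases "y \<in> \<Omega>")
  case False
  have "closed_segment x y \<inter> frontier \<Omega> \<noteq> {}"
    using x False by (intro connected_Int_frontier) (auto intro: ends_in_segment)
  then obtain p where p: "p \<in> closed_segment x y" "p \<in> frontier \<Omega>" by blast
  have "norm (y - p) \<le> norm (y - x)" using segment_bound(2)[OF p(1)] by (simp add: norm_minus_commute)
  then have "infdist y (frontier \<Omega>) < \<delta>"
    using infdist_le[OF p(2), of y] assms(2) by (simp add: dist_norm)
  then show ?thesis using False by (simp add: extended_domain_def collar_def)
qed (simp add: extended_domain_def)

lemma extended_domain_borel: "open \<Omega> \<Longrightarrow> extended_domain \<Omega> \<delta> \<in> sets borel"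
proof -
  assume "open \<Omega>"
  have "{x. infdist x (frontier \<Omega>) < \<delta>} \<in> sets borel"
    by (intro borel_open open_Collect_less continuous_intros)
  moreover have "extended_domain \<Omega> \<delta> = \<Omega> \<union> ({x. infdist x (frontier \<Omega>) < \<delta>} - \<Omega>)"
    by (auto simp: extended_domain_def collar_def)
  ultimately show ?thesis using \<open>open \<Omega>\<close> by auto
qed

lemma extended_domain_mono: "\<delta> \<le> \<delta>' \<Longrightarrow> extended_domain \<Omega> \<delta> \<subseteq> extended_domain \<Omega> \<delta>'"
  by (auto simp: extended_domain_def collar_def)

lemma bounded_extended_domain:
  fixes \<Omega> :: "'a::euclidean_space set"
  assumes "bounded \<Omega>" "\<Omega> \<noteq> {}"
  shows "bounded (extended_domain \<Omega> \<delta>)"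
proof -
  have ne: "frontier \<Omega> \<noteq> {}" using assms frontier_eq_empty not_bounded_UNIV by blast
  have "bounded (frontier \<Omega>)"
    using bounded_closure[OF assms(1)] by (rule bounded_subset) (auto simp: frontier_def)
  then obtain a where a: "\<And>x. x \<in> frontier \<Omega> \<Longrightarrow> norm x \<le> a" by (auto simp: bounded_iff)
  obtain a' where a': "\<And>x. x \<in> \<Omega> \<Longrightarrow> norm x \<le> a'" using assms(1) by (auto simp: bounded_iff)
  have "norm x \<le> max a' (a + \<delta>)" if "x \<in> extended_domain \<Omega> \<delta>" for x
  proof (cases "x \<in> \<Omega>")
    case False
    then have i: "infdist x (frontier \<Omega>) < \<delta>" using that by (simp add: extended_domain_def collar_def)
    obtain p where p: "p \<in> frontier \<Omega>" "infdist x (frontier \<Omega>) = dist x p"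
      using infdist_attains_inf[OF frontier_closed ne] by blast
    have "norm x \<le> norm p + dist x p" by (metis dist_norm norm_triangle_sub)
    then show ?thesis using a[OF p(1)] p(2) i by linarith
  qed (use a' in force)
  then show ?thesis by (auto simp: bounded_iff)
qed

text \<open>Members of \<open>S_space\<close> are arbitrary off the extended domain and vanish on
  the collar only almost everywhere. Everything that follows works with the zero extension v, which
  is defined and measurable on the whole space.\<close>

lemma S_spaceD:
  fixes \<Omega> :: "'a::euclidean_space set"
  assumes \<Omega>: "open \<Omega>" and u: "u \<in> S_space \<gamma>1 \<Omega> \<delta>"
  defines "v \<equiv> \<lambda>x. indicator \<Omega> x * u x"
  shows "v \<in> borel_measurable borel" "integrable lborel (\<lambda>x. (v x)\<^sup>2)"
    "(\<lambda>x. indicator (extended_domain \<Omega> \<delta>) x * u x) \<in> borel_measurable borel"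
    "AE x in lborel. indicator (extended_domain \<Omega> \<delta>) x * u x = v x"
proof -
  let ?E = "extended_domain \<Omega> \<delta>"
  have L2: "u \<in> L2_space ?E" and ae: "AE x in lborel. x \<in> collar \<Omega> \<delta> \<longrightarrow> u x = 0"
    using u by (auto simp: S_space_def)
  then have um[measurable]: "(\<lambda>x. indicator ?E x * u x) \<in> borel_measurable borel"
    and ui: "integrable lborel (\<lambda>x. (indicator ?E x * u x)\<^sup>2)"
    by (auto simp: L2_space_iff)
  show "(\<lambda>x. indicator ?E x * u x) \<in> borel_measurable borel" by (rule um)
  have [measurable]: "\<Omega> \<in> sets borel" using \<Omega> by auto
  have veq: "v = (\<lambda>x. indicator \<Omega> x * (indicator ?E x * u x))"
    using open_subset_extended[of \<Omega> \<delta>] by (auto simp: v_def fun_eq_iff indicator_def)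
  show vm: "v \<in> borel_measurable borel" unfolding veq using um by measurable
  show "integrable lborel (\<lambda>x. (v x)\<^sup>2)"
    by (rule Bochner_Integration.integrable_bound[OF ui])
      (use vm open_subset_extended[of \<Omega> \<delta>] in \<open>auto simp: veq indicator_def\<close>)
  show "AE x in lborel. indicator ?E x * u x = v x"
    using ae by eventually_elim (auto simp: v_def indicator_def extended_domain_def)
qed

context
  fixes D0 s :: real and \<gamma>1 :: "real \<Rightarrow> real" and \<Omega> :: "'a::euclidean_space set" and \<delta> :: real
  assumes kernel: "nonlocal_kernel TYPE('a) D0 s \<gamma>1"
    and dom: "bounded \<Omega>" "open \<Omega>" "\<Omega> \<noteq> {}" and \<delta>: "\<delta> > 0"
begin

text \<open>A pair not contained in the extended domain contributes nothing: either its distance is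
  at least \<delta> and the kernel vanishes, or both points lie outside \<Omega>, where v is 0. The
  energy becomes an integral over the whole space, on which translations act.\<close>

lemma S_norm_zero_extension:
  assumes u: "u \<in> S_space \<gamma>1 \<Omega> \<delta>"
    and v_def: "v = (\<lambda>x. indicator \<Omega> x * u x)"
  shows "(S_norm \<gamma>1 \<Omega> \<delta> u)\<^sup>2 = (\<integral>\<^sup>+p. ennreal (knl \<gamma>1 \<delta> (snd p - fst p) * (v (snd p) - v (fst p))\<^sup>2) \<partial>lborel)"
proof -
  let ?E = "extended_domain \<Omega> \<delta>"
  have ae: "AE x in lborel. indicator ?E x * u x = v x"
    unfolding v_def by (rule S_spaceD(4)[OF dom(2) u])
  have "AE p in lborel. (case p of (x, y) \<Rightarrow> ennreal (scaled_kernel DIM('a) \<gamma>1 \<delta> (dist y x) * (u y - u x)\<^sup>2)) * indicator (?E \<times> ?E) p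
      = ennreal (knl \<gamma>1 \<delta> (snd p - fst p) * (v (snd p) - v (fst p))\<^sup>2)"
    using AE_lborel_pair[OF ae]
  proof eventually_elim
    case (elim p)
    obtain x y where p: "p = (x, y)" by force
    have e: "indicator ?E x * u x = v x" "indicator ?E y * u y = v y" using elim p by auto
    show ?case
    proof (cases "x \<in> ?E \<and> y \<in> ?E")
      case True
      then show ?thesis using e p by (auto simp: knl_def dist_norm)
    next
      case False
      have "knl \<gamma>1 \<delta> (y - x) * (v y - v x)\<^sup>2 = 0"
      proof (cases "norm (y - x) < \<delta>")
        case True
        then have "x \<notin> \<Omega>" "y \<notin> \<Omega>"
          using False near_in_extended[of x \<Omega> y \<delta>] near_in_extended[of y \<Omega> x \<delta>] open_subset_extended[of \<Omega> \<delta>]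
          by (auto simp: norm_minus_commute)
        then show ?thesis by (simp add: v_def)
      qed (use kernel_zero[OF kernel \<delta>] in \<open>simp add: not_less\<close>)
      then show ?thesis using False p by auto
    qed
  qed
  then show ?thesis
    unfolding S_norm_def esqrt_power2 by (rule nn_integral_cong_AE)
qed

lemma scaled_energy_le_S_norm:
  assumes u: "u \<in> S_space \<gamma>1 \<Omega> \<delta>"
  defines "v \<equiv> \<lambda>x. indicator \<Omega> x * u x"
  shows "scaled_energy \<delta> v \<le> ennreal (1 / D0) * (S_norm \<gamma>1 \<Omega> \<delta> u)\<^sup>2"
proof -
  have D0: "D0 > 0" by (rule kernel_D0[OF kernel])
  have km[measurable]: "(knl \<gamma>1 \<delta> :: 'a \<Rightarrow> real) \<in> borel_measurable borel" by (rule kernel_borel[OF kernel \<delta>])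
  have vm[measurable]: "v \<in> borel_measurable borel" unfolding v_def by (rule S_spaceD(1)[OF dom(2) u])
  \<comment> \<open>The reciprocal of the lower bound of the kernel, so that c times the kernel is
    at least 1 within its range.\<close>
  define c where "c = \<delta> ^ (DIM('a) + 2) / D0"
  have c: "c > 0" using \<delta> D0 by (simp add: c_def)
  let ?g = "\<lambda>x h. ennreal (knl \<gamma>1 \<delta> h * (v (x + h) - v x)\<^sup>2)"
  have gm: "(\<lambda>p. ?g (fst p) (snd p)) \<in> borel_measurable (lborel \<Otimes>\<^sub>M lborel)"
    by (intro borel_measurable_lborel_pair) measurable
  have "(\<lambda>p. ennreal (knl \<gamma>1 \<delta> (snd p - fst p) * (v (snd p) - v (fst p))\<^sup>2)) \<in> borel_measurable borel"
    unfolding borel_prod[symmetric] by measurable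
  then have Q: "(S_norm \<gamma>1 \<Omega> \<delta> u)\<^sup>2 = (\<integral>\<^sup>+x. \<integral>\<^sup>+h. ?g x h \<partial>lborel \<partial>lborel)"
    unfolding S_norm_zero_extension[OF u meta_eq_to_obj_eq[OF v_def]] by (subst nn_integral_shear) auto
  have "diff_energy \<delta> v \<le> (\<integral>\<^sup>+x. \<integral>\<^sup>+h. ennreal c * ?g x h \<partial>lborel \<partial>lborel)"
    unfolding diff_energy_def
  proof (intro nn_integral_mono)
    fix x h :: 'a
    show "indicator (ball 0 \<delta>) h * ennreal ((v (x + h) - v x)\<^sup>2) \<le> ennreal c * ?g x h"
    proof (cases "norm h < \<delta> \<and> h \<noteq> 0")
      case True
      have "1 \<le> c * knl \<gamma>1 \<delta> h"
        using mult_left_mono[OF kernel_lower[OF kernel \<delta>, of h], of c] True c \<delta> D0 by (simp add: c_def)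
      then have "1 * (v (x + h) - v x)\<^sup>2 \<le> c * knl \<gamma>1 \<delta> h * (v (x + h) - v x)\<^sup>2"
        by (intro mult_right_mono) auto
      then show ?thesis
        using True c kernel_nonneg[OF kernel \<delta>, of h] by (simp add: ennreal_mult[symmetric] ennreal_leI mult.assoc)
    qed auto
  qed
  also have "\<dots> = (\<integral>\<^sup>+x. ennreal c * (\<integral>\<^sup>+h. ?g x h \<partial>lborel) \<partial>lborel)"
    by (intro nn_integral_cong nn_integral_cmult) measurable
  also have "\<dots> = ennreal c * (S_norm \<gamma>1 \<Omega> \<delta> u)\<^sup>2"
    unfolding Q using lborel.borel_measurable_nn_integral_fst[OF gm] by (subst nn_integral_cmult) auto
  finally have "scaled_energy \<delta> v \<le> ennreal (1 / \<delta> ^ (DIM('a) + 2)) * (ennreal c * (S_norm \<gamma>1 \<Omega> \<delta> u)\<^sup>2)"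
    unfolding scaled_energy_def by (intro mult_left_mono) auto
  also have "\<dots> = ennreal (1 / D0) * (S_norm \<gamma>1 \<Omega> \<delta> u)\<^sup>2"
    using \<delta> D0 by (simp add: mult.assoc[symmetric] ennreal_mult[symmetric] c_def)
  finally show ?thesis .
qed

text \<open>The integrable majorant for the nonlocal forms: for x in the extended domain, W bounds
  the kernel times |v(y) - v(x)| |y - x| by the inequality between geometric and arithmetic means.
  The indicator keeps the second summand integrable, since every x contributes the moment d.\<close>

lemma dominating_integrable:
  assumes u: "u \<in> S_space \<gamma>1 \<Omega> \<delta>"
  defines "v \<equiv> \<lambda>x. indicator \<Omega> x * u x"
  defines "W \<equiv> \<lambda>p. knl \<gamma>1 \<delta> (snd p - fst p) * (v (snd p) - v (fst p))\<^sup>2 +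
      indicator (extended_domain \<Omega> \<delta>) (fst p) * (knl \<gamma>1 \<delta> (snd p - fst p) * (norm (snd p - fst p))\<^sup>2)"
  shows "integrable lborel W"
    "(\<integral>p. W p \<partial>lborel) = enn2real ((S_norm \<gamma>1 \<Omega> \<delta> u)\<^sup>2) + measure lborel (extended_domain \<Omega> \<delta>) * DIM('a)"
    "\<And>p. W p \<ge> 0"
proof -
  let ?E = "extended_domain \<Omega> \<delta>"
  let ?a = "\<lambda>p::'a \<times> 'a. knl \<gamma>1 \<delta> (snd p - fst p) * (v (snd p) - v (fst p))\<^sup>2"
  let ?b = "\<lambda>p::'a \<times> 'a. indicator ?E (fst p) * (knl \<gamma>1 \<delta> (snd p - fst p) * (norm (snd p - fst p))\<^sup>2)"
  have km[measurable]: "(knl \<gamma>1 \<delta> :: 'a \<Rightarrow> real) \<in> borel_measurable borel" by (rule kernel_borel[OF kernel \<delta>])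
  have vm[measurable]: "v \<in> borel_measurable borel" unfolding v_def by (rule S_spaceD(1)[OF dom(2) u])
  have [measurable]: "?E \<in> sets borel" by (rule extended_domain_borel[OF dom(2)])
  have k0: "knl \<gamma>1 \<delta> (h::'a) \<ge> 0" for h by (rule kernel_nonneg[OF kernel \<delta>])
  have am: "?a \<in> borel_measurable borel" and bm: "?b \<in> borel_measurable borel"
    unfolding borel_prod[symmetric] by measurable
  have "S_norm \<gamma>1 \<Omega> \<delta> u < \<infinity>" using u by (simp add: S_space_def)
  then have fin: "(S_norm \<gamma>1 \<Omega> \<delta> u)\<^sup>2 < \<infinity>" by (simp add: power2_eq_square ennreal_mult_less_top)
  have na: "(\<integral>\<^sup>+p. ennreal (?a p) \<partial>lborel) = (S_norm \<gamma>1 \<Omega> \<delta> u)\<^sup>2"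
    by (rule S_norm_zero_extension[OF u meta_eq_to_obj_eq[OF v_def], symmetric])
  have ia: "integrable lborel ?a"
    using am fin na k0 by (simp add: integrable_iff_bounded)
  have Ia: "(\<integral>p. ?a p \<partial>lborel) = enn2real ((S_norm \<gamma>1 \<Omega> \<delta> u)\<^sup>2)"
    unfolding na[symmetric] using am k0 by (subst integral_eq_nn_integral) auto
  have fE: "emeasure lborel ?E < \<infinity>"
    by (intro emeasure_bounded_finite bounded_extended_domain dom)
  have nb: "(\<integral>\<^sup>+p. ennreal (?b p) \<partial>lborel) = ennreal (measure lborel ?E * DIM('a))"
  proof -
    have "(\<integral>\<^sup>+p. ennreal (?b p) \<partial>lborel) = (\<integral>\<^sup>+x. \<integral>\<^sup>+h. ennreal (?b (x, x + h)) \<partial>lborel \<partial>lborel)"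
      using bm by (subst nn_integral_shear) auto
    also have "\<dots> = (\<integral>\<^sup>+x. indicator ?E x * ennreal DIM('a) \<partial>lborel)"
    proof (rule nn_integral_cong)
      fix x
      have "(\<integral>\<^sup>+h. ennreal (knl \<gamma>1 \<delta> (h::'a) * (norm h)\<^sup>2) \<partial>lborel) = ennreal DIM('a)"
        using kernel_second_moment[OF kernel \<delta>] k0 by (subst nn_integral_eq_integral) auto
      then show "(\<integral>\<^sup>+h. ennreal (?b (x, x + h)) \<partial>lborel) = indicator ?E x * ennreal DIM('a)"
        by (simp add: indicator_def)
    qed
    also have "\<dots> = emeasure lborel ?E * ennreal DIM('a)" by (subst nn_integral_multc) auto
    finally show ?thesis using fE by (simp add: emeasure_eq_ennreal_measure ennreal_mult')
  qed
  have ib: "integrable lborel ?b"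
    using bm nb k0 by (simp add: integrable_iff_bounded)
  have Ib: "(\<integral>p. ?b p \<partial>lborel) = measure lborel ?E * DIM('a)"
    using bm nb k0 by (subst integral_eq_nn_integral) auto
  show "integrable lborel W" unfolding W_def using ia ib by (rule Bochner_Integration.integrable_add)
  show "(\<integral>p. W p \<partial>lborel) = enn2real ((S_norm \<gamma>1 \<Omega> \<delta> u)\<^sup>2) + measure lborel ?E * DIM('a)"
    unfolding W_def using ia ib Ia Ib by simp
  show "\<And>p. W p \<ge> 0" unfolding W_def using k0 by simp
qed

text \<open>For fixed h, translating x turns the integral of (v(x+h) - v(x)) times the sum of h_b
  g_b(x) into one where the g_b are differenced backwards, which is approximately minus the sum over
  b, c of h_b h_c times the integral of v and the c-th derivative of g_b. Isotropy reduces the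
  double sum to minus the pairing of v with the divergence of g. The remainder has size \<eta> |h|
  per component; the factor |h| outside, the sum over components and the second moment produce d^2
  \<eta>.\<close>

lemma quotient_limit:
  fixes \<eta> :: real
  assumes vi: "integrable lborel v"
    and g: "\<And>b. b \<in> Basis \<Longrightarrow> g b \<in> test_functions \<Omega>"
    and int: "integrable lborel (\<lambda>p. knl \<gamma>1 \<delta> (snd p - fst p) * (v (snd p) - v (fst p)) * (\<Sum>b\<in>Basis. ((snd p - fst p) \<bullet> b) * g b (fst p)))"
    and \<eta>: "\<And>b x h. b \<in> Basis \<Longrightarrow> norm h < \<delta> \<Longrightarrow>
      \<bar>g b (x + h) - g b x - (\<Sum>c\<in>Basis. (h \<bullet> c) * pd c (g b) x)\<bar> \<le> \<eta> * norm h"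
  shows "\<bar>(\<integral>p. knl \<gamma>1 \<delta> (snd p - fst p) * (v (snd p) - v (fst p)) * (\<Sum>b\<in>Basis. ((snd p - fst p) \<bullet> b) * g b (fst p)) \<partial>lborel)
      + (\<Sum>b\<in>Basis. \<integral>x. v x * pd b (g b) x \<partial>lborel)\<bar> \<le> (DIM('a))\<^sup>2 * \<eta> * (\<integral>x. \<bar>v x\<bar> \<partial>lborel)"
proof -
  define N where "N = (\<integral>x. \<bar>v x\<bar> \<partial>lborel)"
  define m where "m b c = (\<integral>x. v x * pd c (g b) x \<partial>lborel)" for b c :: 'a
  define gg where "gg h x = (\<Sum>b\<in>Basis. (h \<bullet> b) * g b x)" for h x :: 'a
  have ggt: "gg h \<in> test_functions \<Omega>" for h unfolding gg_def using g by (intro test_sum test_cmult)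
  define J where "J h = (\<integral>x. (v (x + h) - v x) * gg h x \<partial>lborel)" for h
  have im: "integrable lborel (\<lambda>x. v x * pd c (g b) x)" if "b \<in> Basis" "c \<in> Basis" for b c
    using corr_integrable[OF test_pd[OF g[OF that(1)] that(2)] vi, of 0] by simp
  have J: "\<bar>J h + (\<Sum>b\<in>Basis. \<Sum>c\<in>Basis. (h \<bullet> b) * (h \<bullet> c) * m b c)\<bar> \<le> DIM('a) * \<eta> * (norm h)\<^sup>2 * N"
    if h: "norm h < \<delta>" for h
  proof -
    have i1: "integrable lborel (\<lambda>y. v y * gg h (y - h))" "integrable lborel (\<lambda>y. v y * gg h y)"
      using corr_integrable[OF ggt vi, of h h] corr_integrable[OF ggt vi, of h 0] by auto
    have "J h = (\<integral>x. v (x + h) * gg h x - v x * gg h x \<partial>lborel)"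
      unfolding J_def by (simp add: left_diff_distrib)
    also have "\<dots> = (\<integral>x. v (x + h) * gg h x \<partial>lborel) - (\<integral>x. v x * gg h x \<partial>lborel)"
      using i1 lborel_translation(2)[of "\<lambda>y. v y * gg h (y - h)" h]
      by (intro Bochner_Integration.integral_diff) auto
    also have "(\<integral>x. v (x + h) * gg h x \<partial>lborel) = (\<integral>y. v y * gg h (y - h) \<partial>lborel)"
      using lborel_translation(1)[of "\<lambda>y. v y * gg h (y - h)" h] by simp
    finally have J1: "J h = (\<integral>y. v y * gg h (y - h) \<partial>lborel) - (\<integral>x. v x * gg h x \<partial>lborel)" .
    define q where "q y = (\<Sum>b\<in>Basis. \<Sum>c\<in>Basis. (h \<bullet> b) * (h \<bullet> c) * pd c (g b) y)" for y
    have vq: "v y * q y = (\<Sum>b\<in>Basis. \<Sum>c\<in>Basis. (h \<bullet> b) * (h \<bullet> c) * (v y * pd c (g b) y))" for y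
      unfolding q_def by (simp add: sum_distrib_left mult_ac)
    have iq: "integrable lborel (\<lambda>y. v y * q y)"
      unfolding vq using im by (intro Bochner_Integration.integrable_sum Bochner_Integration.integrable_mult_right)
    have "(\<integral>y. v y * q y \<partial>lborel) = (\<Sum>b\<in>Basis. \<Sum>c\<in>Basis. (h \<bullet> b) * (h \<bullet> c) * m b c)"
      unfolding vq m_def using im
      by (simp add: Bochner_Integration.integral_sum Bochner_Integration.integrable_sum Bochner_Integration.integrable_mult_right)
    then have "J h + (\<Sum>b\<in>Basis. \<Sum>c\<in>Basis. (h \<bullet> b) * (h \<bullet> c) * m b c)
        = (\<integral>y. v y * gg h (y - h) - v y * gg h y + v y * q y \<partial>lborel)"
      using J1 i1 iq by simp
    then have "\<bar>J h + (\<Sum>b\<in>Basis. \<Sum>c\<in>Basis. (h \<bullet> b) * (h \<bullet> c) * m b c)\<bar>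
        \<le> (\<integral>y. \<bar>v y * gg h (y - h) - v y * gg h y + v y * q y\<bar> \<partial>lborel)"
      by (simp only:) (rule integral_abs_bound)
    also have "\<dots> \<le> (\<integral>y. DIM('a) * \<eta> * (norm h)\<^sup>2 * \<bar>v y\<bar> \<partial>lborel)"
    proof (rule integral_mono)
      fix y
      have "gg h (y - h) - gg h y + q y
          = (\<Sum>b\<in>Basis. (h \<bullet> b) * (g b (y - h) - g b y - (\<Sum>c\<in>Basis. ((- h) \<bullet> c) * pd c (g b) y)))"
        unfolding gg_def q_def
        by (simp add: sum_subtractf[symmetric] sum.distrib[symmetric] sum_distrib_left algebra_simps sum_negf)
      also have "\<bar>\<dots>\<bar> \<le> DIM('a) * (\<eta> * norm h) * norm h"
        using \<eta>[of _ "- h" y] h by (intro sum_inner_le) simp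
      finally have "\<bar>v y\<bar> * \<bar>gg h (y - h) - gg h y + q y\<bar> \<le> \<bar>v y\<bar> * (DIM('a) * (\<eta> * norm h) * norm h)"
        by (intro mult_left_mono) auto
      moreover have "v y * gg h (y - h) - v y * gg h y + v y * q y = v y * (gg h (y - h) - gg h y + q y)"
        by (simp add: algebra_simps)
      ultimately show "\<bar>v y * gg h (y - h) - v y * gg h y + v y * q y\<bar> \<le> DIM('a) * \<eta> * (norm h)\<^sup>2 * \<bar>v y\<bar>"
        by (simp only: abs_mult power2_eq_square mult_ac)
    next
      show "integrable lborel (\<lambda>y. \<bar>v y * gg h (y - h) - v y * gg h y + v y * q y\<bar>)"
        using i1 iq by (intro integrable_abs Bochner_Integration.integrable_add Bochner_Integration.integrable_diff)
    qed (use vi in auto)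
    also have "\<dots> = DIM('a) * \<eta> * (norm h)\<^sup>2 * N" by (simp add: N_def)
    finally show ?thesis .
  qed
  let ?I = "\<lambda>p. knl \<gamma>1 \<delta> (snd p - fst p) * (v (snd p) - v (fst p)) * (\<Sum>b\<in>Basis. ((snd p - fst p) \<bullet> b) * g b (fst p))"
  have inner: "(\<integral>x. ?I (x, x + h) \<partial>lborel) = knl \<gamma>1 \<delta> h * J h" for h
    unfolding J_def gg_def by (simp add: mult.assoc)
  have IJ: "integrable lborel (\<lambda>h. knl \<gamma>1 \<delta> h * J h)" "(\<integral>p. ?I p \<partial>lborel) = (\<integral>h. knl \<gamma>1 \<delta> h * J h \<partial>lborel)"
    using integral_shear_Fubini[OF int] by (simp_all only: inner)
  define q where "q h = (\<Sum>b\<in>Basis. \<Sum>c\<in>Basis. (h \<bullet> b) * (h \<bullet> c) * m b c)" for h :: 'a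
  have kq: "knl \<gamma>1 \<delta> h * q h = (\<Sum>b\<in>Basis. \<Sum>c\<in>Basis. m b c * (knl \<gamma>1 \<delta> h * ((h \<bullet> b) * (h \<bullet> c))))" for h
    unfolding q_def by (simp add: sum_distrib_left mult_ac)
  have iq: "integrable lborel (\<lambda>h::'a. knl \<gamma>1 \<delta> h * q h)"
    unfolding kq using kernel_moment_integrable[OF kernel \<delta>]
    by (intro Bochner_Integration.integrable_sum Bochner_Integration.integrable_mult_right)
  have "(\<integral>h. knl \<gamma>1 \<delta> h * q h \<partial>lborel) = (\<Sum>b\<in>Basis. \<Sum>c\<in>Basis. m b c * (if b = c then 1 else 0))"
    unfolding kq using kernel_moment_integrable[OF kernel \<delta>] kernel_isotropic[OF kernel \<delta>]
    by (simp add: Bochner_Integration.integral_sum Bochner_Integration.integrable_sum Bochner_Integration.integrable_mult_right)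
  also have "\<dots> = (\<Sum>b\<in>Basis. m b b)"
    by (intro sum.cong refl) (simp add: if_distrib cong: if_cong)
  finally have "(\<integral>p. ?I p \<partial>lborel) + (\<Sum>b\<in>Basis. m b b) = (\<integral>h. knl \<gamma>1 \<delta> h * J h + knl \<gamma>1 \<delta> h * q h \<partial>lborel)"
    using IJ iq by simp
  then have "\<bar>(\<integral>p. ?I p \<partial>lborel) + (\<Sum>b\<in>Basis. m b b)\<bar> \<le> (\<integral>h. \<bar>knl \<gamma>1 \<delta> h * J h + knl \<gamma>1 \<delta> h * q h\<bar> \<partial>lborel)"
    by (simp only:) (rule integral_abs_bound)
  also have "\<dots> \<le> (\<integral>h. DIM('a) * \<eta> * N * (knl \<gamma>1 \<delta> h * (norm h)\<^sup>2) \<partial>(lborel :: 'a measure))"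
  proof (rule integral_mono)
    fix h :: 'a
    show "\<bar>knl \<gamma>1 \<delta> h * J h + knl \<gamma>1 \<delta> h * q h\<bar> \<le> DIM('a) * \<eta> * N * (knl \<gamma>1 \<delta> h * (norm h)\<^sup>2)"
    proof (cases "norm h < \<delta>")
      case True
      have "knl \<gamma>1 \<delta> h * \<bar>J h + q h\<bar> \<le> knl \<gamma>1 \<delta> h * (DIM('a) * \<eta> * (norm h)\<^sup>2 * N)"
        unfolding q_def by (rule mult_left_mono[OF J[OF True] kernel_nonneg[OF kernel \<delta>]])
      then show ?thesis
        using kernel_nonneg[OF kernel \<delta>, of h] unfolding distrib_left[symmetric] abs_mult by (simp add: mult_ac)
    qed (use kernel_zero[OF kernel \<delta>] in simp)
  next
    show "integrable lborel (\<lambda>h. \<bar>knl \<gamma>1 \<delta> h * J h + knl \<gamma>1 \<delta> h * q h\<bar>)"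
      using IJ(1) iq by (intro integrable_abs Bochner_Integration.integrable_add)
    show "integrable lborel (\<lambda>h::'a. DIM('a) * \<eta> * N * (knl \<gamma>1 \<delta> h * (norm h)\<^sup>2))"
      using kernel_second_moment(2)[OF kernel \<delta>] by (intro Bochner_Integration.integrable_mult_right)
  qed
  also have "\<dots> = (DIM('a))\<^sup>2 * \<eta> * N"
    using kernel_second_moment(1)[OF kernel \<delta>] by (simp add: power2_eq_square)
  finally show ?thesis by (simp add: m_def N_def)
qed

end

section \<open>The nonlocal bilinear form\<close>

definition nonlocal_form :: "(real \<Rightarrow> real) \<Rightarrow> 'a::euclidean_space set \<Rightarrow> real \<Rightarrow> ('a \<Rightarrow> 'a \<Rightarrow> real) \<Rightarrow>
    ('a \<Rightarrow> real) \<Rightarrow> ('a \<Rightarrow> real) \<Rightarrow> real" where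
  "nonlocal_form \<gamma>1 \<Omega> \<delta> A u v =
    (LINT (x, y):extended_domain \<Omega> \<delta> \<times> extended_domain \<Omega> \<delta>|lborel.
       A x y * scaled_kernel DIM('a) \<gamma>1 \<delta> (dist x y) * (u y - u x) * (v y - v x))"

lemma esqrt_S_norm: "S_norm \<gamma>1 \<Omega> \<delta> u = esqrt ((S_norm \<gamma>1 \<Omega> \<delta> u)\<^sup>2)"
  by (simp add: S_norm_def)

context
  fixes D0 s :: real and \<gamma>1 :: "real \<Rightarrow> real" and \<Omega> :: "'a::euclidean_space set" and \<delta> :: real
  assumes kernel: "nonlocal_kernel TYPE('a) D0 s \<gamma>1"
    and dom: "bounded \<Omega>" "open \<Omega>" "\<Omega> \<noteq> {}" and \<delta>: "\<delta> > 0"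
begin

lemma S_norm_power2:
  "(S_norm \<gamma>1 \<Omega> \<delta> u)\<^sup>2 = (\<integral>\<^sup>+p. indicator (extended_domain \<Omega> \<delta> \<times> extended_domain \<Omega> \<delta>) p *
      ennreal (knl \<gamma>1 \<delta> (snd p - fst p) * (indicator (extended_domain \<Omega> \<delta>) (snd p) * u (snd p) - indicator (extended_domain \<Omega> \<delta>) (fst p) * u (fst p))\<^sup>2) \<partial>lborel)"
  unfolding S_norm_def esqrt_power2
  by (intro nn_integral_cong) (auto simp: indicator_def knl_def dist_norm)

lemma zero_in_S: "(\<lambda>x. 0) \<in> S_space \<gamma>1 \<Omega> \<delta>"
proof -
  have "(S_norm \<gamma>1 \<Omega> \<delta> (\<lambda>x. 0))\<^sup>2 = 0" unfolding S_norm_power2 by simp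
  then have "S_norm \<gamma>1 \<Omega> \<delta> (\<lambda>x. 0) = 0" by simp
  then show ?thesis by (simp add: S_space_def L2_space_iff)
qed

lemma test_in_S:
  assumes \<phi>: "\<phi> \<in> test_functions \<Omega>"
  shows "\<phi> \<in> S_space \<gamma>1 \<Omega> \<delta>"
proof -
  let ?E = "extended_domain \<Omega> \<delta>"
  have eq: "(\<lambda>x. indicator ?E x * \<phi> x) = \<phi>" "(\<lambda>x. (indicator ?E x * \<phi> x)\<^sup>2) = (\<lambda>x. (\<phi> x)\<^sup>2)"
    using test_zero[OF \<phi>] open_subset_extended[of \<Omega> \<delta>] by (auto simp: fun_eq_iff indicator_def)
  have L2: "\<phi> \<in> L2_space ?E"
    using test_borel[OF \<phi>] test_integrable_square[OF \<phi>] by (simp only: L2_space_iff eq simp_thms)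
  obtain L where L: "L > 0" "\<And>x h. \<bar>\<phi> (x + h) - \<phi> x\<bar> \<le> L * norm h" using test_lipschitz[OF \<phi>] by blast
  define W where "W p = indicator ?E (fst p) * (knl \<gamma>1 \<delta> (snd p - fst p) * (norm (snd p - fst p))\<^sup>2)" for p :: "'a \<times> 'a"
  \<comment> \<open>Instantiating the majorant at the zero function leaves its second-moment part,
    which is all that a Lipschitz function requires.\<close>
  have W: "integrable lborel W" "\<And>p. W p \<ge> 0"
    using dominating_integrable[OF kernel dom \<delta> zero_in_S] by (simp_all add: W_def[abs_def])
  have "(S_norm \<gamma>1 \<Omega> \<delta> \<phi>)\<^sup>2 \<le> (\<integral>\<^sup>+p. ennreal (L\<^sup>2 * W p) \<partial>lborel)"
    unfolding S_norm_power2
  proof (rule nn_integral_mono)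
    fix p :: "'a \<times> 'a"
    obtain x y where p: "p = (x, y)" by force
    have k: "knl \<gamma>1 \<delta> (y - x) \<ge> 0" by (rule kernel_nonneg[OF kernel \<delta>])
    have "(\<phi> y - \<phi> x)\<^sup>2 \<le> (L * norm (y - x))\<^sup>2"
      using L(2)[of x "y - x"] L(1) by (simp add: abs_le_square_iff[symmetric] abs_mult)
    then have "knl \<gamma>1 \<delta> (y - x) * (\<phi> y - \<phi> x)\<^sup>2 \<le> knl \<gamma>1 \<delta> (y - x) * (L * norm (y - x))\<^sup>2"
      using k by (rule mult_left_mono)
    then show "indicator (?E \<times> ?E) p * ennreal (knl \<gamma>1 \<delta> (snd p - fst p) * (indicator ?E (snd p) * \<phi> (snd p) - indicator ?E (fst p) * \<phi> (fst p))\<^sup>2)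
        \<le> ennreal (L\<^sup>2 * W p)"
      by (auto simp: p W_def indicator_def power_mult_distrib mult_ac intro!: ennreal_leI)
  qed
  also have "\<dots> < \<infinity>"
    using integrable_mult_right[OF W(1), of "L\<^sup>2"] W(2) by (subst nn_integral_eq_integral) auto
  finally have "S_norm \<gamma>1 \<Omega> \<delta> \<phi> < \<infinity>"
    by (subst esqrt_S_norm) simp
  then show ?thesis
    using L2 test_zero[OF \<phi>] by (auto simp: S_space_def collar_def)
qed

lemma S_norm_cmult:
  assumes u: "u \<in> S_space \<gamma>1 \<Omega> \<delta>"
  shows "(S_norm \<gamma>1 \<Omega> \<delta> (\<lambda>x. c * u x))\<^sup>2 = ennreal (c\<^sup>2) * (S_norm \<gamma>1 \<Omega> \<delta> u)\<^sup>2"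
proof -
  let ?E = "extended_domain \<Omega> \<delta>"
  define uE where "uE x = indicator ?E x * u x" for x
  have um[measurable]: "uE \<in> borel_measurable borel" unfolding uE_def by (rule S_spaceD(3)[OF dom(2) u])
  have [measurable]: "?E \<in> sets borel" by (rule extended_domain_borel[OF dom(2)])
  have [measurable]: "(knl \<gamma>1 \<delta> :: 'a \<Rightarrow> real) \<in> borel_measurable borel" by (rule kernel_borel[OF kernel \<delta>])
  have m: "(\<lambda>p. indicator (?E \<times> ?E) p * ennreal (knl \<gamma>1 \<delta> (snd p - fst p) * (uE (snd p) - uE (fst p))\<^sup>2)) \<in> borel_measurable borel"
    unfolding borel_prod[symmetric] by measurable
  have "indicator (?E \<times> ?E) p * ennreal (knl \<gamma>1 \<delta> (snd p - fst p) * (indicator ?E (snd p) * (c * u (snd p)) - indicator ?E (fst p) * (c * u (fst p)))\<^sup>2)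
      = ennreal (c\<^sup>2) * (indicator (?E \<times> ?E) p * ennreal (knl \<gamma>1 \<delta> (snd p - fst p) * (uE (snd p) - uE (fst p))\<^sup>2))" for p
  proof -
    have "knl \<gamma>1 \<delta> (snd p - fst p) * (indicator ?E (snd p) * (c * u (snd p)) - indicator ?E (fst p) * (c * u (fst p)))\<^sup>2
        = c\<^sup>2 * (knl \<gamma>1 \<delta> (snd p - fst p) * (uE (snd p) - uE (fst p))\<^sup>2)"
      by (simp add: uE_def power2_eq_square algebra_simps)
    then show ?thesis
      using kernel_nonneg[OF kernel \<delta>, of "snd p - fst p"] by (auto simp: indicator_def ennreal_mult mult_ac)
  qed
  then show ?thesis
    unfolding S_norm_power2 using m by (simp add: nn_integral_cmult uE_def)
qed

lemma S_space_cmult: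
  assumes u: "u \<in> S_space \<gamma>1 \<Omega> \<delta>"
  shows "(\<lambda>x. c * u x) \<in> S_space \<gamma>1 \<Omega> \<delta>"
proof -
  let ?E = "extended_domain \<Omega> \<delta>"
  have "u \<in> L2_space ?E" and ae: "AE x in lborel. x \<in> collar \<Omega> \<delta> \<longrightarrow> u x = 0" and fin: "S_norm \<gamma>1 \<Omega> \<delta> u < \<infinity>"
    using u by (auto simp: S_space_def)
  then have um: "(\<lambda>x. indicator ?E x * u x) \<in> borel_measurable borel" "integrable lborel (\<lambda>x. (indicator ?E x * u x)\<^sup>2)"
    by (auto simp: L2_space_iff)
  have "(\<lambda>x. c * (indicator ?E x * u x)) \<in> borel_measurable borel" using um(1) by measurable
  moreover have "integrable lborel (\<lambda>x. c\<^sup>2 * (indicator ?E x * u x)\<^sup>2)" using um(2) by simp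
  moreover have "(\<lambda>x. c * (indicator ?E x * u x)) = (\<lambda>x. indicator ?E x * (c * u x))"
    "(\<lambda>x. c\<^sup>2 * (indicator ?E x * u x)\<^sup>2) = (\<lambda>x. (indicator ?E x * (c * u x))\<^sup>2)"
    by (auto simp: power_mult_distrib mult_ac)
  ultimately have "(\<lambda>x. c * u x) \<in> L2_space ?E" by (simp only: L2_space_iff simp_thms)
  moreover have "(S_norm \<gamma>1 \<Omega> \<delta> (\<lambda>x. c * u x))\<^sup>2 < top"
    using fin unfolding S_norm_cmult[OF u] by (simp add: ennreal_mult_less_top power2_eq_square)
  then have "S_norm \<gamma>1 \<Omega> \<delta> (\<lambda>x. c * u x) < \<infinity>"
    by (subst esqrt_S_norm) simp
  moreover have "AE x in lborel. x \<in> collar \<Omega> \<delta> \<longrightarrow> c * u x = 0"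
    using ae by eventually_elim simp
  ultimately show ?thesis by (simp add: S_space_def)
qed

lemma dual_norm_bound:
  assumes F: "linear_functional_on (S_space \<gamma>1 \<Omega> \<delta>) F"
    and M: "dual_norm (S_space \<gamma>1 \<Omega> \<delta>) (S_norm \<gamma>1 \<Omega> \<delta>) F \<le> ennreal M"
    and u: "u \<in> S_space \<gamma>1 \<Omega> \<delta>"
  shows "\<bar>F u\<bar> \<le> max M 0 * enn2real (S_norm \<gamma>1 \<Omega> \<delta> u)"
proof -
  define n where "n = enn2real (S_norm \<gamma>1 \<Omega> \<delta> u)"
  have n: "S_norm \<gamma>1 \<Omega> \<delta> u = ennreal n" "n \<ge> 0" using u by (auto simp: n_def S_space_def)
  \<comment> \<open>A scaling factor strictly above the norm makes u / t admissible in the supremum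
    even if u has norm 0; afterwards t is brought down to the norm. The maximum with 0 accounts for
    \<open>ennreal\<close> sending negative M to 0.\<close>
  have *: "\<bar>F u\<bar> \<le> max M 0 * t" if t: "t > n" for t
  proof -
    have t0: "t > 0" using t n(2) by simp
    let ?w = "\<lambda>x. (1 / t) * u x"
    have w: "?w \<in> S_space \<gamma>1 \<Omega> \<delta>" by (rule S_space_cmult[OF u])
    have "(1 / t)\<^sup>2 * n\<^sup>2 \<le> 1" using t n(2) t0 by (simp add: power_divide divide_le_eq power_mono)
    then have "(S_norm \<gamma>1 \<Omega> \<delta> ?w)\<^sup>2 \<le> 1"
      unfolding S_norm_cmult[OF u] n(1) using n(2) by (simp add: ennreal_power ennreal_mult[symmetric])
    then have "S_norm \<gamma>1 \<Omega> \<delta> ?w \<le> esqrt 1"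
      by (subst esqrt_S_norm) (rule esqrt_mono)
    also have "esqrt 1 = 1" by (simp add: esqrt_def)
    finally have "ennreal \<bar>F ?w\<bar> \<le> dual_norm (S_space \<gamma>1 \<Omega> \<delta>) (S_norm \<gamma>1 \<Omega> \<delta>) F"
      unfolding dual_norm_def using w by (intro SUP_upper) auto
    also note M
    also have "ennreal M \<le> ennreal (max M 0)" by (intro ennreal_leI) simp
    finally have "\<bar>F ?w\<bar> \<le> max M 0" by simp
    moreover have "F ?w = (1 / t) * F u" using F u unfolding linear_functional_on_def by blast
    ultimately show ?thesis using t0 by (simp add: abs_mult divide_le_eq)
  qed
  show ?thesis
    unfolding n_def[symmetric]
  proof (rule field_le_epsilon)
    fix e :: real assume e: "e > 0"
    have "\<bar>F u\<bar> \<le> max M 0 * (n + e / (max M 0 + 1))" using e by (intro *) (simp add: add_nonneg_pos)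
    also have "\<dots> = max M 0 * n + (max M 0 / (max M 0 + 1)) * e" by (simp add: distrib_left)
    also have "(max M 0 / (max M 0 + 1)) * e \<le> 1 * e" using e by (intro mult_right_mono) auto
    finally show "\<bar>F u\<bar> \<le> max M 0 * n + e" by simp
  qed
qed

context
  fixes A :: "'a \<Rightarrow> 'a \<Rightarrow> real"
  assumes Acont: "continuous_on (closure (extended_domain \<Omega> \<delta> \<times> extended_domain \<Omega> \<delta>)) (\<lambda>(x, y). A x y)"
begin

lemma A_borel:
  "(\<lambda>p. indicator (extended_domain \<Omega> \<delta> \<times> extended_domain \<Omega> \<delta>) p * A (fst p) (snd p)) \<in> borel_measurable borel"
proof -
  let ?E = "extended_domain \<Omega> \<delta>"
  have E[measurable]: "?E \<in> sets borel" by (rule extended_domain_borel[OF dom(2)])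
  have "?E \<times> ?E \<in> sets borel" unfolding borel_prod[symmetric] by measurable
  moreover have "continuous_on (?E \<times> ?E) (\<lambda>p. A (fst p) (snd p))"
    using continuous_on_subset[OF Acont closure_subset] by (simp add: case_prod_beta')
  ultimately have "(\<lambda>p. indicator (?E \<times> ?E) p *\<^sub>R A (fst p) (snd p)) \<in> borel_measurable borel"
    by (rule borel_measurable_continuous_on_indicator)
  then show ?thesis by simp
qed

lemma nonlocal_form_eq:
  assumes u: "u \<in> S_space \<gamma>1 \<Omega> \<delta>" and w: "w \<in> S_space \<gamma>1 \<Omega> \<delta>"
    and U: "U = (\<lambda>x. indicator \<Omega> x * u x)" and W: "W = (\<lambda>x. indicator \<Omega> x * w x)"
  defines "G \<equiv> \<lambda>p. indicator (extended_domain \<Omega> \<delta> \<times> extended_domain \<Omega> \<delta>) p * A (fst p) (snd p) *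
      (knl \<gamma>1 \<delta> (snd p - fst p) * (U (snd p) - U (fst p)) * (W (snd p) - W (fst p)))"
  shows "nonlocal_form \<gamma>1 \<Omega> \<delta> A u w = (\<integral>p. G p \<partial>lborel)" "G \<in> borel_measurable borel"
proof -
  let ?E = "extended_domain \<Omega> \<delta>"
  define uE where "uE x = indicator ?E x * u x" for x
  define wE where "wE x = indicator ?E x * w x" for x
  have [measurable]: "uE \<in> borel_measurable borel" unfolding uE_def by (rule S_spaceD(3)[OF dom(2) u])
  have [measurable]: "wE \<in> borel_measurable borel" unfolding wE_def by (rule S_spaceD(3)[OF dom(2) w])
  have [measurable]: "U \<in> borel_measurable borel" unfolding U by (rule S_spaceD(1)[OF dom(2) u])
  have [measurable]: "W \<in> borel_measurable borel" unfolding W by (rule S_spaceD(1)[OF dom(2) w])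
  have [measurable]: "(knl \<gamma>1 \<delta> :: 'a \<Rightarrow> real) \<in> borel_measurable borel" by (rule kernel_borel[OF kernel \<delta>])
  have Am[measurable]: "(\<lambda>p. indicator (?E \<times> ?E) p * A (fst p) (snd p)) \<in> borel_measurable (borel \<Otimes>\<^sub>M borel)"
    using A_borel by (simp add: borel_prod)
  show Gm: "G \<in> borel_measurable borel" unfolding G_def borel_prod[symmetric] by measurable
  define G' where "G' p = indicator (?E \<times> ?E) p * A (fst p) (snd p) *
      (knl \<gamma>1 \<delta> (snd p - fst p) * (uE (snd p) - uE (fst p)) * (wE (snd p) - wE (fst p)))" for p
  have Gm': "G' \<in> borel_measurable borel" unfolding G'_def borel_prod[symmetric] by measurable
  have "nonlocal_form \<gamma>1 \<Omega> \<delta> A u w = (\<integral>p. G' p \<partial>lborel)"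
    unfolding nonlocal_form_def set_lebesgue_integral_def
    by (intro Bochner_Integration.integral_cong)
      (auto simp: G'_def uE_def wE_def indicator_def knl_def dist_norm norm_minus_commute)
  also have "\<dots> = (\<integral>p. G p \<partial>lborel)"
  proof (rule integral_cong_AE)
    have a1: "AE x in lborel. uE x = U x" unfolding uE_def U by (rule S_spaceD(4)[OF dom(2) u])
    have a2: "AE x in lborel. wE x = W x" unfolding wE_def W by (rule S_spaceD(4)[OF dom(2) w])
    from AE_lborel_pair[OF a1] AE_lborel_pair[OF a2] show "AE p in lborel. G' p = G p"
      by eventually_elim (simp add: G'_def G_def)
  qed (use Gm Gm' in auto)
  finally show "nonlocal_form \<gamma>1 \<Omega> \<delta> A u w = (\<integral>p. G p \<partial>lborel)" .
qed

lemma coercive: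
  assumes u: "u \<in> S_space \<gamma>1 \<Omega> \<delta>" and r: "r > 0"
    and A: "\<And>x y. x \<in> extended_domain \<Omega> \<delta> \<Longrightarrow> y \<in> extended_domain \<Omega> \<delta> \<Longrightarrow> r \<le> A x y \<and> A x y \<le> R"
  shows "r * enn2real ((S_norm \<gamma>1 \<Omega> \<delta> u)\<^sup>2) \<le> nonlocal_form \<gamma>1 \<Omega> \<delta> A u u"
proof -
  let ?E = "extended_domain \<Omega> \<delta>"
  define U where "U = (\<lambda>x. indicator \<Omega> x * u x)"
  define K where "K p = knl \<gamma>1 \<delta> (snd p - fst p) * (U (snd p) - U (fst p))\<^sup>2" for p
  define G where "G p = indicator (?E \<times> ?E) p * A (fst p) (snd p) *
      (knl \<gamma>1 \<delta> (snd p - fst p) * (U (snd p) - U (fst p)) * (U (snd p) - U (fst p)))" for p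
  have G: "nonlocal_form \<gamma>1 \<Omega> \<delta> A u u = (\<integral>p. G p \<partial>lborel)" "G \<in> borel_measurable borel"
    using nonlocal_form_eq[OF u u U_def U_def] by (simp_all add: G_def[abs_def])
  have [measurable]: "U \<in> borel_measurable borel" unfolding U_def by (rule S_spaceD(1)[OF dom(2) u])
  have [measurable]: "(knl \<gamma>1 \<delta> :: 'a \<Rightarrow> real) \<in> borel_measurable borel" by (rule kernel_borel[OF kernel \<delta>])
  have Km: "K \<in> borel_measurable borel" unfolding K_def borel_prod[symmetric] by measurable
  have K0: "K p \<ge> 0" for p unfolding K_def using kernel_nonneg[OF kernel \<delta>] by simp
  have nK: "(\<integral>\<^sup>+p. ennreal (K p) \<partial>lborel) = (S_norm \<gamma>1 \<Omega> \<delta> u)\<^sup>2"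
    unfolding K_def by (rule S_norm_zero_extension[OF kernel dom \<delta> u U_def, symmetric])
  have "S_norm \<gamma>1 \<Omega> \<delta> u < \<infinity>" using u by (simp add: S_space_def)
  then have iK: "integrable lborel K"
    using Km K0 nK by (simp add: integrable_iff_bounded power2_eq_square ennreal_mult_less_top)
  have IK: "(\<integral>p. K p \<partial>lborel) = enn2real ((S_norm \<gamma>1 \<Omega> \<delta> u)\<^sup>2)"
    unfolding nK[symmetric] using Km K0 by (intro integral_eq_nn_integral) auto
  have bounds: "r * K p \<le> G p \<and> G p \<le> R * K p" for p
  proof (cases "p \<in> ?E \<times> ?E")
    case True
    then have "r \<le> A (fst p) (snd p)" "A (fst p) (snd p) \<le> R" using A by auto
    moreover have "G p = A (fst p) (snd p) * K p" using True by (simp add: G_def K_def power2_eq_square)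
    ultimately show ?thesis using K0[of p] by (simp add: mult_right_mono)
  next
    case False
    obtain x y where p: "p = (x, y)" by force
    have "K p = 0"
    proof (cases "norm (y - x) < \<delta>")
      case True
      then have "x \<notin> \<Omega>" "y \<notin> \<Omega>"
        using False p near_in_extended[of x \<Omega> y \<delta>] near_in_extended[of y \<Omega> x \<delta>] open_subset_extended[of \<Omega> \<delta>]
        by (auto simp: norm_minus_commute)
      then show ?thesis by (simp add: K_def U_def p)
    qed (use kernel_zero[OF kernel \<delta>, of "y - x"] p in \<open>simp add: K_def not_less\<close>)
    then show ?thesis using False by (simp add: G_def)
  qed
  \<comment> \<open>Integrability of G, obtained from the upper bound on A, ensures that the form is
    a genuine integral and not the default value 0.\<close>
  have iG: "integrable lborel G"
  proof (rule Bochner_Integration.integrable_bound[where f="\<lambda>p. R * K p"])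
    show "AE p in lborel. norm (G p) \<le> norm (R * K p)"
    proof (rule AE_I2)
      fix p
      have "0 \<le> r * K p" using r K0 by simp
      then show "norm (G p) \<le> norm (R * K p)" using bounds[of p] by simp
    qed
  qed (use iK G in auto)
  have "r * enn2real ((S_norm \<gamma>1 \<Omega> \<delta> u)\<^sup>2) = (\<integral>p. r * K p \<partial>lborel)" by (simp add: IK)
  also have "\<dots> \<le> (\<integral>p. G p \<partial>lborel)" using iK iG bounds by (intro integral_mono) auto
  finally show ?thesis by (simp add: G(1))
qed

text \<open>The family g approximates the flux: to first order A(x,y) times the increment of \<phi>
  is the inner product of y - x with g(x). The error of this replacement is absorbed by the majorant
  W, which costs \<eta> times its integral; the remaining first-order term is treated by
  \<open>quotient_limit\<close>.\<close>

lemma bilinear_consistency: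
  fixes \<eta> \<eta>' :: real
  assumes u: "u \<in> S_space \<gamma>1 \<Omega> \<delta>" and \<phi>: "\<phi> \<in> test_functions \<Omega>"
    and g: "\<And>b. b \<in> Basis \<Longrightarrow> g b \<in> test_functions \<Omega>"
    and \<eta>: "\<And>x y. x \<in> extended_domain \<Omega> \<delta> \<Longrightarrow> y \<in> extended_domain \<Omega> \<delta> \<Longrightarrow> norm (y - x) < \<delta> \<Longrightarrow>
      \<bar>A x y * (\<phi> y - \<phi> x) - (\<Sum>b\<in>Basis. ((y - x) \<bullet> b) * g b x)\<bar> \<le> \<eta> * norm (y - x)"
    and \<eta>': "\<And>b x h. b \<in> Basis \<Longrightarrow> norm h < \<delta> \<Longrightarrow>
      \<bar>g b (x + h) - g b x - (\<Sum>c\<in>Basis. (h \<bullet> c) * pd c (g b) x)\<bar> \<le> \<eta>' * norm h"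
    and v: "v = (\<lambda>x. indicator \<Omega> x * u x)" and \<eta>0: "\<eta> \<ge> 0"
  shows "\<bar>nonlocal_form \<gamma>1 \<Omega> \<delta> A u \<phi> + (\<Sum>b\<in>Basis. \<integral>x. v x * pd b (g b) x \<partial>lborel)\<bar>
    \<le> \<eta> * (enn2real ((S_norm \<gamma>1 \<Omega> \<delta> u)\<^sup>2) + measure lborel (extended_domain \<Omega> \<delta>) * DIM('a))
      + (DIM('a))\<^sup>2 * \<eta>' * (\<integral>x. \<bar>v x\<bar> \<partial>lborel)"
proof -
  let ?E = "extended_domain \<Omega> \<delta>"
  have vm[measurable]: "v \<in> borel_measurable borel" unfolding v by (rule S_spaceD(1)[OF dom(2) u])
  have v2: "integrable lborel (\<lambda>x. (v x)\<^sup>2)" unfolding v by (rule S_spaceD(2)[OF dom(2) u])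
  have vi: "integrable lborel v"
    by (rule square_integrable_imp_integrable[OF vm v2 dom(1)]) (simp add: v)
  have km[measurable]: "(knl \<gamma>1 \<delta> :: 'a \<Rightarrow> real) \<in> borel_measurable borel" by (rule kernel_borel[OF kernel \<delta>])
  have k0: "knl \<gamma>1 \<delta> (h::'a) \<ge> 0" for h by (rule kernel_nonneg[OF kernel \<delta>])
  have \<phi>eq: "\<phi> = (\<lambda>x. indicator \<Omega> x * \<phi> x)" using test_zero[OF \<phi>] by (auto simp: fun_eq_iff indicator_def)
  define W where "W p = knl \<gamma>1 \<delta> (snd p - fst p) * (v (snd p) - v (fst p))\<^sup>2 +
      indicator ?E (fst p) * (knl \<gamma>1 \<delta> (snd p - fst p) * (norm (snd p - fst p))\<^sup>2)" for p
  have W: "integrable lborel W"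
    "(\<integral>p. W p \<partial>lborel) = enn2real ((S_norm \<gamma>1 \<Omega> \<delta> u)\<^sup>2) + measure lborel ?E * DIM('a)" "\<And>p. W p \<ge> 0"
    using dominating_integrable[OF kernel dom \<delta> u] by (simp_all add: W_def[abs_def] v)
  define G where "G p = indicator (?E \<times> ?E) p * A (fst p) (snd p) *
      (knl \<gamma>1 \<delta> (snd p - fst p) * (v (snd p) - v (fst p)) * (\<phi> (snd p) - \<phi> (fst p)))" for p
  have G: "nonlocal_form \<gamma>1 \<Omega> \<delta> A u \<phi> = (\<integral>p. G p \<partial>lborel)" "G \<in> borel_measurable borel"
    using nonlocal_form_eq[OF u test_in_S[OF \<phi>] v \<phi>eq] by (simp_all add: G_def[abs_def])
  define H where "H p = knl \<gamma>1 \<delta> (snd p - fst p) * (v (snd p) - v (fst p)) * (\<Sum>b\<in>Basis. ((snd p - fst p) \<bullet> b) * g b (fst p))" for p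
  have gm: "g b \<in> borel_measurable borel" if "b \<in> Basis" for b using test_borel[OF g[OF that]] .
  have Hm: "H \<in> borel_measurable borel"
  proof -
    have "(\<lambda>p::'a \<times> 'a. ((snd p - fst p) \<bullet> b) * g b (fst p)) \<in> borel_measurable (borel \<Otimes>\<^sub>M borel)" if "b \<in> Basis" for b
      using gm[OF that] by measurable
    then have [measurable]: "(\<lambda>p::'a \<times> 'a. \<Sum>b\<in>Basis. ((snd p - fst p) \<bullet> b) * g b (fst p)) \<in> borel_measurable (borel \<Otimes>\<^sub>M borel)"
      by (rule borel_measurable_sum)
    show ?thesis unfolding H_def borel_prod[symmetric] by measurable
  qed
  have amgm: "knl \<gamma>1 \<delta> h * \<bar>t\<bar> * norm h \<le> knl \<gamma>1 \<delta> h * t\<^sup>2 + knl \<gamma>1 \<delta> h * (norm h)\<^sup>2" for h :: 'a and t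
  proof -
    have "2 * (\<bar>t\<bar> * norm h) \<le> t\<^sup>2 + (norm h)\<^sup>2"
      using zero_le_power2[of "\<bar>t\<bar> - norm h"] by (simp add: power2_diff)
    moreover have "0 \<le> \<bar>t\<bar> * norm h" by simp
    ultimately have "\<bar>t\<bar> * norm h \<le> t\<^sup>2 + (norm h)\<^sup>2" by linarith
    then show ?thesis using mult_left_mono[OF _ k0[of h]] by (fastforce simp: distrib_left mult.assoc)
  qed
  have "\<exists>B>0. \<forall>x. \<bar>g b x\<bar> \<le> B" if "b \<in> Basis" for b by (rule test_bounded[OF g[OF that]]) blast
  then obtain B where B: "\<And>b. b \<in> Basis \<Longrightarrow> B b > 0" "\<And>b x. b \<in> Basis \<Longrightarrow> \<bar>g b x\<bar> \<le> B b" by metis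
  define C where "C = (\<Sum>b\<in>Basis. B b)"
  have C: "\<bar>g b x\<bar> \<le> C" if "b \<in> Basis" for b x
    using B(2)[OF that, of x] member_le_sum[of b Basis B] B(1) that unfolding C_def by (force simp: less_imp_le)
  have C0: "C \<ge> 0" unfolding C_def using B(1) by (intro sum_nonneg) (simp add: less_imp_le)
  have iH: "integrable lborel H"
  proof (rule Bochner_Integration.integrable_bound[where f="\<lambda>p. DIM('a) * C * W p"])
    show "AE p in lborel. norm (H p) \<le> norm (DIM('a) * C * W p)"
    proof (rule AE_I2)
      fix p :: "'a \<times> 'a"
      obtain x y where p: "p = (x, y)" by force
      show "norm (H p) \<le> norm (DIM('a) * C * W p)"
      proof (cases "x \<in> \<Omega>")
        case True
        have "\<bar>H p\<bar> = knl \<gamma>1 \<delta> (y - x) * \<bar>v y - v x\<bar> * \<bar>\<Sum>b\<in>Basis. ((y - x) \<bullet> b) * g b x\<bar>"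
          using k0 by (simp add: H_def p abs_mult)
        also have "\<dots> \<le> knl \<gamma>1 \<delta> (y - x) * \<bar>v y - v x\<bar> * (DIM('a) * C * norm (y - x))"
          using k0 C by (intro mult_left_mono sum_inner_le) auto
        also have "\<dots> = DIM('a) * C * (knl \<gamma>1 \<delta> (y - x) * \<bar>v y - v x\<bar> * norm (y - x))" by simp
        also have "\<dots> \<le> DIM('a) * C * W p"
        proof (rule mult_left_mono)
          show "knl \<gamma>1 \<delta> (y - x) * \<bar>v y - v x\<bar> * norm (y - x) \<le> W p"
            using amgm[of "y - x" "v y - v x"] True open_subset_extended[of \<Omega> \<delta>] by (auto simp: W_def p)
        qed (use C0 in simp)
        finally show ?thesis by simp
      next
        case False
        then have "H p = 0" using test_zero[OF g] by (simp add: H_def p)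
        then show ?thesis by simp
      qed
    qed
  qed (use W Hm in auto)
  have diff: "\<bar>G p - H p\<bar> \<le> \<eta> * W p" for p
  proof -
    obtain x y where p: "p = (x, y)" by force
    show ?thesis
    proof (cases "norm (y - x) < \<delta>")
      case near: True
      show ?thesis
      proof (cases "x \<in> ?E \<and> y \<in> ?E")
        case True
        have "G p - H p = knl \<gamma>1 \<delta> (y - x) * (v y - v x) * (A x y * (\<phi> y - \<phi> x) - (\<Sum>b\<in>Basis. ((y - x) \<bullet> b) * g b x))"
          using True by (simp add: G_def H_def p algebra_simps)
        then have "\<bar>G p - H p\<bar> = knl \<gamma>1 \<delta> (y - x) * \<bar>v y - v x\<bar> * \<bar>A x y * (\<phi> y - \<phi> x) - (\<Sum>b\<in>Basis. ((y - x) \<bullet> b) * g b x)\<bar>"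
          using k0 by (simp add: abs_mult)
        also have "\<dots> \<le> knl \<gamma>1 \<delta> (y - x) * \<bar>v y - v x\<bar> * (\<eta> * norm (y - x))"
          using \<eta> True near k0 by (intro mult_left_mono) auto
        also have "\<dots> = \<eta> * (knl \<gamma>1 \<delta> (y - x) * \<bar>v y - v x\<bar> * norm (y - x))" by simp
        also have "\<dots> \<le> \<eta> * W p"
          using amgm[of "y - x" "v y - v x"] True \<eta>0 by (intro mult_left_mono) (auto simp: W_def p)
        finally show ?thesis .
      next
        case False
        then have "x \<notin> \<Omega>" using near near_in_extended[of x \<Omega> y \<delta>] open_subset_extended[of \<Omega> \<delta>] by auto
        then have "H p = 0" using test_zero[OF g] by (simp add: H_def p)
        moreover have "G p = 0" using False by (auto simp: G_def p)
        ultimately show ?thesis using W(3)[of p] \<eta>0 by simp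
      qed
    next
      case False
      then have "knl \<gamma>1 \<delta> (y - x) = 0" by (intro kernel_zero[OF kernel \<delta>]) simp
      then show ?thesis using W(3)[of p] \<eta>0 by (simp add: G_def H_def p)
    qed
  qed
  have iD: "integrable lborel (\<lambda>p. G p - H p)"
    by (rule Bochner_Integration.integrable_bound[where f="\<lambda>p. \<eta> * W p"])
      (use W(1) G(2) Hm diff in \<open>auto intro!: AE_I2 order_trans[OF _ abs_ge_self]\<close>)
  have "(\<integral>p. G p \<partial>lborel) = (\<integral>p. (G p - H p) + H p \<partial>lborel)" by simp
  also have "\<dots> = (\<integral>p. G p - H p \<partial>lborel) + (\<integral>p. H p \<partial>lborel)"
    by (rule Bochner_Integration.integral_add[OF iD iH])
  finally have eq: "nonlocal_form \<gamma>1 \<Omega> \<delta> A u \<phi> = (\<integral>p. G p - H p \<partial>lborel) + (\<integral>p. H p \<partial>lborel)"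
    by (simp add: G(1))
  have "\<bar>\<integral>p. G p - H p \<partial>lborel\<bar> \<le> (\<integral>p. \<eta> * W p \<partial>lborel)"
    using iD W(1) diff by (intro order_trans[OF integral_abs_bound integral_mono]) auto
  also have "\<dots> = \<eta> * (enn2real ((S_norm \<gamma>1 \<Omega> \<delta> u)\<^sup>2) + measure lborel ?E * DIM('a))"
    by (simp add: W(2))
  finally have 1: "\<bar>\<integral>p. G p - H p \<partial>lborel\<bar> \<le> \<eta> * (enn2real ((S_norm \<gamma>1 \<Omega> \<delta> u)\<^sup>2) + measure lborel ?E * DIM('a))" .
  have 2: "\<bar>(\<integral>p. H p \<partial>lborel) + (\<Sum>b\<in>Basis. \<integral>x. v x * pd b (g b) x \<partial>lborel)\<bar> \<le> (DIM('a))\<^sup>2 * \<eta>' * (\<integral>x. \<bar>v x\<bar> \<partial>lborel)"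
    unfolding H_def by (rule quotient_limit[OF kernel dom \<delta> vi g iH[unfolded H_def[abs_def]] \<eta>'])
  show ?thesis using 1 2 unfolding eq by linarith
qed

end

end

section \<open>Convergence of the solutions\<close>

lemma approximate_flux:
  fixes \<Omega> :: "'a::euclidean_space set" and A :: "'a \<Rightarrow> 'a \<Rightarrow> real"
  assumes E: "bounded E" and A: "continuous_on (closure (E \<times> E)) (\<lambda>(x, y). A x y)"
    "\<And>x. x \<in> E \<Longrightarrow> \<bar>A x x\<bar> \<le> R"
    and sub: "\<Omega> \<subseteq> E" and \<psi>: "\<psi> \<in> test_functions \<Omega>" and \<eta>: "\<eta> > 0" and R: "R \<ge> 0"
  obtains g \<delta>2 where "\<delta>2 > 0" "\<And>b. b \<in> Basis \<Longrightarrow> g b \<in> test_functions \<Omega>"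
    "\<And>b x. b \<in> Basis \<Longrightarrow> x \<in> \<Omega> \<Longrightarrow> \<bar>g b x - A x x * pd b \<psi> x\<bar> \<le> \<eta> * \<bar>pd b \<psi> x\<bar>"
    "\<And>x y. x \<in> E \<Longrightarrow> y \<in> E \<Longrightarrow> norm (y - x) < \<delta>2 \<Longrightarrow>
      \<bar>A x y * (\<psi> y - \<psi> x) - (\<Sum>b\<in>Basis. ((y - x) \<bullet> b) * g b x)\<bar> \<le> \<eta> * norm (y - x)"
proof -
  obtain L where L: "L > 0" "\<And>x h. \<bar>\<psi> (x + h) - \<psi> x\<bar> \<le> L * norm h" using test_lipschitz[OF \<psi>] by blast
  \<comment> \<open>The error consists of 2 e from A(x,y) - p(x), times the Lipschitz constant L of
    \<psi>, and of e from the expansion of \<psi>, times |p| \<le> R + 1. The bound on p uses e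
    \<le> 1.\<close>
  define e where "e = min 1 (\<eta> / (2 * L + R + 2))"
  have den: "2 * L + R + 2 > 0" using L R by simp
  have e: "e > 0" "e \<le> 1" "e * (2 * L + R + 2) \<le> \<eta>"
    using \<eta> den by (auto simp: e_def min_def pos_le_divide_eq)
  have e\<eta>: "e \<le> \<eta>"
  proof -
    have "e * 1 \<le> e * (2 * L + R + 2)" using e L R by (intro mult_left_mono) auto
    then show ?thesis using e(3) by simp
  qed
  have K: "compact (closure E)" "closure (E \<times> E) = closure E \<times> closure E"
    using E by (auto simp: compact_closure closure_Times)
  have "continuous_on (closure E) (\<lambda>x. (\<lambda>(x, y). A x y) (x, x))"
    by (rule continuous_on_compose2[OF A(1)]) (auto simp: K(2) intro!: continuous_intros)
  then have "continuous_on (closure E) (\<lambda>x. A x x)" by simp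
  \<comment> \<open>A real polynomial close to the diagonal coefficient: multiplying a partial
    derivative of \<psi> by it gives a test function again, which the continuous coefficient itself
    would not guarantee.\<close>
  then obtain p where p: "real_polynomial_function p" "\<And>x. x \<in> closure E \<Longrightarrow> \<bar>A x x - p x\<bar> < e"
    using Stone_Weierstrass_real_polynomial_function[OF K(1) _ e(1)] by blast
  have "uniformly_continuous_on (closure (E \<times> E)) (\<lambda>(x, y). A x y)"
    using A(1) K by (intro compact_uniformly_continuous) (auto intro: compact_Times)
  then obtain d where d: "d > 0" "\<And>q q'. q \<in> closure (E \<times> E) \<Longrightarrow> q' \<in> closure (E \<times> E) \<Longrightarrow> dist q' q < d \<Longrightarrow>
      dist ((\<lambda>(x, y). A x y) q') ((\<lambda>(x, y). A x y) q) < e"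
    using e(1) unfolding uniformly_continuous_on_def by metis
  obtain d' where d': "d' > 0"
    "\<And>x h. norm h < d' \<Longrightarrow> \<bar>\<psi> (x + h) - \<psi> x - (\<Sum>b\<in>Basis. (h \<bullet> b) * pd b \<psi> x)\<bar> \<le> e * norm h"
    using test_uniformly_differentiable[OF \<psi> e(1)] by blast
  define g where "g b x = p x * pd b \<psi> x" for b x
  show thesis
  proof (rule that[of "min d d'" g])
    show "min d d' > 0" using d d' by simp
    show "g b \<in> test_functions \<Omega>" if "b \<in> Basis" for b
      unfolding g_def using smooth_real_polynomial_function[OF p(1)] by (rule test_mult) (rule test_pd[OF \<psi> that])
    show "\<bar>g b x - A x x * pd b \<psi> x\<bar> \<le> \<eta> * \<bar>pd b \<psi> x\<bar>" if "x \<in> \<Omega>" for b x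
    proof -
      have "x \<in> closure E" using that sub closure_subset by blast
      then have "\<bar>p x - A x x\<bar> \<le> \<eta>" using p(2)[of x] e\<eta> by linarith
      then show ?thesis
        unfolding g_def left_diff_distrib[symmetric] abs_mult by (rule mult_right_mono) simp
    qed
    fix x y assume xy: "x \<in> E" "y \<in> E" "norm (y - x) < min d d'"
    have cl: "x \<in> closure E" "y \<in> closure E" using xy closure_subset by blast+
    have "dist (x, y) (x, x) < d" using xy by (simp add: dist_Pair_Pair dist_norm)
    then have "\<bar>A x y - A x x\<bar> < e"
      using d(2)[of "(x, x)" "(x, y)"] cl by (auto simp: K(2) dist_real_def)
    then have 1: "\<bar>A x y - p x\<bar> \<le> 2 * e" using p(2)[OF cl(1)] by linarith
    have 2: "\<bar>\<psi> y - \<psi> x\<bar> \<le> L * norm (y - x)" using L(2)[of x "y - x"] by simp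
    have 3: "\<bar>\<psi> y - \<psi> x - (\<Sum>b\<in>Basis. ((y - x) \<bullet> b) * pd b \<psi> x)\<bar> \<le> e * norm (y - x)"
      using d'(2)[of "y - x" x] xy by simp
    have 4: "\<bar>p x\<bar> \<le> R + 1" using p(2)[OF cl(1)] A(2)[OF xy(1)] e(2) by linarith
    have "A x y * (\<psi> y - \<psi> x) - (\<Sum>b\<in>Basis. ((y - x) \<bullet> b) * g b x) =
        (A x y - p x) * (\<psi> y - \<psi> x) + p x * (\<psi> y - \<psi> x - (\<Sum>b\<in>Basis. ((y - x) \<bullet> b) * pd b \<psi> x))"
      by (simp add: g_def algebra_simps sum_distrib_left)
    also have "\<bar>\<dots>\<bar> \<le> 2 * e * (L * norm (y - x)) + (R + 1) * (e * norm (y - x))"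
    proof (rule order_trans[OF abs_triangle_ineq add_mono])
      show "\<bar>(A x y - p x) * (\<psi> y - \<psi> x)\<bar> \<le> 2 * e * (L * norm (y - x))"
        unfolding abs_mult using 1 2 e by (intro mult_mono) auto
      show "\<bar>p x * (\<psi> y - \<psi> x - (\<Sum>b\<in>Basis. ((y - x) \<bullet> b) * pd b \<psi> x))\<bar> \<le> (R + 1) * (e * norm (y - x))"
        unfolding abs_mult using 3 4 R by (intro mult_mono) auto
    qed
    also have "\<dots> = e * (2 * L + R + 1) * norm (y - x)" by (simp add: algebra_simps)
    also have "\<dots> \<le> \<eta> * norm (y - x)"
    proof (rule mult_right_mono)
      have "e * (2 * L + R + 1) \<le> e * (2 * L + R + 2)" using e by (intro mult_left_mono) auto
      then show "e * (2 * L + R + 1) \<le> \<eta>" using e(3) by linarith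
    qed simp
    finally show "\<bar>A x y * (\<psi> y - \<psi> x) - (\<Sum>b\<in>Basis. ((y - x) \<bullet> b) * g b x)\<bar> \<le> \<eta> * norm (y - x)" .
  qed
qed

lemma L2_null_pairing:
  fixes f :: "nat \<Rightarrow> 'a::euclidean_space \<Rightarrow> real"
  assumes [measurable]: "\<And>n. f n \<in> borel_measurable borel" "g \<in> borel_measurable borel"
    and f: "(\<lambda>n. \<integral>\<^sup>+x. ennreal ((f n x)\<^sup>2) \<partial>lborel) \<longlonglongrightarrow> 0" and g: "(\<integral>\<^sup>+x. ennreal ((g x)\<^sup>2) \<partial>lborel) < \<infinity>"
  shows "(\<lambda>n. \<integral>x. f n x * g x \<partial>lborel) \<longlonglongrightarrow> 0"
proof -
  have le: "ennreal ((\<integral>x. f n x * g x \<partial>lborel)\<^sup>2) \<le> (\<integral>\<^sup>+x. ennreal ((g x)\<^sup>2) \<partial>lborel) * (\<integral>\<^sup>+x. ennreal ((f n x)\<^sup>2) \<partial>lborel)" for n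
  proof -
    have "ennreal \<bar>\<integral>x. f n x * g x \<partial>lborel\<bar> \<le> (\<integral>\<^sup>+x. ennreal \<bar>f n x * g x\<bar> \<partial>lborel)"
      by (cases "integrable lborel (\<lambda>x. f n x * g x)")
        (use integral_norm_bound_ennreal in \<open>force simp: not_integrable_integral_eq\<close>)+
    also have "\<dots> = (\<integral>\<^sup>+x. ennreal \<bar>g x\<bar> * ennreal \<bar>f n x\<bar> \<partial>lborel)"
      by (intro nn_integral_cong) (simp add: abs_mult ennreal_mult mult.commute[of "ennreal \<bar>g _\<bar>"])
    finally have "(ennreal \<bar>\<integral>x. f n x * g x \<partial>lborel\<bar>)\<^sup>2 \<le> (\<integral>\<^sup>+x. ennreal \<bar>g x\<bar> * ennreal \<bar>f n x\<bar> \<partial>lborel)\<^sup>2"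
      by (rule power_mono) simp
    also have "\<dots> \<le> (\<integral>\<^sup>+x. (ennreal \<bar>g x\<bar>)\<^sup>2 \<partial>lborel) * (\<integral>\<^sup>+x. (ennreal \<bar>f n x\<bar>)\<^sup>2 \<partial>lborel)"
      by (intro Cauchy_Schwarz_nn_integral) measurable
    finally show ?thesis by (simp add: ennreal_power)
  qed
  have "(\<lambda>n. (\<integral>\<^sup>+x. ennreal ((g x)\<^sup>2) \<partial>lborel) * (\<integral>\<^sup>+x. ennreal ((f n x)\<^sup>2) \<partial>lborel)) \<longlonglongrightarrow> (\<integral>\<^sup>+x. ennreal ((g x)\<^sup>2) \<partial>lborel) * 0"
    using g f by (intro ennreal_tendsto_cmult) auto
  then have lim: "(\<lambda>n. (\<integral>\<^sup>+x. ennreal ((g x)\<^sup>2) \<partial>lborel) * (\<integral>\<^sup>+x. ennreal ((f n x)\<^sup>2) \<partial>lborel)) \<longlonglongrightarrow> 0"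
    by simp
  have "(\<lambda>n. ennreal ((\<integral>x. f n x * g x \<partial>lborel)\<^sup>2)) \<longlonglongrightarrow> 0"
    by (rule tendsto_sandwich[OF always_eventually[OF allI[OF zero_le]] always_eventually[OF allI[OF le]] tendsto_const lim])
  then have "(\<lambda>n. (\<integral>x. f n x * g x \<partial>lborel)\<^sup>2) \<longlonglongrightarrow> 0"
    by (subst (asm) ennreal_tendsto_0_iff) auto
  then have "(\<lambda>n. sqrt ((\<integral>x. f n x * g x \<partial>lborel)\<^sup>2)) \<longlonglongrightarrow> sqrt 0" by (rule tendsto_real_sqrt)
  then show ?thesis by (simp add: tendsto_rabs_zero_iff)
qed

lemma nn_integral_power2_add_le:
  fixes f g :: "'a::euclidean_space \<Rightarrow> real"
  assumes [measurable]: "f \<in> borel_measurable borel" "g \<in> borel_measurable borel"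
  shows "(\<integral>\<^sup>+x. ennreal ((f x + g x)\<^sup>2) \<partial>lborel) \<le> 2 * (\<integral>\<^sup>+x. ennreal ((f x)\<^sup>2) \<partial>lborel) + 2 * (\<integral>\<^sup>+x. ennreal ((g x)\<^sup>2) \<partial>lborel)"
proof -
  have "(\<integral>\<^sup>+x. ennreal ((f x + g x)\<^sup>2) \<partial>lborel) \<le> (\<integral>\<^sup>+x. 2 * ennreal ((f x)\<^sup>2) + 2 * ennreal ((g x)\<^sup>2) \<partial>lborel)"
  proof (rule nn_integral_mono)
    fix x
    have "(f x + g x)\<^sup>2 \<le> 2 * (f x)\<^sup>2 + 2 * (g x)\<^sup>2"
      using zero_le_power2[of "f x - g x"] by (simp add: power2_eq_square algebra_simps)
    then have "ennreal ((f x + g x)\<^sup>2) \<le> ennreal (2 * (f x)\<^sup>2 + 2 * (g x)\<^sup>2)" by (rule ennreal_leI)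
    also have "\<dots> = 2 * ennreal ((f x)\<^sup>2) + 2 * ennreal ((g x)\<^sup>2)"
      by (subst ennreal_plus) (auto simp: ennreal_mult')
    finally show "ennreal ((f x + g x)\<^sup>2) \<le> 2 * ennreal ((f x)\<^sup>2) + 2 * ennreal ((g x)\<^sup>2)" .
  qed
  also have "\<dots> = 2 * (\<integral>\<^sup>+x. ennreal ((f x)\<^sup>2) \<partial>lborel) + 2 * (\<integral>\<^sup>+x. ennreal ((g x)\<^sup>2) \<partial>lborel)"
    by (subst nn_integral_add) (auto simp: nn_integral_cmult)
  finally show ?thesis .
qed

lemma tendsto_two_sum_0:
  fixes f g :: "nat \<Rightarrow> ennreal"
  assumes "f \<longlonglongrightarrow> 0" "g \<longlonglongrightarrow> 0" "\<And>n. h n \<le> 2 * f n + 2 * g n"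
  shows "h \<longlonglongrightarrow> 0"
proof -
  have "(\<lambda>n. 2 * f n + 2 * g n) \<longlonglongrightarrow> 2 * 0 + 2 * 0"
    using assms by (intro tendsto_add ennreal_tendsto_cmult) auto
  then have lim: "(\<lambda>n. 2 * f n + 2 * g n) \<longlonglongrightarrow> 0" by simp
  show ?thesis
    by (rule tendsto_sandwich[OF always_eventually[OF allI[OF zero_le]] always_eventually[OF allI[OF assms(3)]] tendsto_const lim])
qed

text \<open>Once the gradients are within distance 1 of their limit, their norms are bounded by that
  of the limit. Dropping an initial segment turns this into the uniform Dirichlet bound demanded of
  a weakly null sequence.\<close>

lemma H10_approximation_bounded:
  fixes \<Omega> :: "'a::euclidean_space set"
  assumes dom: "open \<Omega>" "bounded \<Omega>" and u: "u \<in> H10_space \<Omega>"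
  obtains \<phi> M where "\<And>n::nat. \<phi> n \<in> test_functions \<Omega>" "\<And>n. dirichlet (\<phi> n) \<le> M"
    "(\<lambda>n. \<integral>\<^sup>+x. ennreal ((indicator \<Omega> x * (u x - \<phi> n x))\<^sup>2) \<partial>lborel) \<longlonglongrightarrow> 0"
    "\<And>b. b \<in> Basis \<Longrightarrow> (\<lambda>n. \<integral>\<^sup>+x. ennreal ((indicator \<Omega> x * (weak_gradient \<Omega> u x \<bullet> b - pd b (\<phi> n) x))\<^sup>2) \<partial>lborel) \<longlonglongrightarrow> 0"
proof -
  obtain \<phi> where \<phi>: "\<And>n::nat. \<phi> n \<in> test_functions \<Omega>"
    and l1: "(\<lambda>n. \<integral>\<^sup>+x. ennreal ((indicator \<Omega> x * (u x - \<phi> n x))\<^sup>2) \<partial>lborel) \<longlonglongrightarrow> 0"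
    and l2: "\<And>b. b \<in> Basis \<Longrightarrow> (\<lambda>n. \<integral>\<^sup>+x. ennreal ((indicator \<Omega> x * (weak_gradient \<Omega> u x \<bullet> b - pd b (\<phi> n) x))\<^sup>2) \<partial>lborel) \<longlonglongrightarrow> 0"
    using H10_approximation[OF dom u] by blast
  have "\<exists>N. \<forall>n\<ge>N. (\<integral>\<^sup>+x. ennreal ((indicator \<Omega> x * (weak_gradient \<Omega> u x \<bullet> b - pd b (\<phi> n) x))\<^sup>2) \<partial>lborel) < 1" if "b \<in> Basis" for b
    using order_tendstoD(2)[OF l2[OF that], of 1] by (auto simp: eventually_sequentially)
  then obtain Nb where Nb: "\<And>b n. b \<in> Basis \<Longrightarrow> n \<ge> Nb b \<Longrightarrow>
      (\<integral>\<^sup>+x. ennreal ((indicator \<Omega> x * (weak_gradient \<Omega> u x \<bullet> b - pd b (\<phi> n) x))\<^sup>2) \<partial>lborel) < 1" by metis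
  define N where "N = Max (Nb ` Basis)"
  have N: "Nb b \<le> N" if "b \<in> Basis" for b using that by (simp add: N_def)
  have "u \<in> H1_space \<Omega>" using u by (simp add: H10_space_def)
  then have "weak_gradient \<Omega> u \<in> L2_space \<Omega>"
    using is_weak_gradient_weak_gradient[OF dom] by (simp add: is_weak_gradient_def)
  then have wg: "(\<lambda>x. indicator \<Omega> x * (weak_gradient \<Omega> u x \<bullet> b)) \<in> borel_measurable borel"
    "integrable lborel (\<lambda>x. (indicator \<Omega> x * (weak_gradient \<Omega> u x \<bullet> b))\<^sup>2)" if "b \<in> Basis" for b
    using that by (auto simp: L2_space_vec_iff L2_space_iff)
  define I where "I b = (\<integral>x. (indicator \<Omega> x * (weak_gradient \<Omega> u x \<bullet> b))\<^sup>2 \<partial>lborel)" for b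
  have bd: "(\<integral>x. (pd b (\<phi> n) x)\<^sup>2 \<partial>lborel) \<le> 2 * I b + 2" if b: "b \<in> Basis" and n: "n \<ge> N" for b n
  proof -
    have pm: "pd b (\<phi> n) \<in> borel_measurable borel" using test_borel[OF test_pd[OF \<phi> b]] .
    let ?f = "\<lambda>x. indicator \<Omega> x * (weak_gradient \<Omega> u x \<bullet> b)"
    let ?d = "\<lambda>x. pd b (\<phi> n) x - ?f x"
    have deq: "(?d x)\<^sup>2 = (indicator \<Omega> x * (weak_gradient \<Omega> u x \<bullet> b - pd b (\<phi> n) x))\<^sup>2" for x
      using test_pd_zero[OF \<phi>[of n], of x b] by (cases "x \<in> \<Omega>") (auto simp: power2_commute)
    have "ennreal (\<integral>x. (pd b (\<phi> n) x)\<^sup>2 \<partial>lborel) = (\<integral>\<^sup>+x. ennreal ((?f x + ?d x)\<^sup>2) \<partial>lborel)"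
      using test_integrable_square[OF test_pd[OF \<phi> b]] by (subst nn_integral_eq_integral) auto
    also have "\<dots> \<le> 2 * (\<integral>\<^sup>+x. ennreal ((?f x)\<^sup>2) \<partial>lborel) + 2 * (\<integral>\<^sup>+x. ennreal ((?d x)\<^sup>2) \<partial>lborel)"
      using wg(1)[OF b] pm by (intro nn_integral_power2_add_le) auto
    also have "\<dots> \<le> 2 * ennreal (I b) + 2 * 1"
      using wg(2)[OF b] Nb[OF b, of n] n N[OF b] unfolding deq I_def
      by (intro add_mono mult_left_mono) (auto simp: nn_integral_eq_integral less_imp_le)
    also have "\<dots> = ennreal (2 * I b + 2)"
      by (simp add: I_def ennreal_mult)
    finally show ?thesis by (subst (asm) ennreal_le_iff) (simp_all add: I_def)
  qed
  show thesis
  proof (rule that[of "\<lambda>n. \<phi> (n + N)" "\<Sum>b\<in>Basis. 2 * I b + 2"])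
    show "dirichlet (\<phi> (n + N)) \<le> (\<Sum>b\<in>Basis. 2 * I b + 2)" for n
    proof -
      have "dirichlet (\<phi> (n + N)) = (\<Sum>b\<in>Basis. \<integral>x. (pd b (\<phi> (n + N)) x)\<^sup>2 \<partial>lborel)"
        unfolding dirichlet_def
        by (rule Bochner_Integration.integral_sum) (rule test_integrable_square[OF test_pd[OF \<phi>]])
      also have "\<dots> \<le> (\<Sum>b\<in>Basis. 2 * I b + 2)" using bd by (intro sum_mono) auto
      finally show ?thesis .
    qed
  qed (use \<phi> LIMSEQ_ignore_initial_segment[OF l1, of N] LIMSEQ_ignore_initial_segment[OF l2, of _ N] in auto)
qed

text \<open>The parameter is frozen and the horizons form a sequence, the setting of the Banach-Saks
  argument. The values of \<open>f0\<close> on test functions link the nonlocal problems to the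
  local one, and \<delta>1 provides a single extended domain containing all the others.\<close>

theorem nonlocal_to_local:
  fixes \<Omega> :: "'a::euclidean_space set" and \<delta>s :: "nat \<Rightarrow> real" and A :: "'a \<Rightarrow> 'a \<Rightarrow> real"
  assumes domain: "bounded \<Omega>" "lipschitz_domain \<Omega>"
    and kernel: "nonlocal_kernel TYPE('a) D0 s \<gamma>1"
    and A: "continuous_on (closure (extended_domain \<Omega> \<delta>1 \<times> extended_domain \<Omega> \<delta>1)) (\<lambda>(x, y). A x y)"
      "\<And>x y. x \<in> extended_domain \<Omega> \<delta>1 \<Longrightarrow> y \<in> extended_domain \<Omega> \<delta>1 \<Longrightarrow> r \<le> A x y \<and> A x y \<le> R"
    and r: "r > 0"
    and \<delta>s: "\<And>n. 0 < \<delta>s n" "\<And>n. \<delta>s n < \<delta>1" "\<delta>s \<longlonglongrightarrow> 0"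
    and u: "\<And>n. u n \<in> S_space \<gamma>1 \<Omega> (\<delta>s n)"
      "\<And>n \<phi>. \<phi> \<in> test_functions \<Omega> \<Longrightarrow> nonlocal_form \<gamma>1 \<Omega> (\<delta>s n) A (u n) \<phi> = f0 \<phi>"
      "\<And>n. enn2real ((S_norm \<gamma>1 \<Omega> (\<delta>s n) (u n))\<^sup>2) \<le> K1"
      "\<And>n. (\<integral>\<^sup>+x. ennreal ((indicator \<Omega> x * u n x)\<^sup>2) \<partial>lborel) \<le> ennreal K2"
    and u0: "local_weak_solution \<Omega> (\<lambda>x. A x x) f0 u0"
  shows "(\<lambda>n. \<integral>\<^sup>+x. ennreal ((indicator \<Omega> x * (u n x - u0 x))\<^sup>2) \<partial>lborel) \<longlonglongrightarrow> 0"
proof -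
  let ?d = "DIM('a)"
  have dom: "open \<Omega>" "bounded \<Omega>" "\<Omega> \<noteq> {}" using domain by (auto simp: lipschitz_domain_def)
  have \<Omega>m[measurable]: "\<Omega> \<in> sets borel" using dom by auto
  define E1 where "E1 = extended_domain \<Omega> \<delta>1"
  have E1: "bounded E1" "\<Omega> \<subseteq> E1" "E1 \<in> sets borel"
    unfolding E1_def by (intro bounded_extended_domain dom open_subset_extended extended_domain_borel)+
  have sub: "extended_domain \<Omega> (\<delta>s n) \<subseteq> E1" for n
    unfolding E1_def using \<delta>s(2)[of n] by (intro extended_domain_mono) simp
  have AE1: "continuous_on (closure (E1 \<times> E1)) (\<lambda>(x, y). A x y)" using A(1) by (simp add: E1_def)
  have Ab: "r \<le> A x y" "A x y \<le> R" if "x \<in> E1" "y \<in> E1" for x y using A(2) that by (auto simp: E1_def)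
  have R: "R \<ge> 0"
  proof -
    obtain x where "x \<in> \<Omega>" using dom by blast
    then show ?thesis using Ab[of x x] E1(2) r by fastforce
  qed
  have An: "continuous_on (closure (extended_domain \<Omega> (\<delta>s n) \<times> extended_domain \<Omega> (\<delta>s n))) (\<lambda>(x, y). A x y)" for n
    by (rule continuous_on_subset[OF AE1]) (intro closure_mono Sigma_mono sub)
  define K1' where "K1' = max K1 0"
  define K2' where "K2' = max K2 0"
  have K: "K1' \<ge> 0" "K2' \<ge> 0" by (auto simp: K1'_def K2'_def)
  have uS: "enn2real ((S_norm \<gamma>1 \<Omega> (\<delta>s n) (u n))\<^sup>2) \<le> K1'" for n using u(3)[of n] by (simp add: K1'_def)
  have Sfin: "(S_norm \<gamma>1 \<Omega> (\<delta>s n) (u n))\<^sup>2 \<le> ennreal K1'" for n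
  proof -
    have "S_norm \<gamma>1 \<Omega> (\<delta>s n) (u n) < \<infinity>" using u(1) by (simp add: S_space_def)
    then have "(S_norm \<gamma>1 \<Omega> (\<delta>s n) (u n))\<^sup>2 < top" by (simp add: power2_eq_square ennreal_mult_less_top)
    then have "(S_norm \<gamma>1 \<Omega> (\<delta>s n) (u n))\<^sup>2 = ennreal (enn2real ((S_norm \<gamma>1 \<Omega> (\<delta>s n) (u n))\<^sup>2))" by simp
    also have "\<dots> \<le> ennreal K1'" using uS by (rule ennreal_leI)
    finally show ?thesis .
  qed
  define v where "v n = (\<lambda>x. indicator \<Omega> x * u n x)" for n
  have vm: "v n \<in> borel_measurable borel" and v2: "integrable lborel (\<lambda>x. (v n x)\<^sup>2)" for n
    unfolding v_def using S_spaceD(1,2)[OF dom(1) u(1)] by blast+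
  have v0: "v n x = 0" if "x \<notin> \<Omega>" for n x using that by (simp add: v_def)
  have vK2: "(\<integral>\<^sup>+x. ennreal ((v n x)\<^sup>2) \<partial>lborel) \<le> ennreal K2'" for n
    using u(4)[of n] unfolding v_def K2'_def by (rule order_trans) (simp add: ennreal_leI)
  have vi: "integrable lborel (v n)" for n
    by (rule square_integrable_imp_integrable[OF vm v2 dom(2) v0])
  have \<Omega>fin: "emeasure lborel \<Omega> < \<infinity>" by (rule emeasure_bounded_finite[OF dom(2)])
  define K3 where "K3 = measure lborel \<Omega> + K2'"
  have vK3: "(\<integral>x. \<bar>v n x\<bar> \<partial>lborel) \<le> K3" for n
  proof -
    have "ennreal (\<integral>x. (v n x)\<^sup>2 \<partial>lborel) \<le> ennreal K2'"
      using vK2[of n] v2[of n] by (subst (asm) nn_integral_eq_integral) auto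
    then have I: "(\<integral>x. (v n x)\<^sup>2 \<partial>lborel) \<le> K2'" using K by (subst (asm) ennreal_le_iff) auto
    have i\<Omega>: "integrable lborel (indicator \<Omega> :: 'a \<Rightarrow> real)" using \<Omega>fin by (intro integrable_real_indicator) auto
    have "(\<integral>x. \<bar>v n x\<bar> \<partial>lborel) \<le> (\<integral>x. indicator \<Omega> x + (v n x)\<^sup>2 \<partial>lborel)"
    proof (rule integral_mono)
      fix x
      have "2 * \<bar>v n x\<bar> \<le> 1 + (v n x)\<^sup>2" using zero_le_power2[of "\<bar>v n x\<bar> - 1"] by (simp add: power2_diff)
      then show "\<bar>v n x\<bar> \<le> indicator \<Omega> x + (v n x)\<^sup>2" using v0[of x n] by (cases "x \<in> \<Omega>") auto
    qed (use vi v2 i\<Omega> in auto)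
    also have "\<dots> = measure lborel \<Omega> + (\<integral>x. (v n x)\<^sup>2 \<partial>lborel)" using i\<Omega> v2 by simp
    finally show ?thesis using I by (simp add: K3_def)
  qed
  have K3: "K3 \<ge> 0" using K by (simp add: K3_def)
  have D0: "D0 > 0" by (rule kernel_D0[OF kernel])
  have en: "scaled_energy (\<delta>s n) (v n) \<le> ennreal (K1' / D0)" for n
  proof -
    have "scaled_energy (\<delta>s n) (v n) \<le> ennreal (1 / D0) * (S_norm \<gamma>1 \<Omega> (\<delta>s n) (u n))\<^sup>2"
      unfolding v_def by (rule scaled_energy_le_S_norm[OF kernel dom(2,1,3) \<delta>s(1) u(1)])
    also have "\<dots> \<le> ennreal (1 / D0) * ennreal K1'" by (intro mult_left_mono Sfin) simp
    also have "\<dots> = ennreal (K1' / D0)" using D0 K by (simp add: ennreal_mult[symmetric])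
    finally show ?thesis .
  qed
  obtain C \<delta>2 where C: "C > 0" and \<delta>2: "\<delta>2 > 0"
    and reg: "\<And>\<delta> v. 0 < \<delta> \<Longrightarrow> \<delta> < \<delta>2 \<Longrightarrow> v \<in> borel_measurable borel \<Longrightarrow> integrable lborel (\<lambda>x. (v x)\<^sup>2) \<Longrightarrow>
      (\<And>x. x \<notin> \<Omega> \<Longrightarrow> v x = 0) \<Longrightarrow>
      \<exists>w\<in>test_functions \<Omega>.
        (\<integral>\<^sup>+x. ennreal ((w x - v x)\<^sup>2) \<partial>lborel) \<le> ennreal (C * \<delta>\<^sup>2) * scaled_energy \<delta> v \<and>
        (\<forall>b\<in>Basis. (\<integral>\<^sup>+x. ennreal ((pd b w x)\<^sup>2) \<partial>lborel)
          \<le> ennreal C * (scaled_energy \<delta> v + (\<integral>\<^sup>+x. ennreal ((v x)\<^sup>2) \<partial>lborel)))"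
    using regularisation[OF domain] by blast
  define K4 where "K4 = C * (K1' / D0 + K2')"
  have K4: "K4 \<ge> 0" using C K D0 by (simp add: K4_def)
  \<comment> \<open>For horizons too large for the regularisation the zero function fills the place;
    it meets the gradient bound, while closeness to v is claimed only for small horizons, which
    suffices for the limit.\<close>
  define good where "good n w \<longleftrightarrow> w \<in> test_functions \<Omega> \<and>
      (\<delta>s n < \<delta>2 \<longrightarrow> (\<integral>\<^sup>+x. ennreal ((w x - v n x)\<^sup>2) \<partial>lborel) \<le> ennreal (C * (K1' / D0) * (\<delta>s n)\<^sup>2)) \<and>
      (\<forall>b\<in>Basis. (\<integral>\<^sup>+x. ennreal ((pd b w x)\<^sup>2) \<partial>lborel) \<le> ennreal K4)" for n w
  have "\<exists>w. good n w" for n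
  proof (cases "\<delta>s n < \<delta>2")
    case True
    obtain w where w: "w \<in> test_functions \<Omega>"
      "(\<integral>\<^sup>+x. ennreal ((w x - v n x)\<^sup>2) \<partial>lborel) \<le> ennreal (C * (\<delta>s n)\<^sup>2) * scaled_energy (\<delta>s n) (v n)"
      "\<And>b. b \<in> Basis \<Longrightarrow> (\<integral>\<^sup>+x. ennreal ((pd b w x)\<^sup>2) \<partial>lborel)
          \<le> ennreal C * (scaled_energy (\<delta>s n) (v n) + (\<integral>\<^sup>+x. ennreal ((v n x)\<^sup>2) \<partial>lborel))"
      using reg[OF \<delta>s(1) True vm v2 v0] by blast
    show ?thesis
      unfolding good_def
    proof (intro exI[of _ w] conjI impI ballI w(1))
      have "ennreal (C * (\<delta>s n)\<^sup>2) * scaled_energy (\<delta>s n) (v n) \<le> ennreal (C * (\<delta>s n)\<^sup>2) * ennreal (K1' / D0)"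
        by (intro mult_left_mono en) simp
      also have "\<dots> = ennreal (C * (K1' / D0) * (\<delta>s n)\<^sup>2)"
        using C K D0 by (subst ennreal_mult[symmetric]) (auto simp: mult_ac)
      finally show "(\<integral>\<^sup>+x. ennreal ((w x - v n x)\<^sup>2) \<partial>lborel) \<le> ennreal (C * (K1' / D0) * (\<delta>s n)\<^sup>2)"
        by (rule order_trans[OF w(2)])
      fix b :: 'a assume b: "b \<in> Basis"
      have "ennreal C * (scaled_energy (\<delta>s n) (v n) + (\<integral>\<^sup>+x. ennreal ((v n x)\<^sup>2) \<partial>lborel)) \<le> ennreal C * (ennreal (K1' / D0) + ennreal K2')"
        by (intro mult_left_mono add_mono en vK2) simp
      also have "\<dots> = ennreal K4"
        using C K D0 unfolding K4_def by (simp add: ennreal_mult)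
      finally show "(\<integral>\<^sup>+x. ennreal ((pd b w x)\<^sup>2) \<partial>lborel) \<le> ennreal K4"
        by (rule order_trans[OF w(3)[OF b]])
    qed
  next
    case False
    then show ?thesis unfolding good_def by (intro exI[of _ "\<lambda>x. 0"]) (simp add: pd_const test_0)
  qed
  then obtain w where "\<And>n. good n (w n)" by metis
  then have w: "\<And>n. w n \<in> test_functions \<Omega>"
    and wv: "\<And>n. \<delta>s n < \<delta>2 \<Longrightarrow> (\<integral>\<^sup>+x. ennreal ((w n x - v n x)\<^sup>2) \<partial>lborel) \<le> ennreal (C * (K1' / D0) * (\<delta>s n)\<^sup>2)"
    and pw: "\<And>n b. b \<in> Basis \<Longrightarrow> (\<integral>\<^sup>+x. ennreal ((pd b (w n) x)\<^sup>2) \<partial>lborel) \<le> ennreal K4"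
    unfolding good_def by simp_all
  have wm: "w n \<in> borel_measurable borel" for n by (rule test_borel[OF w])
  have small: "\<forall>\<^sub>F n in sequentially. \<delta>s n < c" if "c > 0" for c
    using order_tendstoD(2)[OF \<delta>s(3) that] .
  have wv0: "(\<lambda>n. \<integral>\<^sup>+x. ennreal ((w n x - v n x)\<^sup>2) \<partial>lborel) \<longlonglongrightarrow> 0"
  proof -
    have "(\<lambda>n. C * (K1' / D0) * (\<delta>s n)\<^sup>2) \<longlonglongrightarrow> C * (K1' / D0) * 0\<^sup>2"
      by (intro tendsto_intros \<delta>s(3))
    then have lim: "(\<lambda>n. ennreal (C * (K1' / D0) * (\<delta>s n)\<^sup>2)) \<longlonglongrightarrow> 0"
      using C K D0 by (subst ennreal_tendsto_0_iff) auto
    have "\<forall>\<^sub>F n in sequentially. (\<integral>\<^sup>+x. ennreal ((w n x - v n x)\<^sup>2) \<partial>lborel) \<le> ennreal (C * (K1' / D0) * (\<delta>s n)\<^sup>2)"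
      using small[OF \<delta>2] by eventually_elim (rule wv)
    then show ?thesis
      by (rule tendsto_sandwich[OF always_eventually[OF allI[OF zero_le]] _ tendsto_const lim])
  qed
  have wI: "(\<integral>x. (pd b (w n) x)\<^sup>2 \<partial>lborel) \<le> K4" if "b \<in> Basis" for b n
    using pw[OF that, of n] test_integrable_square[OF test_pd[OF w[of n] that]] K4
    by (subst (asm) nn_integral_eq_integral) (auto simp: ennreal_le_iff)
  have dirichlet_eq: "dirichlet z = (\<Sum>b\<in>Basis. \<integral>x. (pd b z x)\<^sup>2 \<partial>lborel)" if "z \<in> test_functions \<Omega>" for z
    unfolding dirichlet_def
    by (rule Bochner_Integration.integral_sum) (rule test_integrable_square[OF test_pd[OF that]])
  have wD: "dirichlet (w n) \<le> ?d * K4" for n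
    unfolding dirichlet_eq[OF w] using sum_mono[of Basis "\<lambda>b. \<integral>x. (pd b (w n) x)\<^sup>2 \<partial>lborel" "\<lambda>_. K4"] wI by simp

  \<comment> \<open>The diagonal coefficient is cut off outside \<Omega>, where it is not
    controlled, so that it is bounded and measurable on the whole space.\<close>
  define a where "a x = indicator \<Omega> x * A x x" for x
  have am[measurable]: "a \<in> borel_measurable borel"
  proof -
    have "continuous_on \<Omega> (\<lambda>x. (\<lambda>(x, y). A x y) (x, x))"
      by (rule continuous_on_compose2[OF AE1])
        (use E1(2) closure_subset[of "E1 \<times> E1"] in \<open>auto intro!: continuous_intros\<close>)
    then have "(\<lambda>x. indicator \<Omega> x *\<^sub>R A x x) \<in> borel_measurable borel"
      by (intro borel_measurable_continuous_on_indicator) auto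
    then show ?thesis by (simp add: a_def[abs_def])
  qed
  have aR: "\<bar>a x\<bar> \<le> R" for x
    using Ab[of x x] E1(2) r R by (auto simp: a_def indicator_def)
  have ar: "r \<le> a x" if "x \<in> \<Omega>" for x using Ab[of x x] that E1(2) by (auto simp: a_def)

  have u0H: "u0 \<in> H10_space \<Omega>" using u0 by (simp add: local_weak_solution_def)
  obtain \<phi> M\<phi> where \<phi>: "\<And>n::nat. \<phi> n \<in> test_functions \<Omega>" and \<phi>D: "\<And>n. dirichlet (\<phi> n) \<le> M\<phi>"
    and \<phi>0: "(\<lambda>n. \<integral>\<^sup>+x. ennreal ((indicator \<Omega> x * (u0 x - \<phi> n x))\<^sup>2) \<partial>lborel) \<longlonglongrightarrow> 0"
    and \<phi>1: "\<And>b. b \<in> Basis \<Longrightarrow> (\<lambda>n. \<integral>\<^sup>+x. ennreal ((indicator \<Omega> x * (weak_gradient \<Omega> u0 x \<bullet> b - pd b (\<phi> n) x))\<^sup>2) \<partial>lborel) \<longlonglongrightarrow> 0"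
    using H10_approximation_bounded[OF dom(1,2) u0H] by blast
  have pdm: "pd b z \<in> borel_measurable borel" if "z \<in> test_functions \<Omega>" "b \<in> Basis" for b z
    by (rule test_borel[OF test_pd[OF that]])
  have fin2: "(\<integral>\<^sup>+x. ennreal ((z x)\<^sup>2) \<partial>lborel) < \<infinity>" if "z \<in> test_functions \<Omega>" for z
    using test_integrable_square[OF that] by (subst nn_integral_eq_integral) auto

  \<comment> \<open>The value f0(\<psi>) is the nonlocal form of u, hence nearly minus the pairing
    of v with the divergence of g. Exchanging v for w, integrating by parts and exchanging g for a
    grad \<psi> leads to the local energy of w.\<close>
  have weak_w: "(\<lambda>n. energy a (w n) \<psi>) \<longlonglongrightarrow> f0 \<psi>" if \<psi>: "\<psi> \<in> test_functions \<Omega>" for \<psi>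
  proof (rule LIMSEQ_I)
    fix e :: real assume e: "e > 0"
    \<comment> \<open>Collects the factors that multiply \<eta> in the consistency estimate and in
      the replacement of g; the summand 1 makes it positive.\<close>
    define KK where "KK = K1' + measure lborel E1 * ?d + (?d)\<^sup>2 * K3 + ?d * K4 + dirichlet \<psi> + 1"
    have KK: "KK > 0"
      using K K3 K4 dirichlet_nonneg[of \<psi>] unfolding KK_def by (intro add_nonneg_pos add_nonneg_nonneg) auto
    define \<eta> where "\<eta> = e / (2 * KK)"
    have \<eta>: "\<eta> > 0" using e KK by (simp add: \<eta>_def)
    have AR: "\<bar>A x x\<bar> \<le> R" if "x \<in> E1" for x using Ab[OF that that] r by simp
    define flux where "flux g d \<longleftrightarrow> d > 0 \<and> (\<forall>b\<in>Basis. g b \<in> test_functions \<Omega>) \<and>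
      (\<forall>b\<in>Basis. \<forall>x\<in>\<Omega>. \<bar>g b x - A x x * pd b \<psi> x\<bar> \<le> \<eta> * \<bar>pd b \<psi> x\<bar>) \<and>
      (\<forall>x\<in>E1. \<forall>y\<in>E1. norm (y - x) < d \<longrightarrow>
        \<bar>A x y * (\<psi> y - \<psi> x) - (\<Sum>b\<in>Basis. ((y - x) \<bullet> b) * g b x)\<bar> \<le> \<eta> * norm (y - x))" for g d
    have "\<exists>g d. flux g d"
      by (rule approximate_flux[OF E1(1) AE1 AR E1(2) \<psi> \<eta> R], assumption) (unfold flux_def, blast)
    then obtain g \<delta>3 where "flux g \<delta>3" by blast
    then have \<delta>3: "\<delta>3 > 0" and g: "\<And>b. b \<in> Basis \<Longrightarrow> g b \<in> test_functions \<Omega>"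
      and ga: "\<And>b x. b \<in> Basis \<Longrightarrow> x \<in> \<Omega> \<Longrightarrow> \<bar>g b x - A x x * pd b \<psi> x\<bar> \<le> \<eta> * \<bar>pd b \<psi> x\<bar>"
      and gA: "\<And>x y. x \<in> E1 \<Longrightarrow> y \<in> E1 \<Longrightarrow> norm (y - x) < \<delta>3 \<Longrightarrow>
        \<bar>A x y * (\<psi> y - \<psi> x) - (\<Sum>b\<in>Basis. ((y - x) \<bullet> b) * g b x)\<bar> \<le> \<eta> * norm (y - x)"
      by (simp_all add: flux_def)
    define okay where "okay b d \<longleftrightarrow> d > 0 \<and> (\<forall>x h. norm h < d \<longrightarrow>
      \<bar>g b (x + h) - g b x - (\<Sum>c\<in>Basis. (h \<bullet> c) * pd c (g b) x)\<bar> \<le> \<eta> * norm h)" for b d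
    have "\<exists>d. okay b d" if "b \<in> Basis" for b
      by (rule test_uniformly_differentiable[OF g[OF that] \<eta>]) (auto simp: okay_def)
    then obtain db where "\<And>b. b \<in> Basis \<Longrightarrow> okay b (db b)" by metis
    then have db: "\<And>b. b \<in> Basis \<Longrightarrow> db b > 0"
      "\<And>b x h. b \<in> Basis \<Longrightarrow> norm h < db b \<Longrightarrow> \<bar>g b (x + h) - g b x - (\<Sum>c\<in>Basis. (h \<bullet> c) * pd c (g b) x)\<bar> \<le> \<eta> * norm h"
      unfolding okay_def by simp_all
    define \<delta>4 where "\<delta>4 = min \<delta>3 (Min (db ` Basis))"
    have \<delta>4: "\<delta>4 > 0" "\<delta>4 \<le> \<delta>3" "\<And>b. b \<in> Basis \<Longrightarrow> \<delta>4 \<le> db b"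
      using \<delta>3 db(1) by (auto simp: \<delta>4_def min_le_iff_disj)
    \<comment> \<open>The cost of exchanging v for w. Unlike the other errors it is not proportional
      to \<eta>; it tends to 0 because g is fixed while w - v is null in L2.\<close>
    define T where "T n = (\<Sum>b\<in>Basis. \<integral>x. (w n x - v n x) * pd b (g b) x \<partial>lborel)" for n
    have "T \<longlonglongrightarrow> (\<Sum>b\<in>(Basis::'a set). 0)"
      unfolding T_def
    proof (intro tendsto_sum L2_null_pairing[OF _ _ wv0])
      fix b :: 'a assume b: "b \<in> Basis"
      show "pd b (g b) \<in> borel_measurable borel" by (rule pdm[OF g[OF b] b])
      show "(\<integral>\<^sup>+x. ennreal ((pd b (g b) x)\<^sup>2) \<partial>lborel) < \<infinity>" by (rule fin2[OF test_pd[OF g[OF b] b]])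
      show "(\<lambda>x. w n x - v n x) \<in> borel_measurable borel" for n using wm vm by measurable
    qed
    then have T0: "T \<longlonglongrightarrow> 0" by simp
    have bound: "\<bar>energy a (w n) \<psi> - f0 \<psi>\<bar> \<le> \<eta> * KK + \<bar>T n\<bar>" if n: "\<delta>s n < \<delta>4" for n
    proof -
      have E_le: "measure lborel (extended_domain \<Omega> (\<delta>s n)) \<le> measure lborel E1"
        using emeasure_bounded_finite[OF E1(1)]
        by (intro measure_mono_fmeasurable sub fmeasurableI) (use E1(3) extended_domain_borel[OF dom(1)] in auto)
      have "\<bar>nonlocal_form \<gamma>1 \<Omega> (\<delta>s n) A (u n) \<psi> + (\<Sum>b\<in>Basis. \<integral>x. v n x * pd b (g b) x \<partial>lborel)\<bar>
        \<le> \<eta> * (enn2real ((S_norm \<gamma>1 \<Omega> (\<delta>s n) (u n))\<^sup>2) + measure lborel (extended_domain \<Omega> (\<delta>s n)) * ?d)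
          + (?d)\<^sup>2 * \<eta> * (\<integral>x. \<bar>v n x\<bar> \<partial>lborel)"
      proof (rule bilinear_consistency[OF kernel dom(2,1,3) \<delta>s(1) An u(1) \<psi> g])
        show "\<bar>A x y * (\<psi> y - \<psi> x) - (\<Sum>b\<in>Basis. ((y - x) \<bullet> b) * g b x)\<bar> \<le> \<eta> * norm (y - x)"
          if "x \<in> extended_domain \<Omega> (\<delta>s n)" "y \<in> extended_domain \<Omega> (\<delta>s n)" "norm (y - x) < \<delta>s n" for x y
          using that sub n \<delta>4(2) by (intro gA) auto
        show "\<bar>g b (x + h) - g b x - (\<Sum>c\<in>Basis. (h \<bullet> c) * pd c (g b) x)\<bar> \<le> \<eta> * norm h"
          if "b \<in> Basis" "norm h < \<delta>s n" for b x h
          using that n \<delta>4(3)[OF that(1)] by (intro db(2)) auto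
        show "v n = (\<lambda>x. indicator \<Omega> x * u n x)" by (simp add: v_def)
      qed (use \<eta> in auto)
      also have "\<dots> \<le> \<eta> * (K1' + measure lborel E1 * ?d) + (?d)\<^sup>2 * \<eta> * K3"
        using uS[of n] E_le vK3[of n] \<eta> by (intro add_mono mult_left_mono mult_right_mono) auto
      finally have 1: "\<bar>f0 \<psi> + (\<Sum>b\<in>Basis. \<integral>x. v n x * pd b (g b) x \<partial>lborel)\<bar> \<le> \<eta> * (K1' + measure lborel E1 * ?d) + (?d)\<^sup>2 * \<eta> * K3"
        using u(2)[OF \<psi>] by simp
      have iv: "integrable lborel (\<lambda>x. v n x * pd b (g b) x)" if "b \<in> Basis" for b
        using corr_integrable[OF test_pd[OF g[OF that] that] vi[of n], of 0] by simp
      have iw: "integrable lborel (\<lambda>x. w n x * pd b (g b) x)" if "b \<in> Basis" for b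
        by (rule test_integrable_mult[OF test_smooth[OF w] test_pd[OF g[OF that] that]])
      have 2: "T n = (\<Sum>b\<in>Basis. \<integral>x. w n x * pd b (g b) x \<partial>lborel) - (\<Sum>b\<in>Basis. \<integral>x. v n x * pd b (g b) x \<partial>lborel)"
        unfolding T_def sum_subtractf[symmetric] using iv iw by (intro sum.cong) (auto simp: left_diff_distrib)
      have 3: "(\<Sum>b\<in>Basis. \<integral>x. w n x * pd b (g b) x \<partial>lborel) = - (\<Sum>b\<in>Basis. \<integral>x. pd b (w n) x * g b x \<partial>lborel)"
        unfolding sum_negf[symmetric] using g by (intro sum.cong integration_by_parts[OF test_smooth[OF w]]) auto
      have ig: "integrable lborel (\<lambda>x. pd b (w n) x * g b x)" if "b \<in> Basis" for b
        by (rule test_integrable_mult[OF smooth_pd[OF test_smooth[OF w] that] g[OF that]])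
      have ia: "integrable lborel (\<lambda>x. (pd b (w n) x * pd b \<psi> x) * a x)" if "b \<in> Basis" for b
        by (rule integrable_mult_bounded[OF test_integrable_mult[OF smooth_pd[OF test_smooth[OF w] that] test_pd[OF \<psi> that]] am aR])
      have "(\<Sum>b\<in>Basis. \<integral>x. pd b (w n) x * g b x \<partial>lborel) - energy a (w n) \<psi>
          = (\<Sum>b\<in>Basis. (\<integral>x. pd b (w n) x * g b x \<partial>lborel) - (\<integral>x. (pd b (w n) x * pd b \<psi> x) * a x \<partial>lborel))"
        unfolding energy_def sum_distrib_right using ia
        by (simp add: Bochner_Integration.integral_sum sum_subtractf)
      also have "\<bar>\<dots>\<bar> \<le> (\<Sum>b\<in>Basis. \<eta> * ((\<integral>x. (pd b (w n) x)\<^sup>2 \<partial>lborel) + (\<integral>x. (pd b \<psi> x)\<^sup>2 \<partial>lborel)))"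
      proof (rule order_trans[OF sum_abs sum_mono])
        fix b :: 'a assume b: "b \<in> Basis"
        have i2: "integrable lborel (\<lambda>x. (pd b (w n) x)\<^sup>2)" "integrable lborel (\<lambda>x. (pd b \<psi> x)\<^sup>2)"
          using test_integrable_square test_pd w \<psi> b by blast+
        have "(\<integral>x. pd b (w n) x * g b x \<partial>lborel) - (\<integral>x. (pd b (w n) x * pd b \<psi> x) * a x \<partial>lborel)
            = (\<integral>x. pd b (w n) x * g b x - (pd b (w n) x * pd b \<psi> x) * a x \<partial>lborel)"
          using ig[OF b] ia[OF b] by simp
        also have "\<bar>\<dots>\<bar> \<le> (\<integral>x. \<eta> * ((pd b (w n) x)\<^sup>2 + (pd b \<psi> x)\<^sup>2) \<partial>lborel)"
        proof (rule order_trans[OF integral_abs_bound integral_mono])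
          fix x
          show "\<bar>pd b (w n) x * g b x - (pd b (w n) x * pd b \<psi> x) * a x\<bar> \<le> \<eta> * ((pd b (w n) x)\<^sup>2 + (pd b \<psi> x)\<^sup>2)"
          proof (cases "x \<in> \<Omega>")
            case True
            have "pd b (w n) x * g b x - (pd b (w n) x * pd b \<psi> x) * a x = pd b (w n) x * (g b x - A x x * pd b \<psi> x)"
              using True by (simp add: a_def algebra_simps)
            also have "\<bar>\<dots>\<bar> \<le> \<bar>pd b (w n) x\<bar> * (\<eta> * \<bar>pd b \<psi> x\<bar>)"
              unfolding abs_mult by (intro mult_left_mono ga b True) simp
            also have "\<dots> = \<eta> * (\<bar>pd b (w n) x\<bar> * \<bar>pd b \<psi> x\<bar>)" by simp
            also have "\<dots> \<le> \<eta> * ((pd b (w n) x)\<^sup>2 + (pd b \<psi> x)\<^sup>2)"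
            proof (rule mult_left_mono)
              have "2 * (\<bar>pd b (w n) x\<bar> * \<bar>pd b \<psi> x\<bar>) \<le> (pd b (w n) x)\<^sup>2 + (pd b \<psi> x)\<^sup>2"
                using zero_le_power2[of "\<bar>pd b (w n) x\<bar> - \<bar>pd b \<psi> x\<bar>"] by (simp add: power2_diff)
              moreover have "0 \<le> \<bar>pd b (w n) x\<bar> * \<bar>pd b \<psi> x\<bar>" by simp
              ultimately show "\<bar>pd b (w n) x\<bar> * \<bar>pd b \<psi> x\<bar> \<le> (pd b (w n) x)\<^sup>2 + (pd b \<psi> x)\<^sup>2" by linarith
            qed (use \<eta> in simp)
            finally show ?thesis .
          next
            case False
            then show ?thesis using test_pd_zero[OF w] \<eta> by simp
          qed
        qed (use ig[OF b] ia[OF b] i2 in auto)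
        also have "\<dots> = \<eta> * ((\<integral>x. (pd b (w n) x)\<^sup>2 \<partial>lborel) + (\<integral>x. (pd b \<psi> x)\<^sup>2 \<partial>lborel))"
          using i2 by simp
        finally show "\<bar>(\<integral>x. pd b (w n) x * g b x \<partial>lborel) - (\<integral>x. (pd b (w n) x * pd b \<psi> x) * a x \<partial>lborel)\<bar>
            \<le> \<eta> * ((\<integral>x. (pd b (w n) x)\<^sup>2 \<partial>lborel) + (\<integral>x. (pd b \<psi> x)\<^sup>2 \<partial>lborel))" .
      qed
      also have "\<dots> = \<eta> * (dirichlet (w n) + dirichlet \<psi>)"
        unfolding dirichlet_eq[OF w] dirichlet_eq[OF \<psi>] by (simp add: sum_distrib_left[symmetric] sum.distrib)
      also have "\<dots> \<le> \<eta> * (?d * K4 + dirichlet \<psi>)" using wD[of n] \<eta> by simp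
      finally have 4: "\<bar>(\<Sum>b\<in>Basis. \<integral>x. pd b (w n) x * g b x \<partial>lborel) - energy a (w n) \<psi>\<bar> \<le> \<eta> * (?d * K4 + dirichlet \<psi>)" .
      have 5: "\<eta> * (K1' + measure lborel E1 * ?d) + (?d)\<^sup>2 * \<eta> * K3 + \<eta> * (?d * K4 + dirichlet \<psi>) \<le> \<eta> * KK"
        unfolding KK_def using \<eta> by (simp add: algebra_simps)
      show ?thesis using 1 2 3 4 5 by linarith
    qed
    have "\<forall>\<^sub>F n in sequentially. \<bar>T n\<bar> < e / 2"
      using order_tendstoD(2)[OF tendsto_rabs_zero[OF T0], of "e / 2"] e by simp
    with small[OF \<delta>4(1)] have "\<forall>\<^sub>F n in sequentially. norm (energy a (w n) \<psi> - f0 \<psi>) < e"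
    proof eventually_elim
      case (elim n)
      have "\<eta> * KK = e / 2" using KK by (simp add: \<eta>_def)
      then show ?case using bound[OF elim(1)] elim(2) by simp
    qed
    then show "\<exists>N. \<forall>n\<ge>N. norm (energy a (w n) \<psi> - f0 \<psi>) < e" by (simp add: eventually_sequentially)
  qed

  have u0H1: "u0 \<in> H1_space \<Omega>" using u0H by (simp add: H10_space_def)
  then have wgL: "(\<lambda>x. weak_gradient \<Omega> u0 x \<bullet> b) \<in> L2_space \<Omega>" if "b \<in> Basis" for b
    using is_weak_gradient_weak_gradient[OF dom(1,2)] that by (auto simp: is_weak_gradient_def L2_space_vec_iff)
  have weak_\<phi>: "(\<lambda>n. energy a (\<phi> n) \<psi>) \<longlonglongrightarrow> f0 \<psi>" if \<psi>: "\<psi> \<in> test_functions \<Omega>" for \<psi>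
  proof -
    define W where "W b x = indicator \<Omega> x * (weak_gradient \<Omega> u0 x \<bullet> b)" for b x
    have Wm: "W b \<in> borel_measurable borel" if "b \<in> Basis" for b
      using wgL[OF that] by (simp add: L2_space_iff W_def[abs_def])
    have f0eq: "f0 \<psi> = (\<integral>x. (\<Sum>b\<in>Basis. (W b x * pd b \<psi> x) * a x) \<partial>lborel)"
    proof -
      have "f0 \<psi> = (LINT x:\<Omega>|lborel. A x x * (weak_gradient \<Omega> u0 x \<bullet> weak_gradient \<Omega> \<psi> x))"
        using u0 test_in_H10[OF dom(1,2) \<psi>] by (simp add: local_weak_solution_def)
      also have "\<dots> = (LINT x:\<Omega>|lborel. A x x * (weak_gradient \<Omega> u0 x \<bullet> grad \<psi> x))"
      proof -
        have g2: "(\<lambda>x. indicator \<Omega> x *\<^sub>R g x) \<in> borel_measurable borel" if "g \<in> L2_space \<Omega>" for g :: "'a \<Rightarrow> 'a"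
          using that by (simp add: L2_space_def set_borel_measurable_def)
        have wgu: "weak_gradient \<Omega> u0 \<in> L2_space \<Omega>"
          using is_weak_gradient_weak_gradient[OF dom(1,2) u0H1] by (simp add: is_weak_gradient_def)
        \<comment> \<open>\<open>integral_cong_AE\<close> requires both integrands to be measurable.
          The coefficient and the gradients are controlled on \<Omega> only, so each factor carries
          the indicator.\<close>
        have m: "(\<lambda>x. indicator \<Omega> x *\<^sub>R (A x x * (weak_gradient \<Omega> u0 x \<bullet> g x))) \<in> borel_measurable lborel"
          if "g \<in> L2_space \<Omega>" for g
        proof -
          have "(\<lambda>x. a x * ((indicator \<Omega> x *\<^sub>R weak_gradient \<Omega> u0 x) \<bullet> (indicator \<Omega> x *\<^sub>R g x))) \<in> borel_measurable borel"
            using g2[OF wgu] g2[OF that] am by measurable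
          also have "(\<lambda>x. a x * ((indicator \<Omega> x *\<^sub>R weak_gradient \<Omega> u0 x) \<bullet> (indicator \<Omega> x *\<^sub>R g x))) =
              (\<lambda>x. indicator \<Omega> x *\<^sub>R (A x x * (weak_gradient \<Omega> u0 x \<bullet> g x)))"
            by (auto simp: a_def indicator_def)
          finally show ?thesis by simp
        qed
        have gL: "grad \<psi> \<in> L2_space \<Omega>" using is_weak_gradient_test[OF \<psi>] by (simp add: is_weak_gradient_def)
        have wL: "weak_gradient \<Omega> \<psi> \<in> L2_space \<Omega>"
          using is_weak_gradient_weak_gradient[OF dom(1,2) test_in_H1[OF dom(1,2) \<psi>]] by (simp add: is_weak_gradient_def)
        have "AE x in lborel. indicator \<Omega> x *\<^sub>R (A x x * (weak_gradient \<Omega> u0 x \<bullet> weak_gradient \<Omega> \<psi> x)) =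
            indicator \<Omega> x *\<^sub>R (A x x * (weak_gradient \<Omega> u0 x \<bullet> grad \<psi> x))"
          using weak_gradient_test[OF dom(1,2) \<psi>] by eventually_elim (auto simp: indicator_def)
        then show ?thesis
          unfolding set_lebesgue_integral_def by (rule integral_cong_AE[OF m[OF wL] m[OF gL]])
      qed
      also have "\<dots> = (\<integral>x. (\<Sum>b\<in>Basis. (W b x * pd b \<psi> x) * a x) \<partial>lborel)"
        unfolding set_lebesgue_integral_def
        by (intro Bochner_Integration.integral_cong refl)
          (auto simp: W_def a_def indicator_def grad_def inner_sum_right sum_distrib_left mult_ac)
      finally show ?thesis .
    qed
    have iW: "integrable lborel (\<lambda>x. (W b x * pd b \<psi> x) * a x)" if "b \<in> Basis" for b
      using L2_mult_test_integrable[OF dom(1,2) wgL[OF that] test_pd[OF \<psi> that]] am aR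
      unfolding W_def by (rule integrable_mult_bounded)
    have i\<phi>: "integrable lborel (\<lambda>x. (pd b (\<phi> n) x * pd b \<psi> x) * a x)" if "b \<in> Basis" for b n
      by (rule integrable_mult_bounded[OF test_integrable_mult[OF smooth_pd[OF test_smooth[OF \<phi>] that] test_pd[OF \<psi> that]] am aR])
    have eq: "energy a (\<phi> n) \<psi> = f0 \<psi> - (\<Sum>b\<in>Basis. \<integral>x. (W b x - pd b (\<phi> n) x) * (pd b \<psi> x * a x) \<partial>lborel)" for n
    proof -
      have "(\<Sum>b\<in>Basis. \<integral>x. (W b x - pd b (\<phi> n) x) * (pd b \<psi> x * a x) \<partial>lborel)
          = (\<Sum>b\<in>Basis. (\<integral>x. (W b x * pd b \<psi> x) * a x \<partial>lborel) - (\<integral>x. (pd b (\<phi> n) x * pd b \<psi> x) * a x \<partial>lborel))"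
        using iW i\<phi> by (intro sum.cong refl) (simp add: left_diff_distrib mult.assoc)
      also have "\<dots> = f0 \<psi> - energy a (\<phi> n) \<psi>"
        unfolding f0eq energy_def sum_distrib_right using iW i\<phi>
        by (simp add: Bochner_Integration.integral_sum sum_subtractf)
      finally show ?thesis by simp
    qed
    have "(\<lambda>n. \<Sum>b\<in>Basis. \<integral>x. (W b x - pd b (\<phi> n) x) * (pd b \<psi> x * a x) \<partial>lborel) \<longlonglongrightarrow> (\<Sum>b\<in>(Basis::'a set). 0)"
    proof (intro tendsto_sum L2_null_pairing)
      fix b :: 'a assume b: "b \<in> Basis"
      have pm: "pd b \<psi> \<in> borel_measurable borel" by (rule pdm[OF \<psi> b])
      show "(\<lambda>x. W b x - pd b (\<phi> n) x) \<in> borel_measurable borel" for n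
        using Wm[OF b] pdm[OF \<phi> b] by measurable
      show "(\<lambda>x. pd b \<psi> x * a x) \<in> borel_measurable borel" using pm am by measurable
      have "(\<integral>\<^sup>+x. ennreal ((pd b \<psi> x * a x)\<^sup>2) \<partial>lborel) \<le> (\<integral>\<^sup>+x. ennreal (R\<^sup>2) * ennreal ((pd b \<psi> x)\<^sup>2) \<partial>lborel)"
      proof (rule nn_integral_mono)
        fix x
        have "(a x)\<^sup>2 \<le> R\<^sup>2" using aR[of x] R by (simp add: abs_le_square_iff[symmetric])
        then have "(pd b \<psi> x * a x)\<^sup>2 \<le> R\<^sup>2 * (pd b \<psi> x)\<^sup>2"
          unfolding power_mult_distrib mult.commute[of "(pd b \<psi> x)\<^sup>2"] by (rule mult_right_mono) simp
        then show "ennreal ((pd b \<psi> x * a x)\<^sup>2) \<le> ennreal (R\<^sup>2) * ennreal ((pd b \<psi> x)\<^sup>2)"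
          by (simp add: ennreal_mult[symmetric] ennreal_leI)
      qed
      also have "\<dots> < \<infinity>"
        using pm fin2[OF test_pd[OF \<psi> b]] by (subst nn_integral_cmult) (auto simp: ennreal_mult_less_top)
      finally show "(\<integral>\<^sup>+x. ennreal ((pd b \<psi> x * a x)\<^sup>2) \<partial>lborel) < \<infinity>" .
      have "(W b x - pd b (\<phi> n) x)\<^sup>2 = (indicator \<Omega> x * (weak_gradient \<Omega> u0 x \<bullet> b - pd b (\<phi> n) x))\<^sup>2" for n x
        using test_pd_zero[OF \<phi>[of n], of x b] by (cases "x \<in> \<Omega>") (auto simp: W_def)
      then show "(\<lambda>n. \<integral>\<^sup>+x. ennreal ((W b x - pd b (\<phi> n) x)\<^sup>2) \<partial>lborel) \<longlonglongrightarrow> 0"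
        using \<phi>1[OF b] by simp
    qed
    then have "(\<lambda>n. f0 \<psi> - (\<Sum>b\<in>Basis. \<integral>x. (W b x - pd b (\<phi> n) x) * (pd b \<psi> x * a x) \<partial>lborel)) \<longlonglongrightarrow> f0 \<psi> - 0"
      by (intro tendsto_diff tendsto_const) simp
    then show ?thesis unfolding eq by simp
  qed

  \<comment> \<open>The difference of w and \<phi>, written with the factor -1 to fit the additivity
    lemma for \<open>energy\<close>.\<close>
  define z where "z n = (\<lambda>x. w n x + (-1) * \<phi> n x)" for n
  have zt: "z n \<in> test_functions \<Omega>" for n unfolding z_def by (intro test_add test_cmult w \<phi>)
  have zD: "dirichlet (z n) \<le> 2 * (?d * K4) + 2 * M\<phi>" for n
  proof -
    have "dirichlet (z n) \<le> (\<integral>x. 2 * (\<Sum>b\<in>Basis. (pd b (w n) x)\<^sup>2) + 2 * (\<Sum>b\<in>Basis. (pd b (\<phi> n) x)\<^sup>2) \<partial>lborel)"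
      unfolding dirichlet_def
    proof (rule integral_mono)
      fix x
      have p: "pd b (z n) x = pd b (w n) x - pd b (\<phi> n) x" for b
        unfolding z_def using pd_diff[OF test_smooth[OF w[of n]] test_smooth[OF \<phi>[of n]], of b x] by simp
      have "(pd b (z n) x)\<^sup>2 \<le> 2 * (pd b (w n) x)\<^sup>2 + 2 * (pd b (\<phi> n) x)\<^sup>2" for b
        unfolding p using zero_le_power2[of "pd b (w n) x + pd b (\<phi> n) x"] by (simp add: power2_eq_square algebra_simps)
      then show "(\<Sum>b\<in>Basis. (pd b (z n) x)\<^sup>2) \<le> 2 * (\<Sum>b\<in>Basis. (pd b (w n) x)\<^sup>2) + 2 * (\<Sum>b\<in>Basis. (pd b (\<phi> n) x)\<^sup>2)"
        unfolding sum_distrib_left sum.distrib[symmetric] by (intro sum_mono)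
    qed (use dirichlet_integrable[OF zt] dirichlet_integrable[OF w] dirichlet_integrable[OF \<phi>] in auto)
    also have "\<dots> = 2 * dirichlet (w n) + 2 * dirichlet (\<phi> n)"
      using dirichlet_integrable[OF w] dirichlet_integrable[OF \<phi>] by (simp add: dirichlet_def)
    finally show ?thesis using wD[of n] \<phi>D[of n] by linarith
  qed
  have weak_z: "(\<lambda>n. energy a (z n) \<psi>) \<longlonglongrightarrow> 0" if \<psi>: "\<psi> \<in> test_functions \<Omega>" for \<psi>
  proof -
    have "energy a (z n) \<psi> = energy a (w n) \<psi> - energy a (\<phi> n) \<psi>" for n
      unfolding z_def energy_add[OF am aR w \<phi> \<psi>] by simp
    then show ?thesis using tendsto_diff[OF weak_w[OF \<psi>] weak_\<phi>[OF \<psi>]] by simp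
  qed
  have "(\<lambda>n. \<integral>x. (z n x)\<^sup>2 \<partial>lborel) \<longlonglongrightarrow> 0"
    by (rule weakly_null_imp_strongly_null[OF dom(2) am aR ar r zt zD weak_z])
  then have z0: "(\<lambda>n. \<integral>\<^sup>+x. ennreal ((z n x)\<^sup>2) \<partial>lborel) \<longlonglongrightarrow> 0"
    using test_integrable_square[OF zt] by (simp add: nn_integral_eq_integral ennreal_tendsto_0_iff)
  have u0m: "(\<lambda>x. indicator \<Omega> x * u0 x) \<in> borel_measurable borel"
    using u0H1 by (auto simp: H1_space_def L2_space_iff)
  have u0e: "(\<lambda>x. indicator \<Omega> x * (u0 x - \<phi> n x)) \<in> borel_measurable borel" for n
    using u0m test_borel[OF \<phi>[of n]] by (simp add: right_diff_distrib)
  have wv0': "(\<lambda>n. \<integral>\<^sup>+x. ennreal ((v n x - w n x)\<^sup>2) \<partial>lborel) \<longlonglongrightarrow> 0"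
    using wv0 by (simp add: power2_commute)
  \<comment> \<open>The target is reached from v - u0 = (v - w) + (w - \<phi>) - (u0 - \<phi>):
    regularisation error, weakly null part, and approximation error of u0, all three null in
    L2.\<close>
  have s1: "(\<lambda>n. \<integral>\<^sup>+x. ennreal (((v n x - w n x) + z n x)\<^sup>2) \<partial>lborel) \<longlonglongrightarrow> 0"
    by (rule tendsto_two_sum_0[OF wv0' z0]) (intro nn_integral_power2_add_le borel_measurable_diff vm wm test_borel[OF zt])
  have \<phi>0': "(\<lambda>n. \<integral>\<^sup>+x. ennreal ((- (indicator \<Omega> x * (u0 x - \<phi> n x)))\<^sup>2) \<partial>lborel) \<longlonglongrightarrow> 0"
    using \<phi>0 by simp
  have s2: "(\<lambda>n. \<integral>\<^sup>+x. ennreal ((((v n x - w n x) + z n x) + - (indicator \<Omega> x * (u0 x - \<phi> n x)))\<^sup>2) \<partial>lborel) \<longlonglongrightarrow> 0"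
    by (rule tendsto_two_sum_0[OF s1 \<phi>0'])
      (intro nn_integral_power2_add_le borel_measurable_add borel_measurable_diff borel_measurable_uminus vm wm test_borel[OF zt] u0e)
  have "((v n x - w n x) + z n x) + - (indicator \<Omega> x * (u0 x - \<phi> n x)) = indicator \<Omega> x * (u n x - u0 x)" for n x
    using test_zero[OF \<phi>[of n], of x] by (cases "x \<in> \<Omega>") (auto simp: z_def v_def)
  then show ?thesis using s2 by simp
qed

text \<open>No measurability of the integrands is needed: \<open>nn_integral\<close> is a lower integral, so
  measurable minorants can be used in their place.\<close>

lemma nn_integral_dominated_null:
  fixes F :: "nat \<Rightarrow> 'b \<Rightarrow> ennreal"
  assumes w: "w \<in> borel_measurable M" "(\<integral>\<^sup>+x. w x \<partial>M) < \<infinity>"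
    and F: "\<And>n x. F n x \<le> w x" "\<And>x. (\<lambda>n. F n x) \<longlonglongrightarrow> 0"
  shows "(\<lambda>n. \<integral>\<^sup>+x. F n x \<partial>M) \<longlonglongrightarrow> 0"
proof (rule order_tendstoI)
  fix a :: ennreal assume "0 < a"
  then obtain c where c: "0 < c" "c < a" using dense by blast
  \<comment> \<open>Strictness is what makes this work: if the lower integral of F exceeds c, so
    does that of some simple minorant. The minorants are measurable, and dominated convergence keeps
    their integrals below c eventually.\<close>
  have "\<exists>g. simple_function M g \<and> g \<le> F n \<and> (c < (\<integral>\<^sup>+x. F n x \<partial>M) \<longrightarrow> c < (\<integral>\<^sup>+x. g x \<partial>M))" for n
  proof (cases "c < (\<integral>\<^sup>+x. F n x \<partial>M)")
    case True
    then obtain g where "simple_function M g" "g \<le> F n" "c < integral\<^sup>S M g"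
      unfolding nn_integral_def by (auto simp: less_SUP_iff)
    then show ?thesis by (intro exI[of _ g]) (simp add: nn_integral_eq_simple_integral)
  next
    case False
    then show ?thesis by (intro exI[of _ "\<lambda>_. 0"]) (simp add: le_fun_def)
  qed
  then obtain g where g: "\<And>n. simple_function M (g n)" "\<And>n. g n \<le> F n"
    "\<And>n. c < (\<integral>\<^sup>+x. F n x \<partial>M) \<Longrightarrow> c < (\<integral>\<^sup>+x. g n x \<partial>M)"
    by metis
  have gF: "g n x \<le> F n x" for n x using g(2) by (simp add: le_fun_def)
  have "(\<lambda>n. \<integral>\<^sup>+x. g n x \<partial>M) \<longlonglongrightarrow> (\<integral>\<^sup>+x. 0 \<partial>M)"
  proof (rule nn_integral_dominated_convergence[where w=w])
    show "AE x in M. g n x \<le> w x" for n using gF F(1) order_trans by blast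
    show "AE x in M. (\<lambda>n. g n x) \<longlonglongrightarrow> 0"
    proof (rule AE_I2)
      fix x
      show "(\<lambda>n. g n x) \<longlonglongrightarrow> 0"
        by (rule tendsto_sandwich[OF always_eventually[OF allI[OF zero_le]] always_eventually[OF allI[OF gF]] tendsto_const F(2)])
    qed
  qed (use w g(1) in \<open>auto intro: borel_measurable_simple_function\<close>)
  then have "\<forall>\<^sub>F n in sequentially. (\<integral>\<^sup>+x. g n x \<partial>M) < c"
    using order_tendstoD(2) c(1) by fastforce
  then show "\<forall>\<^sub>F n in sequentially. (\<integral>\<^sup>+x. F n x \<partial>M) < a"
  proof eventually_elim
    case (elim n)
    then have "(\<integral>\<^sup>+x. F n x \<partial>M) \<le> c" using g(3)[of n] by (meson less_asym not_less)
    then show ?case using c(2) by simp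
  qed
qed simp

section \<open>Uniform bounds and integration over the parameter\<close>

theorem corollary2p3:
  fixes \<Omega> :: "'a::euclidean_space set"
    and \<rho> :: "real ^ 'm \<Rightarrow> real"
    and D0 s \<delta>0 r R :: real
    and \<gamma>1 :: "real \<Rightarrow> real"
    and A :: "'a \<Rightarrow> 'a \<Rightarrow> real ^ 'm \<Rightarrow> real"
    and f :: "real \<Rightarrow> ('a \<Rightarrow> real) \<Rightarrow> real"
    and f0 :: "('a \<Rightarrow> real) \<Rightarrow> real"
    and u :: "real \<Rightarrow> real ^ 'm \<Rightarrow> 'a \<Rightarrow> real"
    and u0 :: "real ^ 'm \<Rightarrow> 'a \<Rightarrow> real"
  assumes domain: "bounded \<Omega>" "lipschitz_domain \<Omega>"
    and density: "\<forall>\<xi>\<in>param_space. 0 \<le> \<rho> \<xi>"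
      "set_borel_measurable lborel param_space \<rho>"
      "(\<integral>\<^sup>+\<xi>\<in>param_space. ennreal (\<rho> \<xi>) \<partial>lborel) = 1"
    and kernel: "nonlocal_kernel TYPE('a) D0 s \<gamma>1"
    and poincare: "0 < \<delta>0"
      "\<exists>C::real. \<forall>\<delta>\<in>{0<..<\<delta>0}. \<forall>v\<in>S_space \<gamma>1 \<Omega> \<delta>.
         (L2_norm_on \<Omega> v)\<^sup>2 \<le> ennreal C * (S_norm \<gamma>1 \<Omega> \<delta> v)\<^sup>2"
    and A_measurable: "\<forall>\<delta>\<in>{0<..<\<delta>0}. set_borel_measurable lborel
         (extended_domain \<Omega> \<delta> \<times> extended_domain \<Omega> \<delta> \<times> param_space) (\<lambda>(x, y, \<xi>). A x y \<xi>)"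
    and A_symmetric: "\<forall>\<delta>\<in>{0<..<\<delta>0}. \<forall>x\<in>extended_domain \<Omega> \<delta>. \<forall>y\<in>extended_domain \<Omega> \<delta>.
         \<forall>\<xi>\<in>param_space. A x y \<xi> = A y x \<xi>"
    and A_bounds: "0 < r"
      "\<forall>\<delta>\<in>{0<..<\<delta>0}. \<forall>x\<in>extended_domain \<Omega> \<delta>. \<forall>y\<in>extended_domain \<Omega> \<delta>.
         \<forall>\<xi>\<in>param_space. r \<le> A x y \<xi> \<and> A x y \<xi> \<le> R"
    and A_continuous: "\<forall>\<delta>\<in>{0<..<\<delta>0}. \<forall>\<xi>\<in>param_space.
         continuous_on (closure (extended_domain \<Omega> \<delta> \<times> extended_domain \<Omega> \<delta>)) (\<lambda>(x, y). A x y \<xi>)"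
    and f_linear: "\<forall>\<delta>\<in>{0<..<\<delta>0}. linear_functional_on (S_space \<gamma>1 \<Omega> \<delta>) (f \<delta>)"
    and f_bounded: "\<exists>M::real. \<forall>\<delta>\<in>{0<..<\<delta>0}.
         dual_norm (S_space \<gamma>1 \<Omega> \<delta>) (S_norm \<gamma>1 \<Omega> \<delta>) (f \<delta>) \<le> ennreal M"
    and f0_dual: "linear_functional_on (H10_space \<Omega>) f0"
      "dual_norm (H10_space \<Omega>) (H1_norm \<Omega>) f0 < \<infinity>"
    and f_consistent: "\<forall>\<delta>\<in>{0<..<\<delta>0}. \<forall>\<phi>\<in>test_functions \<Omega>. f \<delta> \<phi> = f0 \<phi>"
    and nonlocal_solution: "\<forall>\<delta>\<in>{0<..<\<delta>0}. \<forall>\<xi>\<in>param_space.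
         nonlocal_weak_solution \<gamma>1 \<Omega> \<delta> (\<lambda>x y. A x y \<xi>) (f \<delta>) (u \<delta> \<xi>)"
    and local_solution: "\<forall>\<xi>\<in>param_space.
         local_weak_solution \<Omega> (\<lambda>x. A x x \<xi>) f0 (u0 \<xi>)"
  shows "((\<lambda>\<delta>. L2_tensor_norm \<Omega> \<rho> (\<lambda>\<xi> x. u \<delta> \<xi> x - u0 \<xi> x)) \<longlongrightarrow> 0) (at_right 0)"
proof -
  have dom: "open \<Omega>" "bounded \<Omega>" "\<Omega> \<noteq> {}" using domain by (auto simp: lipschitz_domain_def)
  obtain C where "\<forall>\<delta>\<in>{0<..<\<delta>0}. \<forall>v\<in>S_space \<gamma>1 \<Omega> \<delta>.
      (L2_norm_on \<Omega> v)\<^sup>2 \<le> ennreal C * (S_norm \<gamma>1 \<Omega> \<delta> v)\<^sup>2"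
    using poincare(2) by blast
  then have C: "\<And>\<delta> v. 0 < \<delta> \<Longrightarrow> \<delta> < \<delta>0 \<Longrightarrow> v \<in> S_space \<gamma>1 \<Omega> \<delta> \<Longrightarrow>
      (L2_norm_on \<Omega> v)\<^sup>2 \<le> ennreal C * (S_norm \<gamma>1 \<Omega> \<delta> v)\<^sup>2"
    by simp
  obtain M where "\<forall>\<delta>\<in>{0<..<\<delta>0}.
      dual_norm (S_space \<gamma>1 \<Omega> \<delta>) (S_norm \<gamma>1 \<Omega> \<delta>) (f \<delta>) \<le> ennreal M"
    using f_bounded by blast
  then have M: "\<And>\<delta>. 0 < \<delta> \<Longrightarrow> \<delta> < \<delta>0 \<Longrightarrow>
      dual_norm (S_space \<gamma>1 \<Omega> \<delta>) (S_norm \<gamma>1 \<Omega> \<delta>) (f \<delta>) \<le> ennreal M"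
    by simp
  \<comment> \<open>Testing the equation with its own solution gives r n^2 \<le> max(M, 0) n for the
    energy norm n, hence n \<le> max(M, 0) / r; squaring gives K1. The Poincare constant turns it
    into the L2 bound K2. The maxima with 0 match the truncation performed by
    \<open>ennreal\<close>.\<close>
  define K1 where "K1 = (max M 0 / r)\<^sup>2"
  define K2 where "K2 = max C 0 * K1"
  have K: "K1 \<ge> 0" "K2 \<ge> 0" by (auto simp: K1_def K2_def)
  have uS: "u \<delta> \<xi> \<in> S_space \<gamma>1 \<Omega> \<delta>"
    and ueq: "\<And>v. v \<in> S_space \<gamma>1 \<Omega> \<delta> \<Longrightarrow> nonlocal_form \<gamma>1 \<Omega> \<delta> (\<lambda>x y. A x y \<xi>) (u \<delta> \<xi>) v = f \<delta> v"
    if "0 < \<delta>" "\<delta> < \<delta>0" "\<xi> \<in> param_space" for \<delta> \<xi>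
    using nonlocal_solution that by (auto simp: nonlocal_weak_solution_def nonlocal_form_def)
  have SK1: "enn2real ((S_norm \<gamma>1 \<Omega> \<delta> (u \<delta> \<xi>))\<^sup>2) \<le> K1" if \<delta>: "0 < \<delta>" "\<delta> < \<delta>0" and \<xi>: "\<xi> \<in> param_space" for \<delta> \<xi>
  proof -
    define n where "n = enn2real (S_norm \<gamma>1 \<Omega> \<delta> (u \<delta> \<xi>))"
    have n0: "n \<ge> 0" by (simp add: n_def)
    have n: "enn2real ((S_norm \<gamma>1 \<Omega> \<delta> (u \<delta> \<xi>))\<^sup>2) = n\<^sup>2"
      by (simp add: n_def power2_eq_square enn2real_mult)
    have co: "r * n\<^sup>2 \<le> nonlocal_form \<gamma>1 \<Omega> \<delta> (\<lambda>x y. A x y \<xi>) (u \<delta> \<xi>) (u \<delta> \<xi>)"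
      unfolding n[symmetric]
      by (rule coercive[OF kernel dom(2,1,3) \<delta>(1) _ uS[OF \<delta> \<xi>] A_bounds(1), where R=R])
        (use A_continuous A_bounds(2) \<delta> \<xi> in auto)
    also have "\<dots> = f \<delta> (u \<delta> \<xi>)" by (rule ueq[OF \<delta> \<xi> uS[OF \<delta> \<xi>]])
    also have "\<dots> \<le> max M 0 * n"
      using dual_norm_bound[OF kernel dom(2,1,3) \<delta>(1) _ M[OF \<delta>] uS[OF \<delta> \<xi>]] f_linear \<delta>
      by (simp add: n_def abs_le_iff)
    finally have "n * (r * n) \<le> n * max M 0" by (simp add: power2_eq_square mult_ac)
    then have "r * n \<le> max M 0" using n0 by (cases "n = 0") (auto dest: mult_left_le_imp_le)
    then have "n \<le> max M 0 / r" using A_bounds(1) by (simp add: pos_le_divide_eq mult.commute)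
    then show ?thesis unfolding n K1_def using n0 by (rule power_mono)
  qed
  have UK2: "(\<integral>\<^sup>+x. ennreal ((indicator \<Omega> x * u \<delta> \<xi> x)\<^sup>2) \<partial>lborel) \<le> ennreal K2"
    if \<delta>: "0 < \<delta>" "\<delta> < \<delta>0" and \<xi>: "\<xi> \<in> param_space" for \<delta> \<xi>
  proof -
    have "S_norm \<gamma>1 \<Omega> \<delta> (u \<delta> \<xi>) < \<infinity>" using uS[OF \<delta> \<xi>] by (simp add: S_space_def)
    then have "(S_norm \<gamma>1 \<Omega> \<delta> (u \<delta> \<xi>))\<^sup>2 < top" by (simp add: power2_eq_square ennreal_mult_less_top)
    then have S: "(S_norm \<gamma>1 \<Omega> \<delta> (u \<delta> \<xi>))\<^sup>2 = ennreal (enn2real ((S_norm \<gamma>1 \<Omega> \<delta> (u \<delta> \<xi>))\<^sup>2))" by simp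
    have "(\<integral>\<^sup>+x. ennreal ((indicator \<Omega> x * u \<delta> \<xi> x)\<^sup>2) \<partial>lborel) = (L2_norm_on \<Omega> (u \<delta> \<xi>))\<^sup>2"
      unfolding L2_norm_on_power2 set_nn_integral_eq_real ..
    also have "\<dots> \<le> ennreal C * (S_norm \<gamma>1 \<Omega> \<delta> (u \<delta> \<xi>))\<^sup>2" by (rule C[OF \<delta> uS[OF \<delta> \<xi>]])
    also have "\<dots> \<le> ennreal (max C 0) * ennreal K1"
      by (subst S, intro mult_mono ennreal_leI SK1[OF \<delta> \<xi>]) auto
    also have "\<dots> = ennreal K2" unfolding K2_def using K by (subst ennreal_mult) auto
    finally show ?thesis .
  qed
  \<comment> \<open>Sequences bounded by \<delta>0 / 2 are enough for a limit at 0. The hypotheses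
    on A concern horizons strictly below \<delta>0, and \<delta>0 / 2 is one such horizon whose
    extended domain contains those of the whole sequence.\<close>
  show ?thesis
  proof (rule tendsto_at_right_sequentially[where b="\<delta>0 / 2"])
    show "0 < \<delta>0 / 2" using poincare(1) by simp
    fix S :: "nat \<Rightarrow> real"
    assume S: "\<And>n. 0 < S n" "\<And>n. S n < \<delta>0 / 2" "S \<longlonglongrightarrow> 0"
    have S0: "S n < \<delta>0" for n using S(2)[of n] poincare(1) by simp
    define G where "G n \<xi> = (\<integral>\<^sup>+x. ennreal ((indicator \<Omega> x * (u (S n) \<xi> x - u0 \<xi> x))\<^sup>2) \<partial>lborel)" for n \<xi>
    have G0: "(\<lambda>n. G n \<xi>) \<longlonglongrightarrow> 0" if \<xi>: "\<xi> \<in> param_space" for \<xi>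
      unfolding G_def
    proof (rule nonlocal_to_local[OF domain kernel _ _ A_bounds(1) S _ _ SK1[OF S(1) S0 \<xi>] UK2[OF S(1) S0 \<xi>]])
      have half: "\<delta>0 / 2 \<in> {0<..<\<delta>0}" using poincare(1) by simp
      show "continuous_on (closure (extended_domain \<Omega> (\<delta>0 / 2) \<times> extended_domain \<Omega> (\<delta>0 / 2))) (\<lambda>(x, y). A x y \<xi>)"
        using A_continuous half \<xi> by blast
      show "r \<le> A x y \<xi> \<and> A x y \<xi> \<le> R" if "x \<in> extended_domain \<Omega> (\<delta>0 / 2)" "y \<in> extended_domain \<Omega> (\<delta>0 / 2)" for x y
        using A_bounds(2) half \<xi> that by blast
      show "u (S n) \<xi> \<in> S_space \<gamma>1 \<Omega> (S n)" for n by (rule uS[OF S(1) S0 \<xi>])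
      show "nonlocal_form \<gamma>1 \<Omega> (S n) (\<lambda>x y. A x y \<xi>) (u (S n) \<xi>) \<phi> = f0 \<phi>" if "\<phi> \<in> test_functions \<Omega>" for n \<phi>
        using ueq[OF S(1) S0 \<xi> test_in_S[OF kernel dom(2,1,3) S(1) that], of n] f_consistent S(1)[of n] S0[of n] that by simp
      show "local_weak_solution \<Omega> (\<lambda>x. A x x \<xi>) f0 (u0 \<xi>)" using local_solution \<xi> by blast
    qed
    \<comment> \<open>The bound on u0 is inherited from the convergence: its squared norm is at most
      2 G n + 2 K2 for every n, hence at most 2 K2 in the limit. Applying the inequality for squares
      of sums once more gives 2 K2 + 2 (2 K2) = 6 K2, independent of n and of the parameter.\<close>
    have Gb: "G n \<xi> \<le> ennreal (6 * K2)" if \<xi>: "\<xi> \<in> param_space" for n \<xi>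
    proof -
      let ?vn = "\<lambda>n x. indicator \<Omega> x * u (S n) \<xi> x" and ?lim = "\<lambda>x. indicator \<Omega> x * u0 \<xi> x"
      let ?I = "\<lambda>g. \<integral>\<^sup>+x. ennreal ((g x :: real)\<^sup>2) \<partial>(lborel :: 'a measure)"
      have vm: "?vn n \<in> borel_measurable borel" for n by (rule S_spaceD(1)[OF dom(1) uS[OF S(1) S0 \<xi>]])
      have "u0 \<xi> \<in> L2_space \<Omega>"
        using local_solution \<xi> by (auto simp: local_weak_solution_def H10_space_def H1_space_def)
      then have v0m: "?lim \<in> borel_measurable borel" by (simp add: L2_space_iff)
      have Geq: "G n \<xi> = ?I (\<lambda>x. ?vn n x + - ?lim x)" "G n \<xi> = ?I (\<lambda>x. ?lim x + - ?vn n x)" for n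
        unfolding G_def by (simp_all add: right_diff_distrib power2_commute)
      have b0: "?I ?lim \<le> 2 * G n \<xi> + 2 * ennreal K2" for n
      proof -
        have "?I ?lim = ?I (\<lambda>x. (?lim x + - ?vn n x) + ?vn n x)" by simp
        also have "\<dots> \<le> 2 * ?I (\<lambda>x. ?lim x + - ?vn n x) + 2 * ?I (?vn n)"
          by (intro nn_integral_power2_add_le borel_measurable_add borel_measurable_uminus vm v0m)
        also have "\<dots> \<le> 2 * G n \<xi> + 2 * ennreal K2"
          unfolding Geq(2) by (intro add_left_mono mult_left_mono UK2[OF S(1) S0 \<xi>]) simp
        finally show ?thesis .
      qed
      have "(\<lambda>n. 2 * G n \<xi> + 2 * ennreal K2) \<longlonglongrightarrow> 2 * 0 + 2 * ennreal K2"
        using G0[OF \<xi>] by (intro tendsto_add tendsto_const ennreal_tendsto_cmult) auto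
      then have v0K: "?I ?lim \<le> 2 * 0 + 2 * ennreal K2"
        by (rule tendsto_lowerbound) (use b0 in auto)
      have "G n \<xi> \<le> 2 * ?I (?vn n) + 2 * ?I (\<lambda>x. - ?lim x)"
        unfolding Geq(1) by (intro nn_integral_power2_add_le borel_measurable_uminus vm v0m)
      also have "\<dots> \<le> 2 * ennreal K2 + 2 * (2 * ennreal K2)"
        using v0K UK2[OF S(1) S0 \<xi>, of n] by (intro add_mono mult_left_mono) auto
      also have "\<dots> = ennreal (6 * K2)"
        using K by (simp add: ennreal_mult distrib_right[symmetric] mult.assoc[symmetric])
      finally show ?thesis .
    qed
    have G: "(\<integral>\<^sup>+\<xi>\<in>param_space. (L2_norm_on \<Omega> (\<lambda>x. u (S n) \<xi> x - u0 \<xi> x))\<^sup>2 * ennreal (\<rho> \<xi>) \<partial>lborel)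
        = (\<integral>\<^sup>+\<xi>. G n \<xi> * ennreal (\<rho> \<xi>) * indicator param_space \<xi> \<partial>lborel)" for n
      unfolding G_def L2_norm_on_power2 set_nn_integral_eq_real ..
    have "(\<lambda>n. \<integral>\<^sup>+\<xi>. G n \<xi> * ennreal (\<rho> \<xi>) * indicator param_space \<xi> \<partial>lborel) \<longlonglongrightarrow> 0"
    proof (rule nn_integral_dominated_null[where w="\<lambda>\<xi>. ennreal (6 * K2) * (ennreal (\<rho> \<xi>) * indicator param_space \<xi>)"])
      have eq: "ennreal (\<rho> \<xi>) * indicator param_space \<xi> = ennreal (indicator param_space \<xi> *\<^sub>R \<rho> \<xi>)" for \<xi>
        by (simp add: indicator_def)
      have rm: "(\<lambda>\<xi>. ennreal (\<rho> \<xi>) * indicator param_space \<xi>) \<in> borel_measurable lborel"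
        unfolding eq using density(2) unfolding set_borel_measurable_def by measurable
      then show "(\<lambda>\<xi>. ennreal (6 * K2) * (ennreal (\<rho> \<xi>) * indicator param_space \<xi>)) \<in> borel_measurable lborel"
        by measurable
      show "(\<integral>\<^sup>+\<xi>. ennreal (6 * K2) * (ennreal (\<rho> \<xi>) * indicator param_space \<xi>) \<partial>lborel) < \<infinity>"
        using density(3) rm by (simp add: nn_integral_cmult)
      show "G n \<xi> * ennreal (\<rho> \<xi>) * indicator param_space \<xi> \<le> ennreal (6 * K2) * (ennreal (\<rho> \<xi>) * indicator param_space \<xi>)" for n \<xi>
        using Gb[of \<xi> n] by (auto simp: indicator_def intro: mult_right_mono)
      show "(\<lambda>n. G n \<xi> * ennreal (\<rho> \<xi>) * indicator param_space \<xi>) \<longlonglongrightarrow> 0" for \<xi>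
      proof (cases "\<xi> \<in> param_space")
        case True
        have "(\<lambda>n. ennreal (\<rho> \<xi>) * G n \<xi>) \<longlonglongrightarrow> ennreal (\<rho> \<xi>) * 0"
          by (rule ennreal_tendsto_cmult[OF _ G0[OF True]]) simp
        then show ?thesis using True by (simp add: mult.commute)
      qed simp
    qed
    then show "(\<lambda>n. L2_tensor_norm \<Omega> \<rho> (\<lambda>\<xi> x. u (S n) \<xi> x - u0 \<xi> x)) \<longlonglongrightarrow> 0"
      unfolding L2_tensor_norm_def esqrt_tendsto_0_iff G .
  qed
qed

end
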